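(* Let $q\in[-1,0)\cup(0,1]$, let $A_q$ be the $C^*$-algebra of the quantum $4$-sphere $S^4_q$ with generators $\alpha,\beta,z$, let $\bar A_q=A_q/\mathbb C\,\mathbb I$, and let $$e=\frac12\begin{pmatrix} 1+z & 0 & \alpha & \beta\\ 0 & 1+z & -q\beta^* & \alpha^*\\ \alpha^* & -q\beta & 1-z & 0\\ \beta^* & \alpha & 0 & 1-z\end{pmatrix}\in \mathrm{Mat}_4(A_q).$$ Then the components $ch_n(e)\in A_q\otimes\bar A_q^{\otimes 2n}$, $n=0,1,2$, of the reduced Chern-Connes character of $e$ are as follows. First, $ch_0(e)=0$. Next, $$ch_1(e)=\tfrac18(1-q^2)\Big\{z\otimes(\beta\otimes\beta^*-\beta^*\otimes\beta)+\beta^*\otimes(z\otimes\beta-\beta\otimes z)+\beta\otimes(\beta^*\otimes z-z\otimes\beta^* )\Big\}.$$ Finally, $$ch_2(e)=\tfrac1{32}\big(z\otimes c_z+\alpha\otimes c_\alpha+\alpha^*\otimes c_{\alpha^*}+\beta\otimes c_\beta+\beta^*\otimes c_{\beta^*}\big),$$ where $$\begin{aligned} c_z={}&(1-q^4)(\beta\otimes\beta^*\otimes\beta\otimes\beta^*-\beta^*\otimes\beta\otimes\beta^*\otimes\beta)\\ &+(1-q^2)\Big\{z\otimes z\otimes(\beta\otimes\beta^*-\beta^*\otimes\beta)+(\beta\otimes z\otimes z\otimes\beta^*-\beta^*\otimes z\otimes z\otimes\beta)\\ &\qquad+(\beta\otimes\beta^*-\beta^*\otimes\beta)\otimes z\otimes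 z+z\otimes(\beta\otimes\beta^*-\beta^*\otimes\beta)\otimes z\\ &\qquad-z\otimes(\beta\otimes z\otimes\beta^*-\beta^*\otimes z\otimes\beta)-(\beta\otimes z\otimes\beta^*-\beta^*\otimes z\otimes\beta)\otimes z\Big\}\\ &+(\alpha\otimes\alpha^*-q^2\alpha^*\otimes\alpha)\otimes(\beta\otimes\beta^*-\beta^*\otimes\beta)\\ &+(\beta\otimes\beta^*-\beta^*\otimes\beta)\otimes(\alpha\otimes\alpha^*-q^2\alpha^*\otimes\alpha)\\ &+(\beta\otimes\alpha-q\,\alpha\otimes\beta)\otimes(\alpha^*\otimes\beta^*-q\,\beta^*\otimes\alpha^* )\\ &+(\alpha^*\otimes\beta^*-q\,\beta^*\otimes\alpha^* )\otimes(\beta\otimes\alpha-q\,\alpha\otimes\beta)\\ &+(\alpha^*\otimes\beta-q\,\beta\otimes\alpha^* )\otimes(q\,\alpha\otimes\beta^*-\beta^*\otimes\alpha)\\ &+(q\,\alpha\otimes\beta^*-\beta^*\otimes\alpha)\otimes(\alpha^*\otimes\beta-q\,\beta\otimes\alpha^* ), \end{aligned}$$ $$\begin{aligned} c_\alpha={}&(z\otimes\alpha^*-\alpha^*\otimes z)\otimes(\beta^*\otimes\beta-\beta\otimes\beta^* )\\ &+q^2(\beta^*\otimes\beta-\beta\otimes\beta^* )\otimes(z\otimes\alpha^*-\alpha^*\otimes z)\\ &+q(z\otimes\beta-\beta\otimes z)\otimes(\alpha^*\otimes\beta^*-q\,\beta^*\otimes\alpha^* )\\ &+(\alpha^*\otimes\beta^*-q\,\beta^*\otimes\alpha^*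 )\otimes(z\otimes\beta-\beta\otimes z)\\ &+q(\beta^*\otimes z-z\otimes\beta^* )\otimes(\alpha^*\otimes\beta-q\,\beta\otimes\alpha^* )\\ &+(\alpha^*\otimes\beta-q\,\beta\otimes\alpha^* )\otimes(\beta^*\otimes z-z\otimes\beta^* ), \end{aligned}$$ $$\begin{aligned} c_{\alpha^*}={}&q^2(z\otimes\alpha-\alpha\otimes z)\otimes(\beta\otimes\beta^*-\beta^*\otimes\beta)\\ &+(\beta\otimes\beta^*-\beta^*\otimes\beta)\otimes(z\otimes\alpha-\alpha\otimes z)\\ &+(\beta^*\otimes z-z\otimes\beta^* )\otimes(\beta\otimes\alpha-q\,\alpha\otimes\beta)\\ &+q(\beta\otimes\alpha-q\,\alpha\otimes\beta)\otimes(\beta^*\otimes z-z\otimes\beta^* )\\ &+(z\otimes\beta-\beta\otimes z)\otimes(\beta^*\otimes\alpha-q\,\alpha\otimes\beta^* )\\ &+q(\beta^*\otimes\alpha-q\,\alpha\otimes\beta^* )\otimes(z\otimes\beta-\beta\otimes z), \end{aligned}$$ $$\begin{aligned} c_\beta={}&(1-q^4)\Big[(\beta^*\otimes z-z\otimes\beta^* )\otimes\beta\otimes\beta^*+\beta^*\otimes\beta\otimes(\beta^*\otimes z-z\otimes\beta^* )\Big]\\ &+(1-q^2)\Big\{\beta^*\otimes z\otimes z\otimes z-z\otimes\beta^*\otimes z\otimes z+z\otimes z\otimes\beta^*\otimes z-z\otimes z\otimes z\otimes\beta^*\Big\}\\ &+(\beta^*\otimes z-z\otimes\beta^* )\otimes(\alpha\otimes\alpha^*-q^2\alpha^*\otimes\alpha)\\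 &+(\alpha\otimes\alpha^*-q^2\alpha^*\otimes\alpha)\otimes(\beta^*\otimes z-z\otimes\beta^* )\\ &+(\alpha\otimes z-z\otimes\alpha)\otimes(\alpha^*\otimes\beta^*-q\,\beta^*\otimes\alpha^* )\\ &+q(\alpha^*\otimes\beta^*-q\,\beta^*\otimes\alpha^* )\otimes(\alpha\otimes z-z\otimes\alpha)\\ &+(\beta^*\otimes\alpha-q\,\alpha\otimes\beta^* )\otimes(\alpha^*\otimes z-z\otimes\alpha^* )\\ &+q(\alpha^*\otimes z-z\otimes\alpha^* )\otimes(\beta^*\otimes\alpha-q\,\alpha\otimes\beta^* ), \end{aligned}$$ $$\begin{aligned} c_{\beta^*}={}&(1-q^4)\Big[(z\otimes\beta-\beta\otimes z)\otimes\beta^*\otimes\beta+\beta\otimes\beta^*\otimes(z\otimes\beta-\beta\otimes z)\Big]\\ &+(1-q^2)\Big\{-\beta\otimes z\otimes z\otimes z+z\otimes\beta\otimes z\otimes z-z\otimes z\otimes\beta\otimes z+z\otimes z\otimes z\otimes\beta\Big\}\\ &+(z\otimes\beta-\beta\otimes z)\otimes(\alpha\otimes\alpha^*-q^2\alpha^*\otimes\alpha)\\ &+(\alpha\otimes\alpha^*-q^2\alpha^*\otimes\alpha)\otimes(z\otimes\beta-\beta\otimes z)\\ &+q(z\otimes\alpha^*-\alpha^*\otimes z)\otimes(\beta\otimes\alpha-q\,\alpha\otimes\beta)\\ &+(\beta\otimes\alpha-q\,\alpha\otimes\beta)\otimes(z\otimes\alpha^*-\alpha^*\otimes z)\\ &+q(\alpha^*\otimes\beta-q\,\beta\otimes\alpha^*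 )\otimes(z\otimes\alpha-\alpha\otimes z)\\ &+(z\otimes\alpha-\alpha\otimes z)\otimes(\alpha^*\otimes\beta-q\,\beta\otimes\alpha^* ). \end{aligned}$$ Contrary to what happens for the classical instanton bundle over $S^4$ (the case $q=1$), the class $ch_1(e)$ does not vanish; the class $ch_2(e)$ does not vanish as well. Moreover $$b\,ch_1(e)=0=B\,ch_0(e),\qquad b\,ch_2(e)=B\,ch_1(e),$$ so that the couple $(ch_1(e),ch_2(e))$ defines a cycle in the $(b,B)$ bicomplex of cyclic homology.
   Context: For $q\in[-1,0)\cup(0,1]$, $A_q$ is the universal unital $C^*$-algebra (unit $\mathbb I$, also written $1$) generated by three elements $\alpha,\beta,z$ subject to the relations $$\beta\alpha=q\alpha\beta,\quad \beta^*\alpha=q\alpha\beta^*,\quad \beta\beta^*=\beta^*\beta,$$ $$z=z^*,\quad z\alpha=\alpha z,\quad z\beta=\beta z,$$ $$\alpha^*\alpha+q^2\beta^*\beta+z^2=\mathbb I,\qquad \alpha\alpha^*+\beta\beta^*+z^2=\mathbb I.$$ The element $e$ is a selfadjoint idempotent, $e^2=e=e^*$; for $q=1$ the algebra $A_q$ is the algebra of continuous functions on $S^4$ and $eA_q^4$ is the module of sections of the classical complex rank two instanton bundle. $\bar A_q=A_q/\mathbb C\,\mathbb I$ is the quotient of $A_q$ by the scalar multiples of the unit; elements of $A_q$ appearing in any tensor slot other than the first are taken modulo multiples of $\mathbb I$, i.e. denote their classes in $\bar A_q$. For $n\ge0$, up to normalization, the components of the reduced Chern-Connes character are $$ch_n(e)=\Big\langle\big(e-\tfrac12\big)\otimes\underbrace{e\otimes\cdots\otimes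 e}_{2n}\Big\rangle\in A_q\otimes\bar A_q^{\otimes 2n},$$ where $\langle\ \rangle$ is the projection on the commutant of the $4\times4$ matrices, taken here in the form $$\langle M_0\otimes\cdots\otimes M_m\rangle=\sum_{i_0,\dots,i_m=1}^4 (M_0)_{i_0i_1}\otimes(M_1)_{i_1i_2}\otimes\cdots\otimes(M_m)_{i_mi_0},\qquad M_j\in\mathrm{Mat}_4(A_q).$$ The operator $b$ is $$b(a_0\otimes\cdots\otimes a_m)=\sum_{j=0}^{m-1}(-1)^j a_0\otimes\cdots\otimes a_ja_{j+1}\otimes\cdots\otimes a_m+(-1)^m a_ma_0\otimes a_1\otimes\cdots\otimes a_{m-1},$$ and $B=AB_0$, where $$B_0(a_0\otimes a_1\otimes\cdots\otimes a_m)=\mathbb I\otimes a_0\otimes a_1\otimes\cdots\otimes a_m,$$ $$A(a_0\otimes a_1\otimes\cdots\otimes a_m)=\frac1m\sum_{j=0}^m(-1)^{mj}a_j\otimes a_{j+1}\otimes\cdots\otimes a_{j-1},$$ with the cyclic identification $m+1=0$.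
   Formalization: With the given normalizations b ch_2 = B ch_1 fails for |q|≠1 (the sides are 1/2 and 1/3 of 1⊗ch_1), so b ch_2 = B((3/2)ch_1) is proved and the cycle is ((3/2)ch_1, ch_2); ch_1≠0 is claimed only for |q|≠1, since ch_1=0 also at q=-1. *)

theory Defs
  imports "HOL-Analysis.Analysis" "HOL-Library.Poly_Mapping"
begin

section \<open>Unital $C^*$-algebras\<close>

class scaleC =
  fixes scaleC :: "complex \<Rightarrow> 'a \<Rightarrow> 'a" (infixr "*\<^sub>C" 75)

class star =
  fixes star :: "'a \<Rightarrow> 'a" ("_\<^sup>\<star>" [1000] 1000)

class cstar_algebra = scaleC + star + real_normed_algebra_1 + banach +
  assumes scaleC_add_right: "c *\<^sub>C (x + y) = c *\<^sub>C x + c *\<^sub>C y"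
    and scaleC_add_left: "(c + d) *\<^sub>C x = c *\<^sub>C x + d *\<^sub>C x"
    and scaleC_scaleC: "c *\<^sub>C d *\<^sub>C x = (c * d) *\<^sub>C x"
    and scaleR_scaleC: "r *\<^sub>R x = complex_of_real r *\<^sub>C x"
    and mult_scaleC_left: "(c *\<^sub>C x) * y = c *\<^sub>C (x * y)"
    and mult_scaleC_right: "x * (c *\<^sub>C y) = c *\<^sub>C (x * y)"
    and norm_scaleC: "norm (c *\<^sub>C x) = cmod c * norm x"
    and star_star: "(x\<^sup>\<star>)\<^sup>\<star> = x"
    and star_add: "(x + y)\<^sup>\<star> = x\<^sup>\<star> + y\<^sup>\<star>"
    and star_scaleC: "(c *\<^sub>C x)\<^sup>\<star> = cnj c *\<^sub>C x\<^sup>\<star>"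
    and star_mult: "(x * y)\<^sup>\<star> = y\<^sup>\<star> * x\<^sup>\<star>"
    and cstar_identity: "norm (x\<^sup>\<star> * x) = (norm x)\<^sup>2"

lemma scaleC_one: "1 *\<^sub>C x = (x :: 'a::cstar_algebra)"
  using scaleR_scaleC[of 1 x] by simp

lemma scaleC_zero_left: "0 *\<^sub>C x = (0 :: 'a::cstar_algebra)"
  using scaleR_scaleC[of 0 x] by simp

lemma scaleC_zero_right: "c *\<^sub>C 0 = (0 :: 'a::cstar_algebra)"
  using scaleC_add_right[of c "0::'a" 0] by simp

lemma star_zero: "0\<^sup>\<star> = (0 :: 'a::cstar_algebra)"
  using star_add[of "0::'a" 0] by simp

lemma star_one: "1\<^sup>\<star> = (1 :: 'a::cstar_algebra)"
  using star_mult[of "1\<^sup>\<star>" "1::'a"] by (simp add: star_star)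

lemma scaleC_sum: "c *\<^sub>C (\<Sum>i\<in>I. f i) = (\<Sum>i\<in>I. c *\<^sub>C (f i :: 'a::cstar_algebra))"
  by (induction I rule: infinite_finite_induct)
     (simp_all add: scaleC_zero_right scaleC_add_right)

lemma star_sum: "(\<Sum>i\<in>I. f i)\<^sup>\<star> = (\<Sum>i\<in>I. (f i :: 'a::cstar_algebra)\<^sup>\<star>)"
  by (induction I rule: infinite_finite_induct) (simp_all add: star_zero star_add)

lemma star_diff: "(x - y :: 'a::cstar_algebra)\<^sup>\<star> = x\<^sup>\<star> - y\<^sup>\<star>"
  using star_add[of "x - y" y] by (simp add: algebra_simps)

lemma norm_star: "norm (x\<^sup>\<star> :: 'a::cstar_algebra) = norm x"
proof -
  have le: "norm y \<le> norm (y\<^sup>\<star>)" for y :: 'a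
  proof (cases "norm y = 0")
    case False
    have "norm y * norm y \<le> norm (y\<^sup>\<star>) * norm y"
      using norm_mult_ineq[of "y\<^sup>\<star>" y] cstar_identity[of y] by (simp add: power2_eq_square)
    with False show ?thesis by simp
  qed simp
  show ?thesis
    using le[of x] le[of "x\<^sup>\<star>"] by (simp add: star_star)
qed


section \<open>Free complex algebras\<close>

text \<open>
  Lists form the free monoid, so the convolution product of finitely supported functions on
  lists is concatenation.
\<close>

instantiation list :: (type) monoid_add
begin
definition zero_list_def: "0 = []"
definition plus_list_def: "xs + ys = xs @ ys"
instance by standard (simp_all add: zero_list_def plus_list_def)
end

type_synonym 'x falg = "'x list \<Rightarrow>\<^sub>0 complex"

abbreviation word :: "'x list \<Rightarrow> 'x falg" where
  "word w \<equiv> Poly_Mapping.single w 1"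

definition fscale :: "complex \<Rightarrow> 'x falg \<Rightarrow> 'x falg" (infixr "\<cdot>" 68) where
  "c \<cdot> p = Poly_Mapping.single [] c * p"

definition extend :: "(complex \<Rightarrow> 'v \<Rightarrow> 'v) \<Rightarrow> ('x list \<Rightarrow> 'v) \<Rightarrow> 'x falg \<Rightarrow> 'v::comm_monoid_add" where
  "extend s f p = (\<Sum>w\<in>Poly_Mapping.keys p. s (Poly_Mapping.lookup p w) (f w))"

lemma fscale_single: "c \<cdot> Poly_Mapping.single w d = Poly_Mapping.single w (c * d)"
  by (simp add: fscale_def mult_single plus_list_def)

lemma fscale_add: "c \<cdot> (p + r) = c \<cdot> p + c \<cdot> r"
  by (simp add: fscale_def algebra_simps)

lemma fscale_diff: "c \<cdot> (p - r) = c \<cdot> p - c \<cdot> r"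
  by (simp add: fscale_def algebra_simps)

lemma fscale_add_left: "(c + d) \<cdot> p = c \<cdot> p + d \<cdot> p"
  by (simp add: fscale_def single_add algebra_simps)

lemma fscale_zero: "0 \<cdot> p = 0" "c \<cdot> 0 = 0"
  by (simp_all add: fscale_def)

lemma fscale_fscale: "c \<cdot> d \<cdot> p = (c * d) \<cdot> p"
  by (simp add: fscale_def mult.assoc[symmetric] mult_single plus_list_def)

lemma fscale_one: "1 \<cdot> p = p"
  by (simp add: fscale_def zero_list_def[symmetric])

lemma fscale_sum: "c \<cdot> (\<Sum>i\<in>I. f i) = (\<Sum>i\<in>I. c \<cdot> f i)"
  by (simp add: fscale_def sum_distrib_left)

lemma extend_superset:
  assumes "finite S" "Poly_Mapping.keys p \<subseteq> S" "\<And>x. s 0 x = 0"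
  shows "extend s f p = (\<Sum>w\<in>S. s (Poly_Mapping.lookup p w) (f w))"
  unfolding extend_def
  using assms by (intro sum.mono_neutral_left) (auto simp: in_keys_iff)

lemma extend_add:
  assumes "\<And>x. s 0 x = 0" "\<And>c d x. s (c + d) x = s c x + s d x"
  shows "extend s f (p + r) = extend s f p + extend s f r"
proof -
  let ?S = "Poly_Mapping.keys p \<union> Poly_Mapping.keys r"
  have "Poly_Mapping.keys (p + r) \<subseteq> ?S" by (rule Poly_Mapping.keys_add)
  then show ?thesis
    using assms
    by (simp add: extend_superset[of ?S] lookup_add sum.distrib)
qed

lemma extend_single:
  assumes "\<And>x. s 0 x = 0"
  shows "extend s f (Poly_Mapping.single w c) = s c (f w)"
  using assms by (cases "c = 0") (simp_all add: extend_def)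

lemma falg_induct [case_names single add]:
  assumes single: "\<And>w c. P (Poly_Mapping.single w c)"
    and add: "\<And>p r. P p \<Longrightarrow> P r \<Longrightarrow> P (p + r)"
  shows "P (p :: 'x falg)"
proof -
  have P0: "P 0" using single[of "[]" 0] by simp
  have "P (\<Sum>w\<in>I. Poly_Mapping.single w (Poly_Mapping.lookup p w))" if "finite I" for I
    using that by (induction I rule: finite_induct) (simp_all add: P0 single add)
  moreover have "p = (\<Sum>w\<in>Poly_Mapping.keys p. Poly_Mapping.single w (Poly_Mapping.lookup p w))"
    by (rule poly_mapping_eqI)
       (auto simp: lookup_sum lookup_single when_def in_keys_iff)
  ultimately show ?thesis
    by (metis finite_keys)
qed


section \<open>The quantum four-sphere\<close>

datatype gen = GAlpha | GBeta | GZ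

text \<open>The letter \<^term>\<open>(g, True)\<close> is the formal adjoint of the generator \<^term>\<open>g\<close>.\<close>

type_synonym free_star = "(gen \<times> bool) falg"

definition fstar :: "free_star \<Rightarrow> free_star" where
  "fstar = extend (\<lambda>c p. cnj c \<cdot> p) (\<lambda>w. word (rev (map (\<lambda>(g, s). (g, \<not> s)) w)))"

fun letter_val :: "'a::cstar_algebra \<Rightarrow> 'a \<Rightarrow> 'a \<Rightarrow> gen \<times> bool \<Rightarrow> 'a" where
  "letter_val \<alpha> \<beta> z (g, s) =
     (let x = (case g of GAlpha \<Rightarrow> \<alpha> | GBeta \<Rightarrow> \<beta> | GZ \<Rightarrow> z) in if s then x\<^sup>\<star> else x)"

definition eval_free :: "'a::cstar_algebra \<Rightarrow> 'a \<Rightarrow> 'a \<Rightarrow> free_star \<Rightarrow> 'a" where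
  "eval_free \<alpha> \<beta> z = extend scaleC (\<lambda>w. prod_list (map (letter_val \<alpha> \<beta> z) w))"

definition sphere_relations :: "real \<Rightarrow> 'a::cstar_algebra \<Rightarrow> 'a \<Rightarrow> 'a \<Rightarrow> bool" where
  "sphere_relations q \<alpha> \<beta> z \<longleftrightarrow>
     \<beta> * \<alpha> = q *\<^sub>R (\<alpha> * \<beta>) \<and> \<beta>\<^sup>\<star> * \<alpha> = q *\<^sub>R (\<alpha> * \<beta>\<^sup>\<star>) \<and> \<beta> * \<beta>\<^sup>\<star> = \<beta>\<^sup>\<star> * \<beta> \<and>
     z = z\<^sup>\<star> \<and> z * \<alpha> = \<alpha> * z \<and> z * \<beta> = \<beta> * z \<and>
     \<alpha>\<^sup>\<star> * \<alpha> + q\<^sup>2 *\<^sub>R (\<beta>\<^sup>\<star> * \<beta>) + z * z = 1 \<and>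
     \<alpha> * \<alpha>\<^sup>\<star> + \<beta> * \<beta>\<^sup>\<star> + z * z = 1"

text \<open>The relations again, as elements of the free unital $*$-algebra that are to vanish.\<close>

definition sphere_relators :: "real \<Rightarrow> free_star set" where
  "sphere_relators q =
    (let \<alpha> = word [(GAlpha, False)]; \<alpha>' = word [(GAlpha, True)];
         \<beta> = word [(GBeta, False)]; \<beta>' = word [(GBeta, True)];
         z = word [(GZ, False)]; z' = word [(GZ, True)]
     in {\<beta> * \<alpha> - q \<cdot> \<alpha> * \<beta>, \<beta>' * \<alpha> - q \<cdot> \<alpha> * \<beta>', \<beta> * \<beta>' - \<beta>' * \<beta>,
         z - z', z * \<alpha> - \<alpha> * z, z * \<beta> - \<beta> * z,
         \<alpha>' * \<alpha> + (q\<^sup>2 \<cdot> \<beta>' * \<beta>) + z * z - 1,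
         \<alpha> * \<alpha>' + \<beta> * \<beta>' + z * z - 1})"

definition cstar_seminorm :: "(free_star \<Rightarrow> real) \<Rightarrow> bool" where
  "cstar_seminorm N \<longleftrightarrow>
     (\<forall>p r. N (p + r) \<le> N p + N r) \<and> (\<forall>c p. N (c \<cdot> p) = cmod c * N p) \<and>
     (\<forall>p r. N (p * r) \<le> N p * N r) \<and> (\<forall>p. N (fstar p * p) = (N p)\<^sup>2)"

text \<open>
  The universal $C^*$-algebra on given generators and relations is the Hausdorff completion of the
  free unital $*$-algebra with respect to the largest $C^*$-seminorm that vanishes on the
  relations.  The predicate says that \<^typ>\<open>'a\<close> with the elements $\alpha,\beta,z$ is this
  completion; the usual universal property is derived in \<open>quantum_sphere_universal\<close> below.
\<close>

definition quantum_sphere :: "real \<Rightarrow> 'a::cstar_algebra \<Rightarrow> 'a \<Rightarrow> 'a \<Rightarrow> bool" where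
  "quantum_sphere q \<alpha> \<beta> z \<longleftrightarrow>
     sphere_relations q \<alpha> \<beta> z \<and>
     closure (range (eval_free \<alpha> \<beta> z)) = UNIV \<and>
     (\<forall>N. cstar_seminorm N \<and> (\<forall>r\<in>sphere_relators q. N r = 0) \<longrightarrow>
          (\<forall>p. N p \<le> norm (eval_free \<alpha> \<beta> z p)))"

lemma eval_add: "eval_free \<alpha> \<beta> z (p + r) = eval_free \<alpha> \<beta> z p + eval_free \<alpha> \<beta> z r"
  unfolding eval_free_def by (rule extend_add) (simp_all add: scaleC_zero_left scaleC_add_left)

lemma eval_single:
  "eval_free \<alpha> \<beta> z (Poly_Mapping.single w c) = c *\<^sub>C prod_list (map (letter_val \<alpha> \<beta> z) w)"
  unfolding eval_free_def by (rule extend_single) (simp add: scaleC_zero_left)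

lemma eval_mult: "eval_free \<alpha> \<beta> z (p * r) = eval_free \<alpha> \<beta> z p * eval_free \<alpha> \<beta> z r"
proof (induction p rule: falg_induct)
  case (single w c)
  show ?case
  proof (induction r rule: falg_induct)
    case (single v d)
    show ?case
      by (simp add: mult_single eval_single plus_list_def mult_scaleC_left mult_scaleC_right
          scaleC_scaleC mult.commute)
  qed (simp add: eval_add algebra_simps)
qed (simp add: eval_add algebra_simps)

lemma eval_one: "eval_free \<alpha> \<beta> z 1 = 1"
proof -
  have "eval_free \<alpha> \<beta> z (word []) = 1" by (simp only: eval_single scaleC_one list.map prod_list.Nil)
  then show ?thesis by (simp add: zero_list_def[symmetric])
qed

lemma eval_scale: "eval_free \<alpha> \<beta> z (c \<cdot> p) = c *\<^sub>C eval_free \<alpha> \<beta> z p"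
  by (simp add: fscale_def eval_mult eval_single mult_scaleC_left)

lemma eval_diff: "eval_free \<alpha> \<beta> z (p - r) = eval_free \<alpha> \<beta> z p - eval_free \<alpha> \<beta> z r"
  using eval_add[of \<alpha> \<beta> z "p - r" r] by (simp add: algebra_simps)

lemma fstar_add: "fstar (p + r) = fstar p + fstar r"
  unfolding fstar_def by (rule extend_add) (simp_all add: fscale_zero fscale_add_left)

lemma eval_fstar: "eval_free \<alpha> \<beta> z (fstar p) = (eval_free \<alpha> \<beta> z p)\<^sup>\<star>"
proof (induction p rule: falg_induct)
  case (single w c)
  have "prod_list (map (letter_val \<alpha> \<beta> z) (rev (map (\<lambda>(g, s). (g, \<not> s)) w)))
      = (prod_list (map (letter_val \<alpha> \<beta> z) w))\<^sup>\<star>"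
    by (induction w) (auto simp: star_one star_mult star_star Let_def)
  then show ?case
    unfolding fstar_def
    by (subst extend_single)
       (simp_all add: fscale_zero fscale_single eval_single star_scaleC)
qed (simp add: fstar_add eval_add star_add)

lemma cstar_seminorm_eval: "cstar_seminorm (\<lambda>p. norm (eval_free \<alpha> \<beta> z p))"
  unfolding cstar_seminorm_def
  by (auto simp: eval_add eval_mult eval_scale eval_fstar norm_scaleC norm_triangle_ineq
      norm_mult_ineq cstar_identity)

lemma eval_relators:
  "(\<forall>r\<in>sphere_relators q. eval_free \<alpha> \<beta> z r = 0) \<longleftrightarrow> sphere_relations q \<alpha> \<beta> z"
  unfolding sphere_relators_def sphere_relations_def
  by (auto simp: Let_def eval_diff eval_add eval_mult eval_scale eval_one eval_single scaleC_one
      scaleR_scaleC)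

definition star_hom :: "('a::cstar_algebra \<Rightarrow> 'b::cstar_algebra) \<Rightarrow> bool" where
  "star_hom \<phi> \<longleftrightarrow> (\<forall>x y. \<phi> (x + y) = \<phi> x + \<phi> y) \<and> (\<forall>c x. \<phi> (c *\<^sub>C x) = c *\<^sub>C \<phi> x) \<and>
     (\<forall>x y. \<phi> (x * y) = \<phi> x * \<phi> y) \<and> (\<forall>x. \<phi> (x\<^sup>\<star>) = (\<phi> x)\<^sup>\<star>) \<and> \<phi> 1 = 1"

lemma quantum_sphere_universal:
  fixes \<alpha> \<beta> z :: "'a::cstar_algebra" and a b c :: "'b::cstar_algebra"
  assumes qs: "quantum_sphere q \<alpha> \<beta> z" and rel: "sphere_relations q a b c"
  shows "\<exists>!\<phi>. star_hom \<phi> \<and> continuous_on UNIV \<phi> \<and> \<phi> \<alpha> = a \<and> \<phi> \<beta> = b \<and> \<phi> z = c"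
proof -
  define ev where "ev = eval_free \<alpha> \<beta> z"
  define ev' where "ev' = eval_free a b c"
  have ev_hom: "ev (p + r) = ev p + ev r" "ev (p * r) = ev p * ev r"
    "ev (k \<cdot> p) = k *\<^sub>C ev p" "ev (fstar p) = (ev p)\<^sup>\<star>"
    "ev' (p + r) = ev' p + ev' r" "ev' (p * r) = ev' p * ev' r"
    "ev' (k \<cdot> p) = k *\<^sub>C ev' p" "ev' (fstar p) = (ev' p)\<^sup>\<star>" for p r k
    by (simp_all add: ev_def ev'_def eval_add eval_mult eval_scale eval_fstar)
  have dense: "closure (range ev) = UNIV"
    using qs by (simp add: quantum_sphere_def ev_def)
  have contr: "norm (ev' p) \<le> norm (ev p)" for p
    using qs cstar_seminorm_eval[of a b c] rel
    by (auto simp: quantum_sphere_def ev_def ev'_def eval_relators[symmetric])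
  have lip: "dist (ev' p) (ev' r) \<le> dist (ev p) (ev r)" for p r
    using contr[of "p - r"] by (simp add: dist_norm ev_def ev'_def eval_diff)
  define f where "f x = ev' (inv ev x)" for x
  have f_ev: "f (ev p) = ev' p" for p
    using lip[of "inv ev (ev p)" p] by (simp add: f_def f_inv_into_f)
  have "uniformly_continuous_on (range ev) f"
    unfolding uniformly_continuous_on_def
  proof (intro allI impI)
    fix \<epsilon> :: real assume "0 < \<epsilon>"
    then show "\<exists>d>0. \<forall>x\<in>range ev. \<forall>x'\<in>range ev. dist x' x < d \<longrightarrow> dist (f x') (f x) < \<epsilon>"
      by (intro exI[of _ \<epsilon>]) (auto simp: f_ev intro: le_less_trans[OF lip])
  qed
  from uniformly_continuous_on_extension_on_closure[OF this]
  obtain g where uc: "uniformly_continuous_on (closure (range ev)) g"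
    and g: "\<And>x. x \<in> range ev \<Longrightarrow> f x = g x"
    by metis
  have cg: "continuous_on UNIV g"
    using uc dense by (simp add: uniformly_continuous_imp_continuous)
  have g_ev: "g (ev p) = ev' p" for p
    using g[of "ev p"] f_ev by simp
  have all: "P x" if "closed {x. P x}" "\<And>p. P (ev p)" for P :: "'a \<Rightarrow> bool" and x
    using closure_minimal[of "range ev" "{x. P x}"] that dense by auto
  have cgI: "continuous_on UNIV (\<lambda>x. g (h x))" if "continuous_on UNIV h" for h :: "'a \<Rightarrow> 'a"
    using continuous_on_compose2[OF cg that] by simp
  have cstar: "continuous_on UNIV (star :: 'c \<Rightarrow> 'c::cstar_algebra)"
    by (rule lipschitz_on_continuous_on[of 1], rule lipschitz_onI)
       (simp_all add: dist_norm norm_star flip: star_diff)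
  have cscale: "continuous_on UNIV (\<lambda>x :: 'c::cstar_algebra. k *\<^sub>C x)" for k
  proof -
    have eq: "k *\<^sub>C x - k *\<^sub>C y = k *\<^sub>C (x - y)" for x y :: 'c
      using scaleC_add_right[of k "x - y" y] by simp
    have "(cmod k)-lipschitz_on UNIV (\<lambda>x :: 'c. k *\<^sub>C x)"
      by (rule lipschitz_onI) (simp_all add: dist_norm eq norm_scaleC)
    then show ?thesis by (rule lipschitz_on_continuous_on)
  qed
  have add: "g (x + y) = g x + g y" for x y
  proof (rule all[of "\<lambda>y. g (x + y) = g x + g y"])
    show "closed {y. g (x + y) = g x + g y}"
      by (intro closed_Collect_eq continuous_intros cgI cg)
    fix p show "g (x + ev p) = g x + g (ev p)"
    proof (rule all[of "\<lambda>x. g (x + ev p) = g x + g (ev p)"])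
      show "closed {x. g (x + ev p) = g x + g (ev p)}"
        by (intro closed_Collect_eq continuous_intros cgI cg)
      fix r show "g (ev r + ev p) = g (ev r) + g (ev p)"
        using g_ev[of "r + p"] by (simp add: g_ev ev_hom)
    qed
  qed
  have mult: "g (x * y) = g x * g y" for x y
  proof (rule all[of "\<lambda>y. g (x * y) = g x * g y"])
    show "closed {y. g (x * y) = g x * g y}"
      by (intro closed_Collect_eq continuous_intros cgI cg)
    fix p show "g (x * ev p) = g x * g (ev p)"
    proof (rule all[of "\<lambda>x. g (x * ev p) = g x * g (ev p)"])
      show "closed {x. g (x * ev p) = g x * g (ev p)}"
        by (intro closed_Collect_eq continuous_intros cgI cg)
      fix r show "g (ev r * ev p) = g (ev r) * g (ev p)"
        using g_ev[of "r * p"] by (simp add: g_ev ev_hom)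
    qed
  qed
  have scale: "g (k *\<^sub>C x) = k *\<^sub>C g x" for k x
  proof (rule all[of "\<lambda>x. g (k *\<^sub>C x) = k *\<^sub>C g x"])
    show "closed {x. g (k *\<^sub>C x) = k *\<^sub>C g x}"
      using continuous_on_compose2[OF cscale cg]
      by (intro closed_Collect_eq cgI cscale) auto
    fix p show "g (k *\<^sub>C ev p) = k *\<^sub>C g (ev p)"
      using g_ev[of "k \<cdot> p"] by (simp add: g_ev ev_hom)
  qed
  have star: "g (x\<^sup>\<star>) = (g x)\<^sup>\<star>" for x
  proof (rule all[of "\<lambda>x. g (x\<^sup>\<star>) = (g x)\<^sup>\<star>"])
    show "closed {x. g (x\<^sup>\<star>) = (g x)\<^sup>\<star>}"
      using continuous_on_compose2[OF cstar cg]
      by (intro closed_Collect_eq cgI cstar) auto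
    fix p show "g ((ev p)\<^sup>\<star>) = (g (ev p))\<^sup>\<star>"
      using g_ev[of "fstar p"] by (simp add: g_ev ev_hom)
  qed
  have gens: "ev (word [(GAlpha, False)]) = \<alpha>" "ev (word [(GBeta, False)]) = \<beta>"
    "ev (word [(GZ, False)]) = z" "ev' (word [(GAlpha, False)]) = a"
    "ev' (word [(GBeta, False)]) = b" "ev' (word [(GZ, False)]) = c"
    by (simp_all add: ev_def ev'_def eval_single scaleC_one)
  have "star_hom g"
    unfolding star_hom_def using add mult scale star g_ev[of 1]
    by (auto simp: ev_def ev'_def eval_one)
  then have ex: "star_hom g \<and> continuous_on UNIV g \<and> g \<alpha> = a \<and> g \<beta> = b \<and> g z = c"
    using cg g_ev[of "word [(GAlpha, False)]"] g_ev[of "word [(GBeta, False)]"]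
      g_ev[of "word [(GZ, False)]"] by (simp add: gens)
  show ?thesis
  proof (rule ex1I[of _ g])
    show "star_hom g \<and> continuous_on UNIV g \<and> g \<alpha> = a \<and> g \<beta> = b \<and> g z = c"
      by (rule ex)
  next
    fix \<phi> assume \<phi>: "star_hom \<phi> \<and> continuous_on UNIV \<phi> \<and> \<phi> \<alpha> = a \<and> \<phi> \<beta> = b \<and> \<phi> z = c"
    have "\<phi> (ev p) = ev' p" for p
    proof (induction p rule: falg_induct)
      case (single w k)
      have "\<phi> (letter_val \<alpha> \<beta> z l) = letter_val a b c l" for l
        using \<phi> by (cases l) (auto simp: star_hom_def Let_def split: gen.splits)
      then have "\<phi> (prod_list (map (letter_val \<alpha> \<beta> z) w)) = prod_list (map (letter_val a b c) w)"
        using \<phi> by (induction w) (auto simp: star_hom_def)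
      then show ?case
        using \<phi> by (simp add: ev_def ev'_def eval_single star_hom_def)
    next
      case (add p r)
      then show ?case using \<phi> by (simp add: ev_def ev'_def eval_add star_hom_def)
    qed
    then have eq: "\<phi> (ev p) = g (ev p)" for p
      by (simp add: g_ev)
    have cl: "closed {x. \<phi> x = g x}"
      using \<phi> by (simp add: closed_Collect_eq cg)
    show "\<phi> = g"
      by (rule ext) (rule all[of "\<lambda>x. \<phi> x = g x", OF cl eq])
  qed
qed


section \<open>Reduced chains\<close>

text \<open>
  The direct sum over $m \ge 0$ of the algebraic tensor products
  $A \otimes \bar A^{\otimes m}$ is presented as a quotient of the free vector space on
  lists: the list $[a_0,\dots,a_m]$ stands for $a_0\otimes\cdots\otimes a_m$, and
  the subspace divided out is spanned by multilinearity in each slot, the lists with the unit in a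
  slot other than the first, and the empty list, which represents no tensor.
\<close>

inductive_set degenerate :: "'a::cstar_algebra falg set" where
  sum: "p \<in> degenerate \<Longrightarrow> r \<in> degenerate \<Longrightarrow> p + r \<in> degenerate"
| additive: "c \<cdot> (word (u @ (x + y) # v) - word (u @ x # v) - word (u @ y # v)) \<in> degenerate"
| homogeneous: "c \<cdot> (word (u @ (k *\<^sub>C x) # v) - (k \<cdot> word (u @ x # v))) \<in> degenerate"
| unit: "u \<noteq> [] \<Longrightarrow> c \<cdot> word (u @ 1 # v) \<in> degenerate"
| empty: "c \<cdot> word [] \<in> degenerate"

lemma degenerate_scale: "p \<in> degenerate \<Longrightarrow> c \<cdot> p \<in> degenerate"
  by (induction rule: degenerate.induct)
     (simp_all add: fscale_add fscale_fscale degenerate.intros)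

lemma degenerate_zero: "0 \<in> degenerate"
  using degenerate.empty[of 0] by (simp add: fscale_zero)

lemma degenerate_uminus: "p \<in> degenerate \<Longrightarrow> - p \<in> degenerate"
  using degenerate_scale[of p "-1"] by (simp add: fscale_def single_uminus zero_list_def[symmetric])

lemma degenerate_diff: "p \<in> degenerate \<Longrightarrow> r \<in> degenerate \<Longrightarrow> p - r \<in> degenerate"
  using degenerate.sum[OF _ degenerate_uminus, of p r] by simp

lemma degenerate_sum: "(\<And>i. i \<in> I \<Longrightarrow> f i \<in> degenerate) \<Longrightarrow> sum f I \<in> degenerate"
  by (induction I rule: infinite_finite_induct) (simp_all add: degenerate_zero degenerate.sum)

definition chain_eq :: "'a::cstar_algebra falg \<Rightarrow> 'a falg \<Rightarrow> bool" where
  "chain_eq p r \<longleftrightarrow> p - r \<in> degenerate"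

lemma equivp_chain_eq: "equivp (chain_eq :: 'a::cstar_algebra falg \<Rightarrow> _)"
proof (rule equivpI)
  show "reflp (chain_eq :: 'a falg \<Rightarrow> _)"
    by (simp add: reflp_def chain_eq_def degenerate_zero)
  show "symp (chain_eq :: 'a falg \<Rightarrow> _)"
    unfolding symp_def chain_eq_def
  proof (intro allI impI)
    fix p r :: "'a falg"
    assume "p - r \<in> degenerate"
    then show "r - p \<in> degenerate" using degenerate_uminus[of "p - r"] by simp
  qed
  show "transp (chain_eq :: 'a falg \<Rightarrow> _)"
    unfolding transp_def chain_eq_def
  proof (intro allI impI)
    fix p r s :: "'a falg"
    assume "p - r \<in> degenerate" "r - s \<in> degenerate"
    then show "p - s \<in> degenerate" using degenerate.sum[of "p - r" "r - s"] by simp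
  qed
qed

quotient_type (overloaded) 'a chain = "'a::cstar_algebra falg" / chain_eq
  by (rule equivp_chain_eq)

definition cls :: "'a::cstar_algebra falg \<Rightarrow> 'a chain" where
  "cls = abs_chain"

instantiation chain :: (cstar_algebra) ab_group_add
begin

lift_definition zero_chain :: "'a chain" is 0 .

lift_definition plus_chain :: "'a chain \<Rightarrow> 'a chain \<Rightarrow> 'a chain" is "(+)"
  unfolding chain_eq_def add_diff_add by (rule degenerate.sum)

lift_definition uminus_chain :: "'a chain \<Rightarrow> 'a chain" is uminus
  unfolding chain_eq_def minus_diff_minus by (rule degenerate_uminus)

lift_definition minus_chain :: "'a chain \<Rightarrow> 'a chain \<Rightarrow> 'a chain" is "(-)"
proof -
  fix p p' r r' :: "'a falg"
  assume "chain_eq p p'" "chain_eq r r'"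
  then show "chain_eq (p - r) (p' - r')"
    using degenerate_diff[of "p - p'" "r - r'"] by (simp add: chain_eq_def algebra_simps)
qed

instance
  by standard (transfer; simp add: chain_eq_def degenerate_zero algebra_simps)+

end

instantiation chain :: (cstar_algebra) scaleC
begin

lift_definition scaleC_chain :: "complex \<Rightarrow> 'a chain \<Rightarrow> 'a chain" is fscale
  unfolding chain_eq_def fscale_diff[symmetric] by (rule degenerate_scale)

instance ..

end

text \<open>The summand $A \otimes \bar A^{\otimes m}$.\<close>

definition chains :: "nat \<Rightarrow> 'a::cstar_algebra chain set" where
  "chains m = {cls p | p. \<forall>w\<in>Poly_Mapping.keys p. length w = Suc m}"

lemma extend_fscale_single: "extend fscale f (Poly_Mapping.single w c) = c \<cdot> f w"
  by (rule extend_single) (simp add: fscale_zero)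

lemma extend_fscale_add: "extend fscale f (p + r) = extend fscale f p + extend fscale f r"
  by (rule extend_add) (simp_all add: fscale_zero fscale_add_left)

lemma extend_fscale_diff: "extend fscale f (p - r) = extend fscale f p - extend fscale f r"
  using extend_fscale_add[of f "p - r" r] by (simp add: algebra_simps)

lemma extend_fscale: "extend fscale f (c \<cdot> p) = c \<cdot> extend fscale f p"
  by (induction p rule: falg_induct)
     (simp_all add: fscale_single fscale_add extend_fscale_single extend_fscale_add fscale_fscale)

lemma extend_degenerate:
  assumes "\<And>u x y v. f (u @ (x + y) # v) - f (u @ x # v) - f (u @ y # v) \<in> degenerate"
    and "\<And>u k x v. f (u @ (k *\<^sub>C x) # v) - (k \<cdot> f (u @ x # v)) \<in> degenerate"
    and "\<And>u v. u \<noteq> [] \<Longrightarrow> f (u @ 1 # v) \<in> degenerate"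
    and "f [] \<in> degenerate"
    and "p \<in> degenerate"
  shows "extend fscale f p \<in> degenerate"
  using assms(5)
  by (induction rule: degenerate.induct)
     (simp_all add: extend_fscale extend_fscale_add extend_fscale_diff extend_fscale_single
       fscale_one degenerate.sum degenerate_scale assms(1-4))

text \<open>On degree $0$ the Hochschild boundary is zero.\<close>

definition face :: "nat \<Rightarrow> 'a::times list \<Rightarrow> 'a list" where
  "face j w = take j w @ (w ! j * w ! Suc j) # drop (j + 2) w"

definition last_face :: "'a::times list \<Rightarrow> 'a list" where
  "last_face w = (last w * hd w) # butlast (tl w)"

definition b_word :: "'a::cstar_algebra list \<Rightarrow> 'a falg" where
  "b_word w = (let m = length w - 1 in
     if m = 0 then 0
     else (\<Sum>j<m. (-1) ^ j \<cdot> word (face j w)) + ((-1) ^ m \<cdot> word (last_face w)))"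

definition B0 :: "'a::cstar_algebra falg \<Rightarrow> 'a falg" where
  "B0 = extend fscale (\<lambda>w. word (1 # w))"

definition A_op :: "'a::cstar_algebra falg \<Rightarrow> 'a falg" where
  "A_op = extend fscale (\<lambda>w. let m = length w - 1 in
     1 / of_nat m \<cdot> (\<Sum>j\<le>m. (-1) ^ (m * j) \<cdot> word (rotate j w)))"

lemma degenerate_additive:
  "word (u @ (x + y) # v) - word (u @ x # v) - word (u @ y # v) \<in> degenerate"
  using degenerate.additive[of 1] by (simp add: fscale_one)

lemma degenerate_homogeneous:
  "word (u @ (k *\<^sub>C x) # v) - (k \<cdot> word (u @ x # v)) \<in> degenerate"
  using degenerate.homogeneous[of 1] by (simp add: fscale_one)

lemma degenerate_unit: "u \<noteq> [] \<Longrightarrow> word (u @ 1 # v) \<in> degenerate"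
  using degenerate.unit[of u 1] by (simp add: fscale_one)

text \<open>\<open>g\<close> acts on the entry after \<open>u\<close> by multiplications from both sides.\<close>

definition slotwise :: "('a::cstar_algebra list \<Rightarrow> 'a list) \<Rightarrow> 'a list \<Rightarrow> 'a list \<Rightarrow> bool" where
  "slotwise g u v \<longleftrightarrow> (\<exists>u' l r v'. \<forall>x. g (u @ x # v) = u' @ (l * x * r) # v')"

lemma slotwise_additive:
  assumes "slotwise g u v"
  shows "word (g (u @ (x + y) # v)) - word (g (u @ x # v)) - word (g (u @ y # v)) \<in> degenerate"
proof -
  obtain u' l r v' where g: "\<And>x. g (u @ x # v) = u' @ (l * x * r) # v'"
    using assms by (auto simp: slotwise_def)
  show ?thesis
    unfolding g using degenerate_additive[of u' "l * x * r" "l * y * r" v']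
    by (simp add: algebra_simps)
qed

lemma slotwise_homogeneous:
  assumes "slotwise g u v"
  shows "word (g (u @ (k *\<^sub>C x) # v)) - (k \<cdot> word (g (u @ x # v))) \<in> degenerate"
proof -
  obtain u' l r v' where g: "\<And>x. g (u @ x # v) = u' @ (l * x * r) # v'"
    using assms by (auto simp: slotwise_def)
  show ?thesis
    unfolding g using degenerate_homogeneous[of u' k "l * x * r" v']
    by (simp add: mult_scaleC_left mult_scaleC_right)
qed

lemma slotwise_sum_additive:
  assumes "\<And>j. j \<in> J \<Longrightarrow> slotwise (g j) u v"
  shows "(\<Sum>j\<in>J. c j \<cdot> word (g j (u @ (x + y) # v))) - (\<Sum>j\<in>J. c j \<cdot> word (g j (u @ x # v)))
    - (\<Sum>j\<in>J. c j \<cdot> word (g j (u @ y # v))) \<in> degenerate"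
  unfolding sum_subtractf[symmetric] fscale_diff[symmetric]
  by (intro degenerate_sum degenerate_scale slotwise_additive assms)

lemma slotwise_sum_homogeneous:
  assumes "\<And>j. j \<in> J \<Longrightarrow> slotwise (g j) u v"
  shows "(\<Sum>j\<in>J. c j \<cdot> word (g j (u @ (k *\<^sub>C x) # v))) - (k \<cdot> (\<Sum>j\<in>J. c j \<cdot> word (g j (u @ x # v))))
    \<in> degenerate"
proof -
  have "(k \<cdot> (\<Sum>j\<in>J. c j \<cdot> word (g j (u @ x # v)))) = (\<Sum>j\<in>J. c j \<cdot> k \<cdot> word (g j (u @ x # v)))"
    by (simp only: fscale_sum fscale_fscale mult.commute)
  then show ?thesis
    unfolding sum_subtractf[symmetric] fscale_diff[symmetric]
    by (simp only: sum_subtractf[symmetric] fscale_diff[symmetric])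
       (intro degenerate_sum degenerate_scale slotwise_homogeneous assms)
qed

lemma slotwise_face:
  assumes "j < length u + length v"
  shows "slotwise (face j) u v"
proof -
  consider (before) "Suc j < length u" | (left) "Suc j = length u" | (right) "j = length u"
    | (after) "length u < j" by linarith
  then show ?thesis
  proof cases
    case before
    then have "face j (u @ x # v) = face j u @ (1 * x * 1) # v" for x
      by (simp add: face_def nth_append)
    then show ?thesis unfolding slotwise_def by blast
  next
    case left
    then have "face j (u @ x # v) = take j u @ (u ! j * x * 1) # v" for x
      by (simp add: face_def nth_append)
    then show ?thesis unfolding slotwise_def by blast
  next
    case right
    then have "face j (u @ x # v) = u @ (1 * x * v ! 0) # drop 1 v" for x
      by (simp add: face_def nth_append)
    then show ?thesis unfolding slotwise_def by blast
  next
    case after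
    define i where "i = j - length u - 1"
    have j: "j = length u + Suc i" using after by (simp add: i_def)
    have "face j (u @ x # v) = u @ (1 * x * 1) # face i v" for x
      by (simp add: face_def nth_append j numeral_3_eq_3)
    then show ?thesis unfolding slotwise_def by blast
  qed
qed

lemma slotwise_last_face:
  assumes "0 < length u + length v"
  shows "slotwise last_face u v"
proof -
  consider (mid) "u \<noteq> []" "v \<noteq> []" | (first) "u = []" "v \<noteq> []" | (last) "u \<noteq> []" "v = []"
    using assms by auto
  then show ?thesis
  proof cases
    case mid
    then have "last_face (u @ x # v) = ((last v * hd u) # tl u) @ (1 * x * 1) # butlast v" for x
      by (simp add: last_face_def butlast_append)
    then show ?thesis unfolding slotwise_def by blast
  next
    case first
    then have "last_face (u @ x # v) = [] @ (last v * x * 1) # butlast v" for x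
      by (simp add: last_face_def)
    then show ?thesis unfolding slotwise_def by blast
  next
    case last
    then have "last_face (u @ x # v) = [] @ (1 * x * hd u) # tl u" for x
      by (simp add: last_face_def butlast_append)
    then show ?thesis unfolding slotwise_def by blast
  qed
qed

lemma face_unit:
  assumes "u \<noteq> []" "j < length u + length v" "Suc j \<noteq> length u" "j \<noteq> length u"
  shows "word (face j (u @ 1 # v)) \<in> (degenerate :: 'a::cstar_algebra falg set)"
proof (cases "j < length u")
  case True
  then have "face j (u @ 1 # v) = face j u @ 1 # v" "face j u \<noteq> []"
    using assms by (auto simp: face_def nth_append)
  then show ?thesis by (simp add: degenerate_unit)
next
  case False
  define i where "i = j - length u - 1"
  have j: "j = length u + Suc i" using False assms by (simp add: i_def)
  have "face j (u @ 1 # v) = u @ 1 # face i v"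
    by (simp add: face_def nth_append j numeral_3_eq_3)
  then show ?thesis using assms by (simp add: degenerate_unit)
qed

lemma b_word_unit:
  assumes "u \<noteq> []"
  shows "b_word (u @ 1 # v) \<in> (degenerate :: 'a::cstar_algebra falg set)"
proof -
  let ?w = "u @ 1 # v :: 'a list"
  let ?t = "\<lambda>j. (-1) ^ j \<cdot> word (face j ?w)"
  define m where "m = length u + length v"
  define k where "k = length u - 1"
  have k: "length u = Suc k" using assms by (cases u) (auto simp: k_def)
  have bw: "b_word ?w = (\<Sum>j<m. ?t j) + ((-1) ^ m \<cdot> word (last_face ?w))"
    using assms by (simp add: b_word_def m_def Let_def)
  have uk: "take k u @ [u ! k] = u"
    using k by (metis lessI take_Suc_conv_app_nth take_all order_refl)
  have fk: "face k ?w = u @ v"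
    using k uk by (simp add: face_def nth_append)
  have cancel: "((-1) ^ j \<cdot> p) + ((-1) ^ Suc j \<cdot> p) = 0" for j and p :: "'a falg"
    by (simp add: fscale_add_left[symmetric] fscale_zero)
  show ?thesis
  proof (cases "v = []")
    case False
    have fk1: "face (Suc k) ?w = u @ v"
      using k False by (cases v) (simp_all add: face_def nth_append)
    have "(\<Sum>j<m. ?t j) = (\<Sum>j\<in>{..<m} - {k, Suc k}. ?t j) + (\<Sum>j\<in>{k, Suc k}. ?t j)"
      using k False by (intro sum.subset_diff) (auto simp: m_def)
    also have "(\<Sum>j\<in>{k, Suc k}. ?t j) = 0"
      using cancel[of k "word (u @ v)"] by (simp add: fk fk1)
    finally have "(\<Sum>j<m. ?t j) \<in> degenerate"
      using assms k by (auto simp: m_def intro!: degenerate_sum degenerate_scale face_unit)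
    moreover have "last_face ?w = ((last v * hd u) # tl u) @ 1 # butlast v"
      using assms False by (simp add: last_face_def butlast_append)
    then have "word (last_face ?w) \<in> degenerate"
      using degenerate_unit[of "(last v * hd u) # tl u" "butlast v"] by simp
    ultimately show ?thesis
      by (simp add: bw degenerate.sum degenerate_scale)
  next
    case True
    have m: "m = Suc k" using True k by (simp add: m_def)
    have "last_face ?w = u"
      using assms True by (simp add: last_face_def butlast_append)
    then have "b_word ?w = (\<Sum>j<k. ?t j)"
      using bw cancel[of k "word u"] fk True by (simp add: m add.assoc)
    then show ?thesis
      using assms k True by (auto intro!: degenerate_sum degenerate_scale face_unit)
  qed
qed

lemma b_word_eq:
  assumes "length u + length v \<noteq> 0"
  shows "b_word (u @ x # v) = (\<Sum>j<length u + length v. (-1) ^ j \<cdot> word (face j (u @ x # v)))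
    + ((-1) ^ (length u + length v) \<cdot> word (last_face (u @ x # v)))"
  using assms by (auto simp: b_word_def Let_def)

lemma b_degenerate:
  assumes "p \<in> degenerate"
  shows "extend fscale b_word p \<in> degenerate"
proof (rule extend_degenerate[where f = b_word, OF _ _ b_word_unit _ assms])
  show "b_word (u @ (x + y) # v) - b_word (u @ x # v) - b_word (u @ y # v) \<in> degenerate"
    for u x y and v :: "'a list"
  proof (cases "length u + length v = 0")
    case False
    let ?m = "length u + length v"
    have "(\<Sum>j<?m. (-1) ^ j \<cdot> word (face j (u @ (x + y) # v)))
        - (\<Sum>j<?m. (-1) ^ j \<cdot> word (face j (u @ x # v)))
        - (\<Sum>j<?m. (-1) ^ j \<cdot> word (face j (u @ y # v))) \<in> degenerate" (is "?s1 \<in> _")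
      by (rule slotwise_sum_additive) (simp add: slotwise_face)
    moreover have "(-1) ^ ?m \<cdot> (word (last_face (u @ (x + y) # v)) - word (last_face (u @ x # v))
        - word (last_face (u @ y # v))) \<in> degenerate" (is "?s2 \<in> _")
      using False by (intro degenerate_scale slotwise_additive slotwise_last_face) auto
    ultimately have "?s1 + ?s2 \<in> degenerate" by (rule degenerate.sum)
    then show ?thesis
      unfolding b_word_eq[OF False] fscale_diff by (simp only: algebra_simps)
  qed (simp add: b_word_def degenerate_zero)
  show "b_word (u @ (k *\<^sub>C x) # v) - (k \<cdot> b_word (u @ x # v)) \<in> degenerate"
    for u k x and v :: "'a list"
  proof (cases "length u + length v = 0")
    case False
    let ?m = "length u + length v"
    have "(\<Sum>j<?m. (-1) ^ j \<cdot> word (face j (u @ (k *\<^sub>C x) # v)))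
        - (k \<cdot> (\<Sum>j<?m. (-1) ^ j \<cdot> word (face j (u @ x # v)))) \<in> degenerate" (is "?s1 \<in> _")
      by (rule slotwise_sum_homogeneous) (simp add: slotwise_face)
    moreover have "(-1) ^ ?m \<cdot> (word (last_face (u @ (k *\<^sub>C x) # v))
        - (k \<cdot> word (last_face (u @ x # v)))) \<in> degenerate" (is "?s2 \<in> _")
      using False by (intro degenerate_scale slotwise_homogeneous slotwise_last_face) auto
    ultimately have "?s1 + ?s2 \<in> degenerate" by (rule degenerate.sum)
    moreover have "((-1) ^ ?m \<cdot> k \<cdot> word (last_face (u @ x # v)))
        = (k \<cdot> (-1) ^ ?m \<cdot> word (last_face (u @ x # v)))"
      by (simp only: fscale_fscale mult.commute)
    ultimately show ?thesis
      unfolding b_word_eq[OF False] fscale_diff fscale_add by (simp only: algebra_simps)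
  qed (simp add: b_word_def degenerate_zero fscale_zero)
  show "b_word [] \<in> degenerate"
    by (simp add: b_word_def degenerate_zero)
qed

lemma slotwise_rotate: "slotwise (rotate j) u v"
proof -
  have "\<exists>u' v'. \<forall>x. rotate j (u @ x # v) = u' @ x # v'"
  proof (induction j)
    case (Suc j)
    then obtain u' v' where r: "\<And>x. rotate j (u @ x # v) = u' @ x # v'" by blast
    show ?case
    proof (cases u')
      case Nil
      then have "\<forall>x. rotate (Suc j) (u @ x # v) = v' @ x # []"
        by (simp add: rotate_def[symmetric] r)
      then show ?thesis by blast
    next
      case (Cons h t)
      then have "\<forall>x. rotate (Suc j) (u @ x # v) = t @ x # (v' @ [h])"
        by (simp add: rotate_def[symmetric] r)
      then show ?thesis by blast
    qed
  qed auto
  then obtain u' v' where "\<forall>x. rotate j (u @ x # v) = u' @ (1 * x * 1) # v'" by auto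
  then show ?thesis unfolding slotwise_def by blast
qed

lemma rotate_two_units:
  "word (rotate j (1 # u @ 1 # v)) \<in> (degenerate :: 'a::cstar_algebra falg set)"
proof -
  let ?n = "\<lambda>w :: 'a list. length (filter (\<lambda>x. x = 1) w)"
  have rot: "?n (rotate j w) = ?n w" for w
  proof (induction j)
    case (Suc j)
    have "?n (rotate1 w) = ?n w" for w by (cases w) auto
    with Suc show ?case by simp
  qed simp
  have "2 \<le> ?n (rotate j (1 # u @ 1 # v))" by (simp add: rot)
  moreover obtain h t where ht: "rotate j (1 # u @ 1 # v) = h # t"
    by (metis list.exhaust list.distinct(1) rotate_is_Nil_conv)
  ultimately have "1 \<le> ?n t" by (auto split: if_splits)
  then have "1 \<in> set t" by (auto simp: Suc_le_eq filter_empty_conv)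
  then obtain u' v' where "t = u' @ 1 # v'" by (auto dest: split_list)
  then show ?thesis
    using degenerate_unit[of "h # u'" v'] ht by simp
qed

lemma B_degenerate:
  assumes "p \<in> degenerate"
  shows "A_op (B0 p) \<in> degenerate"
proof -
  define f :: "'a list \<Rightarrow> 'a falg" where "f w = A_op (word (1 # w))" for w
  have AB: "A_op (B0 r) = extend fscale f r" for r :: "'a falg"
    by (induction r rule: falg_induct)
       (simp_all add: f_def A_op_def B0_def extend_fscale_single extend_fscale_add extend_fscale)
  have f: "f w = 1 / of_nat (length w) \<cdot>
      (\<Sum>j\<le>length w. (-1) ^ (length w * j) \<cdot> word (rotate j (1 # w)))" for w
    by (simp add: f_def A_op_def extend_fscale_single fscale_one Let_def)
  have sl: "slotwise (\<lambda>w. rotate j (1 # w)) u v" for j and u v :: "'a list"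
    using slotwise_rotate[of j "1 # u" v] by (simp add: slotwise_def)
  show ?thesis
    unfolding AB
  proof (rule extend_degenerate[where f = f, OF _ _ _ _ assms])
    show "f (u @ (x + y) # v) - f (u @ x # v) - f (u @ y # v) \<in> degenerate" for u x y v
      unfolding f fscale_diff[symmetric] length_append list.size
      by (intro degenerate_scale slotwise_sum_additive sl)
    show "f (u @ (k *\<^sub>C x) # v) - (k \<cdot> f (u @ x # v)) \<in> degenerate" for u k x v
    proof -
      have "(k \<cdot> f (u @ x # v)) = (1 / of_nat (length (u @ x # v)) \<cdot> k \<cdot>
        (\<Sum>j\<le>length (u @ x # v). (-1) ^ (length (u @ x # v) * j) \<cdot> word (rotate j (1 # u @ x # v))))"
        unfolding f by (simp only: fscale_fscale mult.commute)
      then show ?thesis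
        unfolding f length_append list.size
        by (simp only: fscale_diff[symmetric])
           (intro degenerate_scale slotwise_sum_homogeneous sl)
    qed
    show "f (u @ 1 # v) \<in> degenerate" for u v
      unfolding f by (intro degenerate_scale degenerate_sum rotate_two_units)
    show "f [] \<in> degenerate"
      by (simp add: f fscale_zero degenerate_zero)
  qed
qed

lift_definition hochschild_b :: "'a::cstar_algebra chain \<Rightarrow> 'a chain" is "extend fscale b_word"
  unfolding chain_eq_def extend_fscale_diff[symmetric] by (rule b_degenerate)

text \<open>
  \<^const>\<open>A_op\<close> alone does not descend to reduced chains, its composition with \<^const>\<open>B0\<close> does.
  The factor $1/m$ is then only used for $m \ge 1$.
\<close>

lift_definition connes_B :: "'a::cstar_algebra chain \<Rightarrow> 'a chain" is "\<lambda>p. A_op (B0 p)"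
proof -
  fix p r :: "'a falg"
  assume "chain_eq p r"
  then show "chain_eq (A_op (B0 p)) (A_op (B0 r))"
    using B_degenerate[of "p - r"]
    by (simp add: chain_eq_def A_op_def B0_def extend_fscale_diff)
qed


section \<open>The Chern-Connes character\<close>

definition matrix_contract :: "('a::cstar_algebra ^ 'n ^ 'n) list \<Rightarrow> 'a falg" where
  "matrix_contract Ms = (\<Sum>i | length i = length Ms.
     word (map (\<lambda>j. Ms ! j $ (i ! j) $ (i ! (Suc j mod length Ms))) [0..<length Ms]))"

text \<open>
  The components are those of the character up to a scalar in each degree: if \<open>e\<close> is an
  idempotent, the chains below satisfy $b\,ch_{n+1} = \frac12\, 1\otimes ch_n$,
  whereas $B\,ch_n = \frac1{2n+1}\, 1\otimes ch_n$ (only the summand $j = 0$ of \<^const>\<open>A_op\<close>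
  survives on reduced chains).  Hence $b\,ch_2 = B\,ch_1$ holds after rescaling $ch_1$ by $3/2$.
\<close>

definition ch :: "nat \<Rightarrow> 'a::cstar_algebra ^ 'n ^ 'n \<Rightarrow> 'a chain" where
  "ch n e = cls (matrix_contract ((e - (1/2) *\<^sub>R mat 1) # replicate (2 * n) e))"

definition instanton_projection ::
    "real \<Rightarrow> 'a::cstar_algebra \<Rightarrow> 'a \<Rightarrow> 'a \<Rightarrow> 'a ^ 4 ^ 4" where
  "instanton_projection q \<alpha> \<beta> z = (1/2) *\<^sub>R vector
     [vector [1 + z, 0, \<alpha>, \<beta>],
      vector [0, 1 + z, - (q *\<^sub>R \<beta>\<^sup>\<star>), \<alpha>\<^sup>\<star>],
      vector [\<alpha>\<^sup>\<star>, - (q *\<^sub>R \<beta>), 1 - z, 0],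
      vector [\<beta>\<^sup>\<star>, \<alpha>, 0, 1 - z]]"

text \<open>
  Tensor expressions are written as noncommutative polynomials in the length-one tensors
  \<open>slot x\<close>; \<^const>\<open>cls\<close> takes them to reduced chains.  In the polynomials below
  \<open>\<alpha>'\<close> and \<open>\<beta>'\<close> are the tensors of the adjoints.
\<close>

definition slot :: "'a \<Rightarrow> 'a falg" where
  "slot x = word [x]"

abbreviation tensor :: "'x falg \<Rightarrow> 'x falg \<Rightarrow> 'x falg" (infixr "\<otimes>" 72) where
  "p \<otimes> r \<equiv> p * r"

definition c_z :: "real \<Rightarrow> 'x falg \<Rightarrow> 'x falg \<Rightarrow> 'x falg \<Rightarrow> 'x falg \<Rightarrow> 'x falg \<Rightarrow> 'x falg" where
  "c_z q \<alpha> \<alpha>' \<beta> \<beta>' z =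
     ((1 - q^4) \<cdot> (\<beta> \<otimes> \<beta>' \<otimes> \<beta> \<otimes> \<beta>' - \<beta>' \<otimes> \<beta> \<otimes> \<beta>' \<otimes> \<beta>))
   + ((1 - q^2) \<cdot>
       (z \<otimes> z \<otimes> (\<beta> \<otimes> \<beta>' - \<beta>' \<otimes> \<beta>) + (\<beta> \<otimes> z \<otimes> z \<otimes> \<beta>' - \<beta>' \<otimes> z \<otimes> z \<otimes> \<beta>)
        + (\<beta> \<otimes> \<beta>' - \<beta>' \<otimes> \<beta>) \<otimes> z \<otimes> z + z \<otimes> (\<beta> \<otimes> \<beta>' - \<beta>' \<otimes> \<beta>) \<otimes> z
        - z \<otimes> (\<beta> \<otimes> z \<otimes> \<beta>' - \<beta>' \<otimes> z \<otimes> \<beta>) - (\<beta> \<otimes> z \<otimes> \<beta>' - \<beta>' \<otimes> z \<otimes> \<beta>) \<otimes> z))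
   + (\<alpha> \<otimes> \<alpha>' - (q^2 \<cdot> \<alpha>' \<otimes> \<alpha>)) \<otimes> (\<beta> \<otimes> \<beta>' - \<beta>' \<otimes> \<beta>)
   + (\<beta> \<otimes> \<beta>' - \<beta>' \<otimes> \<beta>) \<otimes> (\<alpha> \<otimes> \<alpha>' - (q^2 \<cdot> \<alpha>' \<otimes> \<alpha>))
   + (\<beta> \<otimes> \<alpha> - (q \<cdot> \<alpha> \<otimes> \<beta>)) \<otimes> (\<alpha>' \<otimes> \<beta>' - (q \<cdot> \<beta>' \<otimes> \<alpha>'))
   + (\<alpha>' \<otimes> \<beta>' - (q \<cdot> \<beta>' \<otimes> \<alpha>')) \<otimes> (\<beta> \<otimes> \<alpha> - (q \<cdot> \<alpha> \<otimes> \<beta>))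
   + (\<alpha>' \<otimes> \<beta> - (q \<cdot> \<beta> \<otimes> \<alpha>')) \<otimes> ((q \<cdot> \<alpha> \<otimes> \<beta>') - \<beta>' \<otimes> \<alpha>)
   + ((q \<cdot> \<alpha> \<otimes> \<beta>') - \<beta>' \<otimes> \<alpha>) \<otimes> (\<alpha>' \<otimes> \<beta> - (q \<cdot> \<beta> \<otimes> \<alpha>'))"

definition c_alpha :: "real \<Rightarrow> 'x falg \<Rightarrow> 'x falg \<Rightarrow> 'x falg \<Rightarrow> 'x falg \<Rightarrow> 'x falg \<Rightarrow> 'x falg" where
  "c_alpha q \<alpha> \<alpha>' \<beta> \<beta>' z =
     (z \<otimes> \<alpha>' - \<alpha>' \<otimes> z) \<otimes> (\<beta>' \<otimes> \<beta> - \<beta> \<otimes> \<beta>')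
   + (q^2 \<cdot> (\<beta>' \<otimes> \<beta> - \<beta> \<otimes> \<beta>') \<otimes> (z \<otimes> \<alpha>' - \<alpha>' \<otimes> z))
   + (q \<cdot> (z \<otimes> \<beta> - \<beta> \<otimes> z) \<otimes> (\<alpha>' \<otimes> \<beta>' - (q \<cdot> \<beta>' \<otimes> \<alpha>')))
   + (\<alpha>' \<otimes> \<beta>' - (q \<cdot> \<beta>' \<otimes> \<alpha>')) \<otimes> (z \<otimes> \<beta> - \<beta> \<otimes> z)
   + (q \<cdot> (\<beta>' \<otimes> z - z \<otimes> \<beta>') \<otimes> (\<alpha>' \<otimes> \<beta> - (q \<cdot> \<beta> \<otimes> \<alpha>')))
   + (\<alpha>' \<otimes> \<beta> - (q \<cdot> \<beta> \<otimes> \<alpha>')) \<otimes> (\<beta>' \<otimes> z - z \<otimes> \<beta>')"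

definition c_alpha' :: "real \<Rightarrow> 'x falg \<Rightarrow> 'x falg \<Rightarrow> 'x falg \<Rightarrow> 'x falg \<Rightarrow> 'x falg \<Rightarrow> 'x falg" where
  "c_alpha' q \<alpha> \<alpha>' \<beta> \<beta>' z =
     (q^2 \<cdot> (z \<otimes> \<alpha> - \<alpha> \<otimes> z) \<otimes> (\<beta> \<otimes> \<beta>' - \<beta>' \<otimes> \<beta>))
   + (\<beta> \<otimes> \<beta>' - \<beta>' \<otimes> \<beta>) \<otimes> (z \<otimes> \<alpha> - \<alpha> \<otimes> z)
   + (\<beta>' \<otimes> z - z \<otimes> \<beta>') \<otimes> (\<beta> \<otimes> \<alpha> - (q \<cdot> \<alpha> \<otimes> \<beta>))
   + (q \<cdot> (\<beta> \<otimes> \<alpha> - (q \<cdot> \<alpha> \<otimes> \<beta>)) \<otimes> (\<beta>' \<otimes> z - z \<otimes> \<beta>'))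
   + (z \<otimes> \<beta> - \<beta> \<otimes> z) \<otimes> (\<beta>' \<otimes> \<alpha> - (q \<cdot> \<alpha> \<otimes> \<beta>'))
   + (q \<cdot> (\<beta>' \<otimes> \<alpha> - (q \<cdot> \<alpha> \<otimes> \<beta>')) \<otimes> (z \<otimes> \<beta> - \<beta> \<otimes> z))"

definition c_beta :: "real \<Rightarrow> 'x falg \<Rightarrow> 'x falg \<Rightarrow> 'x falg \<Rightarrow> 'x falg \<Rightarrow> 'x falg \<Rightarrow> 'x falg" where
  "c_beta q \<alpha> \<alpha>' \<beta> \<beta>' z =
     ((1 - q^4) \<cdot> ((\<beta>' \<otimes> z - z \<otimes> \<beta>') \<otimes> \<beta> \<otimes> \<beta>' + \<beta>' \<otimes> \<beta> \<otimes> (\<beta>' \<otimes> z - z \<otimes> \<beta>')))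
   + ((1 - q^2) \<cdot>
       (\<beta>' \<otimes> z \<otimes> z \<otimes> z - z \<otimes> \<beta>' \<otimes> z \<otimes> z + z \<otimes> z \<otimes> \<beta>' \<otimes> z - z \<otimes> z \<otimes> z \<otimes> \<beta>'))
   + (\<beta>' \<otimes> z - z \<otimes> \<beta>') \<otimes> (\<alpha> \<otimes> \<alpha>' - (q^2 \<cdot> \<alpha>' \<otimes> \<alpha>))
   + (\<alpha> \<otimes> \<alpha>' - (q^2 \<cdot> \<alpha>' \<otimes> \<alpha>)) \<otimes> (\<beta>' \<otimes> z - z \<otimes> \<beta>')
   + (\<alpha> \<otimes> z - z \<otimes> \<alpha>) \<otimes> (\<alpha>' \<otimes> \<beta>' - (q \<cdot> \<beta>' \<otimes> \<alpha>'))
   + (q \<cdot> (\<alpha>' \<otimes> \<beta>' - (q \<cdot> \<beta>' \<otimes> \<alpha>')) \<otimes> (\<alpha> \<otimes> z - z \<otimes> \<alpha>))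
   + (\<beta>' \<otimes> \<alpha> - (q \<cdot> \<alpha> \<otimes> \<beta>')) \<otimes> (\<alpha>' \<otimes> z - z \<otimes> \<alpha>')
   + (q \<cdot> (\<alpha>' \<otimes> z - z \<otimes> \<alpha>') \<otimes> (\<beta>' \<otimes> \<alpha> - (q \<cdot> \<alpha> \<otimes> \<beta>')))"

definition c_beta' :: "real \<Rightarrow> 'x falg \<Rightarrow> 'x falg \<Rightarrow> 'x falg \<Rightarrow> 'x falg \<Rightarrow> 'x falg \<Rightarrow> 'x falg" where
  "c_beta' q \<alpha> \<alpha>' \<beta> \<beta>' z =
     ((1 - q^4) \<cdot> ((z \<otimes> \<beta> - \<beta> \<otimes> z) \<otimes> \<beta>' \<otimes> \<beta> + \<beta> \<otimes> \<beta>' \<otimes> (z \<otimes> \<beta> - \<beta> \<otimes> z)))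
   + ((1 - q^2) \<cdot>
       (- (\<beta> \<otimes> z \<otimes> z \<otimes> z) + z \<otimes> \<beta> \<otimes> z \<otimes> z - z \<otimes> z \<otimes> \<beta> \<otimes> z + z \<otimes> z \<otimes> z \<otimes> \<beta>))
   + (z \<otimes> \<beta> - \<beta> \<otimes> z) \<otimes> (\<alpha> \<otimes> \<alpha>' - (q^2 \<cdot> \<alpha>' \<otimes> \<alpha>))
   + (\<alpha> \<otimes> \<alpha>' - (q^2 \<cdot> \<alpha>' \<otimes> \<alpha>)) \<otimes> (z \<otimes> \<beta> - \<beta> \<otimes> z)
   + (q \<cdot> (z \<otimes> \<alpha>' - \<alpha>' \<otimes> z) \<otimes> (\<beta> \<otimes> \<alpha> - (q \<cdot> \<alpha> \<otimes> \<beta>)))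
   + (\<beta> \<otimes> \<alpha> - (q \<cdot> \<alpha> \<otimes> \<beta>)) \<otimes> (z \<otimes> \<alpha>' - \<alpha>' \<otimes> z)
   + (q \<cdot> (\<alpha>' \<otimes> \<beta> - (q \<cdot> \<beta> \<otimes> \<alpha>')) \<otimes> (z \<otimes> \<alpha> - \<alpha> \<otimes> z))
   + (z \<otimes> \<alpha> - \<alpha> \<otimes> z) \<otimes> (\<alpha>' \<otimes> \<beta> - (q \<cdot> \<beta> \<otimes> \<alpha>'))"

text \<open>
  A chain $(0, x, y)$ in degrees $0, 2, 4$ of the $(b,B)$ bicomplex; the two equations are its
  cycle condition, in the sign convention $b\,ch_{n+1} = B\,ch_n$.
\<close>

definition bB_cycle :: "'a::cstar_algebra chain \<Rightarrow> 'a chain \<Rightarrow> bool" where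
  "bB_cycle x y \<longleftrightarrow> x \<in> chains 2 \<and> y \<in> chains 4 \<and> hochschild_b x = 0 \<and> hochschild_b y = connes_B x"

end

theory Submission
  imports Defs
begin

text \<open>
  Modulo multilinearity, a chain built from matrices is a trace of a product of matrices over the
  free algebra whose letters are the algebra elements (\<open>matrix_contract_trace\<close>).  All of
  the theorem except the non-vanishing is read off from this form.
  
  \<^emph>\<open>Formulas.\<close>  The entries of $e - \frac12$ contain no unit, and in the later slots the
  units contained in $e$ are invisible, so every factor may be replaced by $\frac12 S$, where
  $S$ is the matrix with entries $\pm z,\alpha,\alpha^*,\beta,\beta^*,-q\beta,-q\beta^*$ viewed as
  free letters.  Hence $ch_n(e) = 2^{-(2n+1)}\,\mathrm{tr}\,S^{2n+1}$ (\<open>ch_eq_trace\<close>), and the three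
  displayed formulas are identities in a free algebra, true before any relation is imposed.
  The entries of $K = S^2$ are the $q$-commutators out of which the polynomials $c_z,\dots$ are
  built, and $\mathrm{tr}\,S^5 = \mathrm{tr}\,S K^2$ is compared letter by letter.
  
  \<^emph>\<open>Boundaries.\<close>  The relations of the sphere give $e^2 = e$
  (\<open>instanton_idempotent\<close>).  For any idempotent, the faces of the character telescope to
  $b\,ch_{n+1} = \frac12\, 1\otimes ch_n$, while $B\,ch_n = \frac1{2n+1}\, 1\otimes ch_n$
  (\<open>hochschild_b_ch\<close>, \<open>connes_B_ch\<close>).  With $ch_0 = 0$ this gives the whole cycle condition.
  
  \<^emph>\<open>Non-vanishing.\<close>  It suffices that $1,\alpha,\alpha^*,\beta,\beta^*,z$ are linearly independent
  in $A_q$ (\<open>sphere_independent\<close>): then products of dual functionals vanishing on the unit are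
  well defined on reduced chains, and they detect the coefficient $\frac18(1-q^2)$ of
  $z\otimes\beta\otimes\beta^*$ in $ch_1$ and the coefficient $\frac1{32}$ of
  $z\otimes\alpha\otimes\alpha^*\otimes\beta\otimes\beta^*$ in $ch_2$.  Independence needs enough
  representations of the relations.  They act by weighted shifts on finitely supported sequences; the
  operator norm of such a representation is a $C^*$-seminorm on the free $*$-algebra, hence
  dominated by the norm of $A_q$ (\<open>star_rep.rep_eq_zero\<close>).
\<close>

section \<open>Free algebras, chains and multilinearity\<close>

lemma cls_eq_iff: "cls p = cls r \<longleftrightarrow> p - r \<in> degenerate"
  unfolding cls_def by (simp add: chain.abs_eq_iff chain_eq_def)

lemma cls_hom:
  "cls 0 = 0" "cls (p + r) = cls p + cls r" "cls (c \<cdot> p) = c *\<^sub>C cls p"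
  unfolding cls_def
  by (simp_all add: zero_chain.abs_eq plus_chain.abs_eq scaleC_chain.abs_eq)

lemma cls_boundaries:
  "hochschild_b (cls p) = cls (extend fscale b_word p)"
  "connes_B (cls p) = cls (A_op (B0 p))"
  unfolding cls_def
  by (simp_all add: hochschild_b.abs_eq connes_B.abs_eq)

lemma word_append: "word (u @ v) = word u * word v"
  by (simp add: mult_single plus_list_def)

lemma word_Nil: "word [] = 1"
  by (simp add: zero_list_def[symmetric])

lemma fscale_mult_left: "(c \<cdot> p) * r = (c \<cdot> p * r)"
  by (simp add: fscale_def mult.assoc)

lemma scalar_commute: "p * Poly_Mapping.single [] c = Poly_Mapping.single [] c * (p :: 'x falg)"
  by (induction p rule: falg_induct) (simp_all add: mult_single plus_list_def mult.commute algebra_simps)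

lemma fscale_mult_right: "p * (c \<cdot> r) = (c \<cdot> p * r)"
  by (simp add: fscale_def mult.assoc[symmetric] scalar_commute)

lemma single_fscale: "Poly_Mapping.single w c = (c \<cdot> word w)"
  by (simp add: fscale_single)

text \<open>
  Multilinearity in a slot can be applied to the right of any prefix, but a unit is negligible only
  after a nonempty prefix.  The set \<open>U\<close> of admissible prefixes is \<^term>\<open>UNIV\<close> in the
  first case and \<^term>\<open>- {[]}\<close> in the second, so that both kinds of rewriting obey one calculus.
\<close>

definition null :: "'a list set \<Rightarrow> 'a::cstar_algebra falg \<Rightarrow> bool" where
  "null U p \<longleftrightarrow> (\<forall>u\<in>U. \<forall>r. word u * p * r \<in> degenerate)"

lemma nullI:
  assumes "\<And>u v. u \<in> U \<Longrightarrow> word u * p * word v \<in> degenerate"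
  shows "null U p"
  unfolding null_def
proof (intro ballI allI)
  fix u r assume u: "u \<in> U"
  show "word u * p * r \<in> degenerate"
  proof (induction r rule: falg_induct)
    case (single w c)
    show ?case
      using degenerate_scale[OF assms[OF u, of w], of c]
      by (simp only: single_fscale[of w c] fscale_mult_right)
  next
    case (add p r)
    then show ?case by (simp add: distrib_left degenerate.sum)
  qed
qed

lemma null_UNIV:
  assumes "null UNIV p"
  shows "s * p * r \<in> degenerate"
proof (induction s rule: falg_induct)
  case (single w c)
  have "word w * p * r \<in> degenerate" using assms by (simp add: null_def)
  from degenerate_scale[OF this, of c] show ?case
    by (simp only: single_fscale[of w c] fscale_mult_left)
next
  case (add p r)
  then show ?case by (simp add: distrib_right degenerate.sum)
qed

lemma null_UNIV_left: "null UNIV p \<Longrightarrow> p * r \<in> degenerate"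
  using null_UNIV[of p 1 r] by simp

lemma null_zero: "null U 0"
  by (simp add: null_def degenerate_zero)

lemma null_add: "null U p \<Longrightarrow> null U r \<Longrightarrow> null U (p + r)"
  by (simp add: null_def distrib_left distrib_right degenerate.sum)

lemma null_scale: "null U p \<Longrightarrow> null U (c \<cdot> p)"
  by (simp add: null_def fscale_mult_left fscale_mult_right degenerate_scale)

lemma null_mult_right: "null U p \<Longrightarrow> null U (p * r)"
  by (simp add: null_def mult.assoc)

lemma null_slot_add: "null U (slot (x + y) - (slot x + slot y))"
proof (rule nullI)
  fix u v
  have "word u * (slot (x + y) - (slot x + slot y)) * word v
    = word (u @ (x + y) # v) - word (u @ x # v) - word (u @ y # v)"
    by (simp add: slot_def algebra_simps mult_single plus_list_def)
  then show "word u * (slot (x + y) - (slot x + slot y)) * word v \<in> degenerate"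
    by (simp add: degenerate_additive)
qed

lemma null_slot_scaleC: "null U (slot (k *\<^sub>C x) - (k \<cdot> slot x))"
proof (rule nullI)
  fix u v
  have "word u * (slot (k *\<^sub>C x) - (k \<cdot> slot x)) * word v
    = word (u @ (k *\<^sub>C x) # v) - (k \<cdot> word (u @ x # v))"
    by (simp add: slot_def algebra_simps mult_single plus_list_def fscale_mult_left fscale_mult_right)
  then show "word u * (slot (k *\<^sub>C x) - (k \<cdot> slot x)) * word v \<in> degenerate"
    by (simp add: degenerate_homogeneous)
qed

lemma null_slot_one: "null (- {[]}) (slot 1)"
  by (rule nullI) (simp add: slot_def degenerate_unit mult_single plus_list_def)

lemma null_slot_zero: "null U (slot 0)"
  using null_slot_scaleC[of U 0 0] by (simp add: scaleC_zero_left fscale_zero)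

lemma null_slot_sum: "null U (slot (\<Sum>i\<in>I. f i) - (\<Sum>i\<in>I. slot (f i)))"
proof (induction I rule: infinite_finite_induct)
  case (insert i I)
  from null_add[OF null_slot_add[of U "f i" "sum f I"] insert.IH] insert.hyps
  show ?case by (simp add: algebra_simps)
qed (simp_all add: null_slot_zero)

definition slot_mat :: "'a ^ 'n ^ 'm \<Rightarrow> 'a falg ^ 'n ^ 'm" where
  "slot_mat M = (\<chi> i j. slot (M $ i $ j))"

definition matrix_product :: "('x::semiring_1 ^ 'n ^ 'n) list \<Rightarrow> 'x ^ 'n ^ 'n" where
  "matrix_product Ms = foldr (**) Ms (mat 1)"

lemma matrix_mult_entry: "(A ** B) $ i $ j = (\<Sum>k\<in>UNIV. A $ i $ k * B $ k $ j)"
  by (simp add: matrix_matrix_mult_def)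

lemma matrix_product_simps [simp]: "matrix_product [] = mat 1" "matrix_product (M # Ms) = M ** matrix_product Ms"
  by (simp_all add: matrix_product_def)

lemma matrix_product_append: "matrix_product (Ms @ Ns) = matrix_product Ms ** matrix_product Ns"
  by (induction Ms) (simp_all add: matrix_mul_assoc)

lemma sum_lists_Suc:
  fixes f :: "'i::finite list \<Rightarrow> 'b::comm_monoid_add"
  shows "(\<Sum>is | length is = Suc k. f is) = (\<Sum>i\<in>UNIV. \<Sum>is | length is = k. f (i # is))"
proof -
  let ?h = "\<lambda>p :: 'i \<times> 'i list. fst p # snd p" and ?S = "UNIV \<times> {is. length is = k}"
  have "{is :: 'i list. length is = Suc k} = ?h ` ?S"
    by (force simp: length_Suc_conv)
  moreover have "inj_on ?h ?S"
    by (auto simp: inj_on_def)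
  ultimately have "(\<Sum>is | length is = Suc k. f is) = (\<Sum>p\<in>?S. f (?h p))"
    using sum.reindex[of ?h ?S f] by simp
  then show ?thesis
    by (simp add: sum.cartesian_product case_prod_unfold)
qed

text \<open>
  An entry of a product of matrices is a sum over paths from \<open>a\<close> to \<open>b\<close>; \<open>is\<close> lists the
  intermediate indices.
\<close>

lemma slot_mat_path:
  "(slot_mat M ** matrix_product (map slot_mat Ms)) $ a $ b =
    (\<Sum>is | length is = length Ms.
      word (map (\<lambda>j. (M # Ms) ! j $ ((a # is) ! j) $ ((is @ [b]) ! j)) [0..<Suc (length Ms)]))"
proof (induction Ms arbitrary: M a)
  case Nil
  show ?case by (simp add: slot_mat_def slot_def)
next
  case (Cons N Ms)
  have split: "map f [0..<Suc (Suc n)] = f 0 # map (\<lambda>j. f (Suc j)) [0..<Suc n]"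
    for f :: "nat \<Rightarrow> 'a" and n
    by (subst upt_conv_Cons) (simp_all del: upt_Suc add: map_Suc_upt[symmetric] o_def)
  have "(slot_mat M ** matrix_product (map slot_mat (N # Ms))) $ a $ b
    = (\<Sum>c\<in>UNIV. slot (M $ a $ c) * (slot_mat N ** matrix_product (map slot_mat Ms)) $ c $ b)"
    unfolding list.map matrix_product_simps matrix_mult_entry[of "slot_mat M"] by (simp add: slot_mat_def[of M])
  also have "\<dots> = (\<Sum>c\<in>UNIV. \<Sum>is | length is = length Ms.
      word (map (\<lambda>j. (M # N # Ms) ! j $ ((a # c # is) ! j) $ ((c # is @ [b]) ! j))
        [0..<Suc (Suc (length Ms))]))"
    unfolding Cons.IH sum_distrib_left split slot_def
    by (simp add: mult_single plus_list_def del: upt_Suc)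
  also have "\<dots> = (\<Sum>is | length is = length (N # Ms).
      word (map (\<lambda>j. (M # N # Ms) ! j $ ((a # is) ! j) $ ((is @ [b]) ! j))
        [0..<Suc (length (N # Ms))]))"
    unfolding list.size add_Suc_right add_0_right sum_lists_Suc by simp
  finally show ?case .
qed

lemma matrix_contract_trace:
  fixes Ms :: "('a::cstar_algebra ^ 'n ^ 'n) list"
  assumes "Ms \<noteq> []"
  shows "matrix_contract Ms = trace (matrix_product (map slot_mat Ms))"
proof -
  obtain M Ns where Ms: "Ms = M # Ns" using assms by (cases Ms) auto
  have eq: "map (\<lambda>j. Ms ! j $ ((a # is) ! j) $ ((a # is) ! (Suc j mod length Ms))) [0..<length Ms]
      = map (\<lambda>j. Ms ! j $ ((a # is) ! j) $ ((is @ [a]) ! j)) [0..<length Ms]"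
    if "length is = length Ns" for a and "is" :: "'n list"
  proof (rule map_cong[OF refl])
    fix j assume "j \<in> set [0..<length Ms]"
    then have "j < length Ns \<or> j = length Ns" by (auto simp: Ms)
    then have "(a # is) ! (Suc j mod length Ms) = (is @ [a]) ! j"
      by (auto simp: Ms nth_append that)
    then show "Ms ! j $ ((a # is) ! j) $ ((a # is) ! (Suc j mod length Ms))
      = Ms ! j $ ((a # is) ! j) $ ((is @ [a]) ! j)" by simp
  qed
  have "matrix_contract Ms = (\<Sum>a\<in>UNIV. \<Sum>is | length is = length Ns.
      word (map (\<lambda>j. Ms ! j $ ((a # is) ! j) $ ((a # is) ! (Suc j mod length Ms))) [0..<length Ms]))"
    unfolding matrix_contract_def by (simp add: Ms sum_lists_Suc del: upt_Suc)
  also have "\<dots> = (\<Sum>a\<in>UNIV. \<Sum>is | length is = length Ns.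
      word (map (\<lambda>j. Ms ! j $ ((a # is) ! j) $ ((is @ [a]) ! j)) [0..<length Ms]))"
    by (intro sum.cong refl arg_cong[where f = word]) (simp add: eq)
  also have "\<dots> = (\<Sum>a\<in>UNIV. (slot_mat M ** matrix_product (map slot_mat Ns)) $ a $ a)"
    unfolding slot_mat_path by (simp add: Ms del: upt_Suc)
  finally show ?thesis by (simp add: Ms trace_def)
qed

definition null_mat :: "'a list set \<Rightarrow> 'a::cstar_algebra falg ^ 'n ^ 'm \<Rightarrow> bool" where
  "null_mat U P \<longleftrightarrow> (\<forall>i j. null U (P $ i $ j))"

lemma trace_degenerate: "[] \<in> U \<Longrightarrow> null_mat U P \<Longrightarrow> trace P \<in> degenerate"
  unfolding trace_def null_mat_def null_def
  by (intro degenerate_sum) (metis word_Nil mult_1 mult.right_neutral)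

lemma null_sum: "(\<And>i. i \<in> I \<Longrightarrow> null U (f i)) \<Longrightarrow> null U (sum f I)"
  by (induction I rule: infinite_finite_induct) (simp_all add: null_zero null_add)

lemma null_mat_mult_right:
  fixes P :: "'a::cstar_algebra falg ^ 'n ^ 'm" and R :: "'a falg ^ 'k ^ 'n"
  shows "null_mat U P \<Longrightarrow> null_mat U (P ** R)"
  by (simp add: null_mat_def matrix_matrix_mult_def null_sum null_mult_right)

text \<open>
  The letter in front makes every prefix nonempty.  Hence congruences that use the vanishing of units
  may be applied to all factors but the first.
\<close>

lemma null_slot_mult:
  assumes "null (- {[]}) p"
  shows "null U (slot x * p)"
proof (rule nullI)
  fix u v assume "u \<in> U"
  have "word (u @ [x]) * p * word v \<in> degenerate" using assms by (simp add: null_def)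
  then show "word u * (slot x * p) * word v \<in> degenerate"
    by (simp only: word_append slot_def mult.assoc)
qed

lemma null_mat_slot_mult:
  fixes M :: "'a::cstar_algebra ^ 'n ^ 'm" and P :: "'a falg ^ 'k ^ 'n"
  assumes "null_mat (- {[]}) P"
  shows "null_mat U (slot_mat M ** P)"
  using assms by (simp add: null_mat_def matrix_matrix_mult_def slot_mat_def null_sum null_slot_mult)

lemma matrix_diff_distrib:
  fixes A B :: "'x::ring_1 ^ 'n ^ 'm"
  shows "(A - B) ** C = A ** C - B ** C" "D ** (A - B) = D ** A - D ** B"
  by (simp_all add: vec_eq_iff matrix_matrix_mult_def algebra_simps sum_subtractf)

lemma null_mat_add: "null_mat U P \<Longrightarrow> null_mat U R \<Longrightarrow> null_mat U (P + R)"
  by (simp add: null_mat_def null_add)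

text \<open>
  Telescoping: the factors are replaced one by one, with the genuine words on the left and the
  replacements, which may be arbitrary elements, on the right.
\<close>

lemma null_mat_matrix_product_tail:
  assumes "list_all2 (\<lambda>M P. null_mat (- {[]}) (slot_mat M - P)) Ms Ps"
  shows "null_mat (- {[]}) (matrix_product (map slot_mat Ms) - matrix_product Ps)"
  using assms
proof (induction rule: list_all2_induct)
  case Nil
  show ?case by (simp add: null_mat_def null_zero)
next
  case (Cons M Ms P Ps)
  have "matrix_product (map slot_mat (M # Ms)) - matrix_product (P # Ps) =
    slot_mat M ** (matrix_product (map slot_mat Ms) - matrix_product Ps) + (slot_mat M - P) ** matrix_product Ps"
    by (simp add: matrix_diff_distrib)
  with Cons show ?case
    by (simp add: null_mat_add null_mat_slot_mult null_mat_mult_right)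
qed

lemma null_mat_matrix_product:
  assumes "null_mat U (slot_mat M - P)"
    and "list_all2 (\<lambda>M P. null_mat (- {[]}) (slot_mat M - P)) Ms Ps"
  shows "null_mat U (matrix_product (map slot_mat (M # Ms)) - matrix_product (P # Ps))"
proof -
  have "matrix_product (map slot_mat (M # Ms)) - matrix_product (P # Ps) =
    slot_mat M ** (matrix_product (map slot_mat Ms) - matrix_product Ps) + (slot_mat M - P) ** matrix_product Ps"
    by (simp add: matrix_diff_distrib)
  with assms show ?thesis
    by (simp add: null_mat_add null_mat_slot_mult null_mat_mult_right null_mat_matrix_product_tail)
qed

text \<open>
  A face operator multiplies the letters at a fixed position, so it can be evaluated on a product
  only when the length of the left factor is known.
\<close>

definition homog :: "nat \<Rightarrow> 'x falg \<Rightarrow> bool" where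
  "homog k p \<longleftrightarrow> (\<forall>w\<in>Poly_Mapping.keys p. length w = k)"

lemma homog_induct [consumes 1, case_names single add]:
  assumes "homog k p"
    and single: "\<And>w c. length w = k \<Longrightarrow> P (Poly_Mapping.single w c)"
    and add: "\<And>p r. P p \<Longrightarrow> P r \<Longrightarrow> P (p + r)"
  shows "P (p :: 'x falg)"
proof -
  have P0: "P 0" using single[of "replicate k undefined" 0] by simp
  have "P (\<Sum>w\<in>I. Poly_Mapping.single w (Poly_Mapping.lookup p w))"
    if "finite I" "I \<subseteq> Poly_Mapping.keys p" for I
    using that
  proof (induction I rule: finite_induct)
    case (insert w I)
    then show ?case using assms(1) by (simp add: homog_def single add)
  qed (simp add: P0)
  moreover have "p = (\<Sum>w\<in>Poly_Mapping.keys p. Poly_Mapping.single w (Poly_Mapping.lookup p w))"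
    by (rule poly_mapping_eqI)
       (auto simp: lookup_sum lookup_single when_def in_keys_iff)
  ultimately show ?thesis
    by (metis finite_keys order_refl)
qed

lemma homog_sum: "(\<And>i. i \<in> I \<Longrightarrow> homog k (f i)) \<Longrightarrow> homog k (sum f I)"
  unfolding homog_def using Poly_Mapping.keys_sum[of f I] by fastforce

lemma homog_mult:
  assumes "homog k p" "homog l r"
  shows "homog (k + l) (p * r)"
  unfolding homog_def
proof
  fix w assume "w \<in> Poly_Mapping.keys (p * r)"
  then obtain u v where "u \<in> Poly_Mapping.keys p" "v \<in> Poly_Mapping.keys r" "w = u + v"
    using Poly_Mapping.keys_mult[of p r] by blast
  with assms show "length w = k + l" by (simp add: homog_def plus_list_def)
qed

lemma homog_slot: "homog 1 (slot x)"
  by (simp add: homog_def slot_def)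

lemma homog_matrix_product: "homog (length Ms) (matrix_product (map slot_mat Ms) $ a $ b)"
proof (induction Ms arbitrary: a)
  case Nil
  show ?case by (simp add: homog_def mat_def zero_list_def)
next
  case (Cons M Ms)
  show ?case
    unfolding list.map matrix_product_simps matrix_mult_entry list.size
    using homog_mult[OF homog_slot Cons.IH] by (intro homog_sum) (simp add: slot_mat_def[of M])
qed

lemma extend_fscale_sum:
  "extend fscale f (\<Sum>i\<in>I. p i) = (\<Sum>i\<in>I. extend fscale f (p i))"
  by (induction I rule: infinite_finite_induct)
    (simp_all add: extend_fscale_add, simp_all add: extend_def)

definition face_map :: "nat \<Rightarrow> 'a::cstar_algebra falg \<Rightarrow> 'a falg" where
  "face_map j = extend fscale (\<lambda>w. word (face j w))"

definition last_face_map :: "'a::cstar_algebra falg \<Rightarrow> 'a falg" where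
  "last_face_map = extend fscale (\<lambda>w. word (last_face w))"

lemma face_map_sum:
  "face_map j (\<Sum>i\<in>I. p i) = (\<Sum>i\<in>I. face_map j (p i))"
  "last_face_map (\<Sum>i\<in>I. p i) = (\<Sum>i\<in>I. last_face_map (p i))"
  by (simp_all add: face_map_def last_face_map_def extend_fscale_sum)

lemma b_homog:
  assumes "homog (Suc m) p" "0 < m"
  shows "extend fscale b_word p =
    (\<Sum>j<m. (-1) ^ j \<cdot> face_map j p) + ((-1) ^ m \<cdot> last_face_map p)"
  using assms(1)
proof (induction p rule: homog_induct)
  case (single w c)
  then show ?case
    using assms(2)
    by (simp add: face_map_def last_face_map_def extend_fscale_single b_word_def Let_def
        fscale_add fscale_sum fscale_fscale mult.commute)
next
  case (add p r)
  then show ?case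
    by (simp add: face_map_def last_face_map_def extend_fscale_add fscale_add sum.distrib algebra_simps)
qed

lemma face_map_split:
  assumes "homog j p"
  shows "face_map j (p * (slot x * (slot y * r))) = p * (slot (x * y) * r)"
  using assms
proof (induction p rule: homog_induct)
  case (single u c)
  show ?case
  proof (induction r rule: falg_induct)
    case (single v d)
    then show ?case
      using \<open>length u = j\<close>
      by (simp add: face_map_def slot_def mult_single plus_list_def extend_fscale_single face_def
          nth_append fscale_single)
  next
    case (add p r)
    then show ?case by (simp add: face_map_def extend_fscale_add distrib_left)
  qed
next
  case (add p r)
  then show ?case by (simp add: face_map_def extend_fscale_add distrib_right)
qed

lemma last_face_map_split:
  "last_face_map (slot x * (r * slot y)) = slot (y * x) * r"
proof (induction r rule: falg_induct)
  case (single v d)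
  then show ?case
    by (simp add: last_face_map_def slot_def mult_single plus_list_def extend_fscale_single
        last_face_def butlast_append fscale_single)
next
  case (add p r)
  then show ?case by (simp add: last_face_map_def extend_fscale_add distrib_left distrib_right)
qed

text \<open>
  An inner face merges two neighbouring factors.  Summation over the index between them turns the
  products of entries into entries of the product, by additivity in the merged slot.
\<close>

lemma face_map_contract:
  fixes M N :: "'a::cstar_algebra ^ 'n ^ 'n"
  shows "face_map (length Us) (matrix_contract (Us @ M # N # Vs)) - matrix_contract (Us @ (M ** N) # Vs) \<in> degenerate"
proof -
  let ?U = "matrix_product (map slot_mat Us)" and ?V = "matrix_product (map slot_mat Vs)"
  have "matrix_contract (Us @ M # N # Vs) = (\<Sum>a\<in>UNIV. \<Sum>c\<in>UNIV. \<Sum>d\<in>UNIV. \<Sum>e\<in>UNIV.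
      ?U $ a $ c * (slot (M $ c $ d) * (slot (N $ d $ e) * ?V $ e $ a)))"
    by (simp add: matrix_contract_trace trace_def matrix_product_append matrix_mult_entry sum_distrib_left
        slot_mat_def[of M] slot_mat_def[of N])
  then have "face_map (length Us) (matrix_contract (Us @ M # N # Vs)) =
      (\<Sum>a\<in>UNIV. \<Sum>c\<in>UNIV. \<Sum>d\<in>UNIV. \<Sum>e\<in>UNIV.
        ?U $ a $ c * (slot (M $ c $ d * N $ d $ e) * ?V $ e $ a))"
    by (simp only: face_map_sum face_map_split[OF homog_matrix_product])
  also have "\<dots> = (\<Sum>a\<in>UNIV. \<Sum>c\<in>UNIV. \<Sum>e\<in>UNIV. \<Sum>d\<in>UNIV.
        ?U $ a $ c * (slot (M $ c $ d * N $ d $ e) * ?V $ e $ a))"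
    by (intro sum.cong refl sum.swap)
  also have "\<dots> = (\<Sum>a\<in>UNIV. \<Sum>c\<in>UNIV. \<Sum>e\<in>UNIV.
        ?U $ a $ c * (\<Sum>d\<in>UNIV. slot (M $ c $ d * N $ d $ e)) * ?V $ e $ a)"
    by (simp add: sum_distrib_left sum_distrib_right mult.assoc)
  finally have 1: "face_map (length Us) (matrix_contract (Us @ M # N # Vs)) = \<dots>" .
  have 2: "matrix_contract (Us @ (M ** N) # Vs) = (\<Sum>a\<in>UNIV. \<Sum>c\<in>UNIV. \<Sum>e\<in>UNIV.
        ?U $ a $ c * slot (\<Sum>d\<in>UNIV. M $ c $ d * N $ d $ e) * ?V $ e $ a)"
    by (simp add: matrix_contract_trace trace_def matrix_product_append matrix_mult_entry[of ?U]
        matrix_mult_entry[of "slot_mat _"] sum_distrib_left)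
      (simp add: slot_mat_def[of "_ ** _"] matrix_mult_entry[of M] mult.assoc)
  have "matrix_contract (Us @ (M ** N) # Vs) - face_map (length Us) (matrix_contract (Us @ M # N # Vs)) \<in> degenerate"
    unfolding 1 2 sum_subtractf[symmetric]
      left_diff_distrib[symmetric] right_diff_distrib[symmetric]
    by (intro degenerate_sum null_UNIV null_slot_sum)
  from degenerate_uminus[OF this] show ?thesis by simp
qed

text \<open>
  The last face closes up the cycle, so the last factor is multiplied to the first one from the left.
\<close>

lemma last_face_map_contract:
  fixes M N :: "'a::cstar_algebra ^ 'n ^ 'n"
  shows "last_face_map (matrix_contract (M # Vs @ [N])) - matrix_contract ((N ** M) # Vs) \<in> degenerate"
proof -
  let ?V = "matrix_product (map slot_mat Vs)"
  have "matrix_contract (M # Vs @ [N]) = (\<Sum>a\<in>UNIV. \<Sum>c\<in>UNIV. \<Sum>d\<in>UNIV.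
      slot (M $ a $ c) * (?V $ c $ d * slot (N $ d $ a)))"
    by (simp add: matrix_contract_trace trace_def matrix_product_append matrix_mult_entry sum_distrib_left
        slot_mat_def[of M] slot_mat_def[of N])
  then have "last_face_map (matrix_contract (M # Vs @ [N])) = (\<Sum>a\<in>UNIV. \<Sum>c\<in>UNIV. \<Sum>d\<in>UNIV.
      slot (N $ d $ a * M $ a $ c) * ?V $ c $ d)"
    by (simp only: face_map_sum last_face_map_split)
  also have "\<dots> = (\<Sum>c\<in>UNIV. \<Sum>a\<in>UNIV. \<Sum>d\<in>UNIV. slot (N $ d $ a * M $ a $ c) * ?V $ c $ d)"
    by (rule sum.swap)
  also have "\<dots> = (\<Sum>c\<in>UNIV. \<Sum>d\<in>UNIV. \<Sum>a\<in>UNIV. slot (N $ d $ a * M $ a $ c) * ?V $ c $ d)"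
    by (intro sum.cong refl sum.swap)
  also have "\<dots> = (\<Sum>d\<in>UNIV. \<Sum>c\<in>UNIV. (\<Sum>a\<in>UNIV. slot (N $ d $ a * M $ a $ c)) * ?V $ c $ d)"
    by (subst sum.swap) (simp add: sum_distrib_right)
  finally have 1: "last_face_map (matrix_contract (M # Vs @ [N])) = \<dots>" .
  have 2: "matrix_contract ((N ** M) # Vs) = (\<Sum>d\<in>UNIV. \<Sum>c\<in>UNIV.
        slot (\<Sum>a\<in>UNIV. N $ d $ a * M $ a $ c) * ?V $ c $ d)"
    unfolding matrix_contract_trace[OF list.distinct(2)] trace_def list.map matrix_product_simps matrix_mult_entry[of "slot_mat _"]
    by (simp add: slot_mat_def[of "_ ** _"] matrix_mult_entry[of N])
  have "matrix_contract ((N ** M) # Vs) - last_face_map (matrix_contract (M # Vs @ [N])) \<in> degenerate"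
    unfolding 1 2 sum_subtractf[symmetric]
      left_diff_distrib[symmetric] right_diff_distrib[symmetric]
    by (intro degenerate_sum null_UNIV_left null_slot_sum)
  from degenerate_uminus[OF this] show ?thesis by simp
qed

section \<open>The boundaries of the character of an idempotent\<close>

lemma cls_sum: "cls (\<Sum>i\<in>I. f i) = (\<Sum>i\<in>I. cls (f i))"
  by (induction I rule: infinite_finite_induct) (simp_all add: cls_hom)

lemma cls_uminus: "(-1) *\<^sub>C cls p = - cls p"
  by (simp add: cls_def scaleC_chain.abs_eq uminus_chain.abs_eq fscale_def single_uminus
      zero_list_def[symmetric])

lemma cls_scale_one: "1 *\<^sub>C cls p = cls p"
  by (simp add: fscale_one flip: cls_hom)

lemma null_mat_slot_mat_add:
  fixes X Y :: "'a::cstar_algebra ^ 'n ^ 'm"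
  shows "null_mat U (slot_mat (X + Y) - (slot_mat X + slot_mat Y))"
  by (simp add: null_mat_def slot_mat_def null_slot_add)

lemma trace_diff: "trace (A - B) = trace A - trace (B :: 'x::ring_1 ^ 'n ^ 'n)"
  by (simp add: trace_def sum_subtractf)

lemma trace_plus: "trace (A + B) = trace A + trace (B :: 'x::ring_1 ^ 'n ^ 'n)"
  by (simp add: trace_def sum.distrib)

lemma matrix_plus_distrib: "(A + B) ** C = A ** C + B ** (C :: 'x::ring_1 ^ 'k ^ 'n)"
  by (simp add: vec_eq_iff matrix_mult_entry algebra_simps sum.distrib)

text \<open>
  In the first slot only multilinearity is available, whence \<^term>\<open>UNIV\<close>.
\<close>

lemma contract_cong_head:
  assumes "null_mat UNIV (slot_mat X - P)"
  shows "cls (matrix_contract (X # Ms)) = cls (trace (P ** matrix_product (map slot_mat Ms)))"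
proof -
  have "trace ((slot_mat X - P) ** matrix_product (map slot_mat Ms)) \<in> degenerate"
    using assms by (intro trace_degenerate[of UNIV] null_mat_mult_right) auto
  then show ?thesis
    by (simp add: cls_eq_iff matrix_contract_trace matrix_diff_distrib trace_diff)
qed

lemma contract_head_add:
  "cls (matrix_contract ((X + Y) # Ms)) = cls (matrix_contract (X # Ms)) + cls (matrix_contract (Y # Ms))"
  by (simp only: contract_cong_head[OF null_mat_slot_mat_add])
    (simp add: matrix_contract_trace matrix_plus_distrib trace_plus cls_hom)

lemma B0_slot: "B0 p = slot 1 * p"
proof (induction p rule: falg_induct)
  case (single w c)
  then show ?case
    by (simp add: B0_def extend_fscale_single slot_def mult_single plus_list_def fscale_single)
next
  case (add p r)
  then show ?case by (simp add: B0_def extend_fscale_add distrib_left)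
qed

text \<open>
  Every proper rotation of $1\otimes a_1\otimes\dots\otimes a_m$ moves the unit into a later slot,
  so only the identity rotation contributes on reduced chains.
\<close>

lemma connes_B_homog:
  assumes "homog m p"
  shows "connes_B (cls p) = (1 / of_nat m) *\<^sub>C cls (B0 p)"
proof -
  have "A_op (B0 p) - (1 / of_nat m \<cdot> B0 p) \<in> degenerate"
    using assms
  proof (induction p rule: homog_induct)
    case (single w c)
    let ?R = "\<lambda>j. (-1) ^ (m * j) \<cdot> word (rotate j (1 # w))"
    have "?R (Suc j) \<in> degenerate" if "j < m" for j
    proof -
      have "rotate (Suc j) (1 # w) = drop j w @ 1 # take j w"
        using that single by (simp add: rotate_drop_take)
      then show ?thesis
        using that single by (simp add: degenerate_scale degenerate_unit)
    qed
    then have "(\<Sum>j<m. ?R (Suc j)) \<in> degenerate"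
      by (intro degenerate_sum) auto
    from degenerate_scale[OF this, of "1 / of_nat m"]
    have "(1 / of_nat m \<cdot> (\<Sum>j\<le>m. ?R j)) - (1 / of_nat m \<cdot> word (1 # w)) \<in> degenerate"
      by (simp add: sum.atMost_shift fscale_add fscale_one)
    from degenerate_scale[OF this, of c] show ?case
      using single
      by (simp add: A_op_def B0_def extend_fscale_single extend_fscale fscale_one Let_def fscale_diff
         fscale_fscale mult.commute)
  next
    case (add p r)
    from degenerate.sum[OF add] show ?case
      by (simp add: A_op_def B0_def extend_fscale_add fscale_add algebra_simps)
  qed
  then show ?thesis by (simp add: cls_boundaries cls_eq_iff flip: cls_hom)
qed

lemma homog_contract: "homog (length Ms) (matrix_contract Ms)"
proof (cases "Ms = []")
  case True
  then show ?thesis by (simp add: matrix_contract_def homog_def zero_list_def)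
next
  case False
  then show ?thesis
    by (simp add: matrix_contract_trace trace_def homog_sum homog_matrix_product)
qed

lemma connes_B_ch:
  "connes_B (ch n e) =
    (1 / of_nat (2 * n + 1)) *\<^sub>C cls (B0 (matrix_contract ((e - (1/2) *\<^sub>R mat 1) # replicate (2 * n) e)))"
  unfolding ch_def
  using connes_B_homog[OF homog_contract[of "(e - (1/2) *\<^sub>R mat 1) # replicate (2 * n) e"]]
  by simp

lemma alternating_sum: "(\<Sum>j<2 * n + 1. (-1) ^ Suc j *\<^sub>C cls p) = - cls p"
proof (induction n)
  case 0
  show ?case by (simp add: cls_uminus)
next
  case (Suc n)
  have "(-1) ^ (2 * n + 2) *\<^sub>C cls p = cls p" "(-1) ^ (2 * n + 3) *\<^sub>C cls p = - cls p"
    by (simp_all add: power_add power_mult cls_uminus cls_scale_one)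
  with Suc show ?case by (simp add: eval_nat_numeral)
qed

lemma scaleC_real_half: "(1/2) *\<^sub>R x = (1/2) *\<^sub>C (x :: 'a::cstar_algebra)"
  by (simp add: scaleR_scaleC)

lemma null_mat_unit_shift:
  fixes e :: "'a::cstar_algebra ^ 'n ^ 'n"
  shows "null_mat (- {[]}) (slot_mat e - slot_mat (e - (1/2) *\<^sub>R mat 1))"
proof -
  have half: "null (- {[]}) (slot ((1/2) *\<^sub>R (1::'a)))"
    using null_add[OF null_slot_scaleC[of _ "1/2" 1] null_scale[OF null_slot_one, of "1/2"]]
    by (simp add: scaleC_real_half)
  have "null (- {[]}) (slot x - slot (x - (1/2) *\<^sub>R 1))" for x :: 'a
    using null_add[OF null_slot_add[of _ "x - (1/2) *\<^sub>R 1" "(1/2) *\<^sub>R 1"] half]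
    by (simp add: algebra_simps)
  then show ?thesis
    by (auto simp: null_mat_def slot_mat_def mat_def null_zero)
qed

text \<open>
  The unit matrix in front decouples its slot from the trace of the remaining product.  The shift by
  $\frac12$ may then be inserted into the next factor, which is no longer in the first slot.
\<close>

lemma contract_unit_head:
  fixes e :: "'a::cstar_algebra ^ 'n ^ 'n"
  shows "cls (matrix_contract (((1/2) *\<^sub>R mat 1) # e # Ms)) =
    (1/2) *\<^sub>C cls (B0 (matrix_contract ((e - (1/2) *\<^sub>R mat 1) # Ms)))"
proof -
  let ?P = "\<chi> i j. if i = j then 1/2 \<cdot> slot 1 else 0 :: 'a falg ^ 'n ^ 'n"
  let ?F = "e - (1/2) *\<^sub>R mat 1"
  let ?R = "matrix_product (map slot_mat Ms)"
  have half: "null U (slot ((1/2) *\<^sub>R (1::'a)) - (1/2 \<cdot> slot 1))" for U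
    unfolding scaleC_real_half by (rule null_slot_scaleC)
  have "null_mat UNIV (slot_mat ((1/2) *\<^sub>R mat 1) - ?P)"
    by (auto simp: null_mat_def slot_mat_def mat_def null_slot_zero half)
  from contract_cong_head[OF this]
  have "cls (matrix_contract (((1/2) *\<^sub>R mat 1) # e # Ms)) = cls (trace (?P ** (slot_mat e ** ?R)))"
    by simp
  also have "trace (?P ** (slot_mat e ** ?R)) = (1/2 \<cdot> slot 1 * trace (slot_mat e ** ?R))"
    by (simp add: trace_def matrix_mult_entry[of ?P] if_distrib[where f = "\<lambda>x. x * _"] sum.delta'
        sum_distrib_left fscale_sum fscale_mult_left cong: if_cong)
  also have "cls \<dots> = cls (1/2 \<cdot> slot 1 * trace (slot_mat ?F ** ?R))"
  proof -
    have "null_mat (- {[]}) ((slot_mat e - slot_mat ?F) ** ?R)"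
      by (rule null_mat_mult_right[OF null_mat_unit_shift])
    then have "word [1] * trace ((slot_mat e - slot_mat ?F) ** ?R) * 1 \<in> degenerate"
      unfolding trace_def sum_distrib_left sum_distrib_right
      by (intro degenerate_sum) (auto simp only: null_mat_def null_def)
    from degenerate_scale[OF this, of "1/2"] show ?thesis
      by (simp add: cls_eq_iff slot_def matrix_diff_distrib trace_diff right_diff_distrib fscale_diff)
  qed
  finally show ?thesis
    by (simp add: B0_slot matrix_contract_trace flip: cls_hom)
qed

text \<open>
  Put $f = e - \frac12$; then $fe = ef = \frac12 e$.  The first and the last face both yield
  $\frac12 e\otimes e\otimes\dots$, together $e\otimes e\otimes\dots$; each of the $2n+1$ faces in
  between yields $\pm f\otimes e\otimes\dots$, and the alternating signs leave one of them, with a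
  minus sign.  The difference has $e - f = \frac12$ in front.
\<close>

lemma hochschild_b_ch:
  fixes e :: "'a::cstar_algebra ^ 'n ^ 'n"
  assumes e: "e ** e = e"
  shows "hochschild_b (ch (Suc n) e) =
    (1/2) *\<^sub>C cls (B0 (matrix_contract ((e - (1/2) *\<^sub>R mat 1) # replicate (2 * n) e)))"
proof -
  let ?F = "e - (1/2) *\<^sub>R mat 1" and ?H = "(1/2) *\<^sub>R e" and ?R = "\<lambda>k. replicate k e"
  let ?p = "matrix_contract (?F # ?R (2 * n + 2))"
  have half: "((1/2) *\<^sub>R mat 1) ** e = ?H" "e ** ((1/2) *\<^sub>R mat 1) = ?H"
    by (simp_all add: vec_eq_iff matrix_mult_entry mat_def if_distrib if_distribR sum.delta sum.delta'
        cong: if_cong)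
  have halves: "x - (1/2) *\<^sub>R x = (1/2) *\<^sub>R x" for x :: 'a
  proof -
    have "(1/2) *\<^sub>R x + (1/2) *\<^sub>R x = x" by (simp flip: scaleR_add_left)
    then show ?thesis by (metis add_diff_cancel)
  qed
  have FH: "?F ** e = ?H" "e ** ?F = ?H"
    unfolding matrix_diff_distrib half e by (simp_all add: vec_eq_iff halves)
  have first: "cls (face_map 0 ?p) = cls (matrix_contract (?H # ?R (2 * n + 1)))"
    using face_map_contract[of "[]" ?F e "?R (2 * n + 1)"] by (simp add: FH cls_eq_iff)
  have inner: "cls (face_map (Suc j) ?p) = cls (matrix_contract (?F # ?R (2 * n + 1)))" if "j < 2 * n + 1" for j
  proof -
    have 1: "?R (2 * n + 2) = ?R j @ e # e # ?R (2 * n - j)"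
      using that by (simp flip: replicate_Suc replicate_add)
    have 2: "?R (2 * n + 1) = ?R j @ e # ?R (2 * n - j)"
      using that by (simp flip: replicate_Suc replicate_add)
    show ?thesis
      unfolding 1 2 using face_map_contract[of "?F # ?R j" e e "?R (2 * n - j)"]
      by (simp add: e cls_eq_iff)
  qed
  have last: "cls (last_face_map ?p) = cls (matrix_contract (?H # ?R (2 * n + 1)))"
    using last_face_map_contract[of ?F "?R (2 * n + 1)" e]
    by (simp add: FH cls_eq_iff replicate_append_same)
  have "hochschild_b (ch (Suc n) e) = cls (extend fscale b_word ?p)"
    by (simp add: ch_def cls_boundaries)
  also have "\<dots> = (\<Sum>j<2 * n + 2. (-1) ^ j *\<^sub>C cls (face_map j ?p)) + (-1) ^ (2 * n + 2) *\<^sub>C cls (last_face_map ?p)"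
    using b_homog[OF homog_contract[of "?F # ?R (2 * n + 2)", simplified length_Cons]]
    by (simp add: cls_hom cls_sum)
  also have "\<dots> = cls (face_map 0 ?p) + (\<Sum>j<2 * n + 1. (-1) ^ Suc j *\<^sub>C cls (face_map (Suc j) ?p))
      + cls (last_face_map ?p)"
    using sum.lessThan_Suc_shift[of "\<lambda>j. (-1) ^ j *\<^sub>C cls (face_map j ?p)" "2 * n + 1"]
    by (simp add: cls_scale_one)
  also have "\<dots> = cls (matrix_contract (?H # ?R (2 * n + 1))) - cls (matrix_contract (?F # ?R (2 * n + 1)))
      + cls (matrix_contract (?H # ?R (2 * n + 1)))"
  proof -
    have "(\<Sum>j<2 * n + 1. (-1) ^ Suc j *\<^sub>C cls (face_map (Suc j) ?p))
      = (\<Sum>j<2 * n + 1. (-1) ^ Suc j *\<^sub>C cls (matrix_contract (?F # ?R (2 * n + 1))))"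
      by (intro sum.cong refl) (simp only: inner lessThan_iff)
    then show ?thesis
      by (simp only: first last alternating_sum add_uminus_conv_diff)
  qed
  also have "\<dots> = cls (matrix_contract (((1/2) *\<^sub>R mat 1) # ?R (2 * n + 1)))"
  proof -
    have "?H + ?H = ?F + (1/2) *\<^sub>R mat 1"
      by (simp add: scaleR_add_left[symmetric])
    then show ?thesis
      using contract_head_add[of ?H ?H "?R (2 * n + 1)"]
        contract_head_add[of ?F "(1/2) *\<^sub>R mat 1" "?R (2 * n + 1)"]
      by (simp add: algebra_simps)
  qed
  also have "\<dots> = (1/2) *\<^sub>C cls (B0 (matrix_contract (?F # ?R (2 * n))))"
    by (simp add: contract_unit_head)
  finally show ?thesis .
qed

lemma ch_in_chains: "c *\<^sub>C ch n e \<in> chains (2 * n)"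
proof -
  let ?p = "c \<cdot> matrix_contract ((e - (1/2) *\<^sub>R mat 1) # replicate (2 * n) e)"
  have "homog (Suc (2 * n)) (matrix_contract ((e - (1/2) *\<^sub>R mat 1) # replicate (2 * n) e))"
    using homog_contract[of "(e - (1/2) *\<^sub>R mat 1) # replicate (2 * n) e"] by simp
  moreover have "homog 0 (Poly_Mapping.single [] c)"
    by (simp add: homog_def)
  ultimately have "homog (0 + Suc (2 * n)) ?p"
    unfolding fscale_def by (intro homog_mult)
  then show ?thesis
    by (auto simp: chains_def homog_def ch_def simp flip: cls_hom)
qed

text \<open>
  The components are not normalized, which accounts for the factor: in degree $n$ the operator $B$
  produces $\frac1{2n+1}$ where $b$ produces $\frac12$.
\<close>

lemma b_ch_eq_B_ch:
  assumes "e ** e = e"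
  shows "hochschild_b (ch (Suc n) e) = connes_B ((of_nat (2 * n + 1) / 2) *\<^sub>C ch n e)"
proof -
  let ?p = "matrix_contract ((e - (1/2) *\<^sub>R mat 1) # replicate (2 * n) e)"
  have B: "connes_B (cls (c \<cdot> ?p)) = c *\<^sub>C connes_B (cls ?p)" for c
    by (simp add: cls_boundaries A_op_def B0_def extend_fscale flip: cls_hom)
  have "connes_B ((of_nat (2 * n + 1) / 2) *\<^sub>C ch n e) = (of_nat (2 * n + 1) / 2) *\<^sub>C connes_B (ch n e)"
    using B by (simp add: ch_def cls_hom)
  also have "\<dots> = cls ((of_nat (2 * n + 1) / 2) \<cdot> (1 / of_nat (2 * n + 1)) \<cdot> B0 ?p)"
    by (simp only: connes_B_ch cls_hom)
  also have "\<dots> = (1/2) *\<^sub>C cls (B0 ?p)"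
    unfolding fscale_fscale by (simp add: cls_hom del: of_nat_Suc of_nat_add)
  finally show ?thesis by (simp add: hochschild_b_ch[OF assms])
qed

section \<open>The trace identities for the instanton matrix\<close>

lemma vector_4:
  "(vector [w, x, y, z] :: 'b::zero ^ 4) $ 1 = w"
  "(vector [w, x, y, z] :: 'b::zero ^ 4) $ 2 = x"
  "(vector [w, x, y, z] :: 'b::zero ^ 4) $ 3 = y"
  "(vector [w, x, y, z] :: 'b::zero ^ 4) $ 4 = z"
  unfolding vector_def by simp_all

lemma fscale_uminus: "c \<cdot> (- p) = - (c \<cdot> p)"
  by (simp add: fscale_def)

text \<open>
  The matrix $2e - 1$, with free letters in place of the generators and their adjoints.
\<close>

definition instanton_poly :: "real \<Rightarrow> 'x falg \<Rightarrow> 'x falg \<Rightarrow> 'x falg \<Rightarrow> 'x falg \<Rightarrow> 'x falg \<Rightarrow> 'x falg ^ 4 ^ 4" where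
  "instanton_poly q a a' b b' t = vector
     [vector [t, 0, a, b],
      vector [0, t, - (q \<cdot> b'), a'],
      vector [a', - (q \<cdot> b), - t, 0],
      vector [b', a, 0, - t]]"

definition instanton_square :: "real \<Rightarrow> 'x falg \<Rightarrow> 'x falg \<Rightarrow> 'x falg \<Rightarrow> 'x falg \<Rightarrow> 'x falg \<Rightarrow> 'x falg ^ 4 ^ 4" where
  "instanton_square q a a' b b' t = vector
     [vector [t * t + a * a' + b * b', b * a - (q \<cdot> a * b), t * a - a * t, t * b - b * t],
      vector [a' * b' - (q \<cdot> b' * a'), t * t + (q^2 \<cdot> b' * b) + a' * a, - (q \<cdot> (t * b' - b' * t)), t * a' - a' * t],
      vector [a' * t - t * a', - (q \<cdot> (b * t - t * b)), a' * a + (q^2 \<cdot> b * b') + t * t, a' * b - (q \<cdot> b * a')],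
      vector [b' * t - t * b', a * t - t * a, b' * a - (q \<cdot> a * b'), b' * b + a * a' + t * t]]"

lemma instanton_square:
  "instanton_poly q a a' b b' t ** instanton_poly q a a' b b' t = instanton_square q a a' b b' t"
  unfolding instanton_poly_def instanton_square_def
  by (simp add: vec_eq_iff forall_4 matrix_mult_entry sum_4 vector_4 fscale_mult_left fscale_mult_right
     fscale_diff fscale_fscale power2_eq_square fscale_uminus fscale_zero)

text \<open>
  Collecting the trace by its leading letter isolates the five polynomials $c_z,\dots,c_{\beta^*}$.
\<close>

lemma trace_instanton_poly_mult:
  "trace (instanton_poly q a a' b b' t ** L) =
    t * (L $ 1 $ 1 + L $ 2 $ 2 - L $ 3 $ 3 - L $ 4 $ 4) + a * (L $ 3 $ 1 + L $ 2 $ 4)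
    + a' * (L $ 1 $ 3 + L $ 4 $ 2) + b * (L $ 4 $ 1 - (q \<cdot> L $ 2 $ 3)) + b' * (L $ 1 $ 4 - (q \<cdot> L $ 3 $ 2))"
  by (simp add: trace_def instanton_poly_def matrix_mult_entry sum_4 vector_4 fscale_mult_left
     fscale_mult_right algebra_simps)

text \<open>
  The scalars are turned into one central element of the free algebra, so that the polynomial
  identities below become plain noncommutative ring identities.
\<close>

lemma fscale_letters:
  fixes q :: real and p :: "'x falg"
  defines "Q \<equiv> Poly_Mapping.single [] (complex_of_real q)"
  shows "(complex_of_real q \<cdot> p) = Q * p"
    and "((complex_of_real q)^2 \<cdot> p) = Q * (Q * p)"
    and "((1 - (complex_of_real q)^2) \<cdot> p) = p - Q * (Q * p)"
    and "((1 - (complex_of_real q)^4) \<cdot> p) = p - Q * (Q * (Q * (Q * p)))"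
proof -
  have 1: "Q * Q = Poly_Mapping.single [] ((complex_of_real q)^2)"
    by (simp add: Q_def mult_single plus_list_def power2_eq_square fscale_uminus fscale_zero)
  have 2: "Q * (Q * (Q * Q)) = Poly_Mapping.single [] ((complex_of_real q)^4)"
    by (simp add: Q_def mult_single plus_list_def eval_nat_numeral)
  have one: "Poly_Mapping.single [] (1::complex) = (1 :: 'x falg)" by (fact word_Nil)
  show "(complex_of_real q \<cdot> p) = Q * p"
    by (simp add: fscale_def Q_def)
  show "((complex_of_real q)^2 \<cdot> p) = Q * (Q * p)"
    by (simp add: fscale_def mult.assoc flip: 1)
  show "((1 - (complex_of_real q)^2) \<cdot> p) = p - Q * (Q * p)"
    by (simp add: fscale_def single_diff one algebra_simps mult.assoc flip: 1)
  show "((1 - (complex_of_real q)^4) \<cdot> p) = p - Q * (Q * (Q * (Q * p)))"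
    by (simp add: fscale_def single_diff one algebra_simps mult.assoc flip: 2)
qed

lemma trace_instanton_poly_3:
  fixes a a' b b' t :: "'x falg"
  shows
  "trace (instanton_poly q a a' b b' t ** instanton_square q a a' b b' t) =
   ((1 - q^2) \<cdot> (t \<otimes> (b \<otimes> b' - b' \<otimes> b) + b' \<otimes> (t \<otimes> b - b \<otimes> t) + b \<otimes> (b' \<otimes> t - t \<otimes> b')))"
proof -
  define Q where "Q = Poly_Mapping.single ([] :: 'x list) (complex_of_real q)"
  have cm: "x * Q = Q * x" "x * (Q * r) = Q * (x * r)" for x r
    unfolding Q_def by (simp_all add: scalar_commute flip: mult.assoc)
  note cm' = cm[of a] cm[of a'] cm[of b] cm[of b'] cm[of t]
  show ?thesis
    unfolding trace_instanton_poly_mult instanton_square_def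
    by (simp add: vector_4 fscale_letters[where 'x='x and q=q, folded Q_def])
      (simp add: algebra_simps cm')
qed

lemma trace_instanton_poly_5:
  fixes q :: real and a a' b b' t :: "'x falg"
  defines "K \<equiv> instanton_square q a a' b b' t"
  shows "trace (instanton_poly q a a' b b' t ** (K ** K)) =
   t \<otimes> c_z q a a' b b' t + a \<otimes> c_alpha q a a' b b' t + a' \<otimes> c_alpha' q a a' b b' t
          + b \<otimes> c_beta q a a' b b' t + b' \<otimes> c_beta' q a a' b b' t"
proof -
  define Q where "Q = Poly_Mapping.single ([] :: 'x list) (complex_of_real q)"
  have cm: "x * Q = Q * x" "x * (Q * r) = Q * (x * r)" for x r
    unfolding Q_def by (simp_all add: scalar_commute flip: mult.assoc)
  \<comment> \<open>Instances only: as a general rewrite rule, commutation with the central element would loop on that element itself.\<close>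
  note cm' = cm[of a] cm[of a'] cm[of b] cm[of b'] cm[of t]
  note K = K_def instanton_square_def vector_4 fscale_letters[where 'x='x and q=q, folded Q_def]
  have z: "(K ** K) $ 1 $ 1 + (K ** K) $ 2 $ 2 - (K ** K) $ 3 $ 3 - (K ** K) $ 4 $ 4 = c_z q a a' b b' t"
    unfolding c_z_def by (simp only: matrix_mult_entry sum_4, simp add: K, simp add: algebra_simps cm')
  have a: "(K ** K) $ 3 $ 1 + (K ** K) $ 2 $ 4 = c_alpha q a a' b b' t"
    unfolding c_alpha_def by (simp only: matrix_mult_entry sum_4, simp add: K, simp add: algebra_simps cm')
  have a': "(K ** K) $ 1 $ 3 + (K ** K) $ 4 $ 2 = c_alpha' q a a' b b' t"
    unfolding c_alpha'_def by (simp only: matrix_mult_entry sum_4, simp add: K, simp add: algebra_simps cm')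
  have b: "(K ** K) $ 4 $ 1 - (q \<cdot> (K ** K) $ 2 $ 3) = c_beta q a a' b b' t"
    unfolding c_beta_def by (simp only: matrix_mult_entry sum_4, simp add: K, simp add: algebra_simps cm')
  have b': "(K ** K) $ 1 $ 4 - (q \<cdot> (K ** K) $ 3 $ 2) = c_beta' q a a' b b' t"
    unfolding c_beta'_def by (simp only: matrix_mult_entry sum_4, simp add: K, simp add: algebra_simps cm')
  show ?thesis
    unfolding trace_instanton_poly_mult z a a' b b' ..
qed

definition scale_mat :: "complex \<Rightarrow> 'x falg ^ 'n ^ 'm \<Rightarrow> 'x falg ^ 'n ^ 'm" where
  "scale_mat c P = (\<chi> i j. c \<cdot> P $ i $ j)"

lemma matrix_product_scale_mat: "matrix_product (replicate k (scale_mat c P)) = scale_mat (c ^ k) (matrix_product (replicate k P))"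
  by (induction k)
    (simp_all add: scale_mat_def vec_eq_iff matrix_mult_entry fscale_one fscale_sum fscale_mult_left
      fscale_mult_right fscale_fscale mult.commute)

text \<open>
  A representation of $e - \frac12$ as $c\,P$ in the first slot, up to multilinearity alone, serves
  all slots: in the later ones $e$ and $e - \frac12$ have the same class.
\<close>

lemma ch_eq_trace:
  fixes e :: "'a::cstar_algebra ^ 'n ^ 'n"
  assumes P: "null_mat UNIV (slot_mat (e - (1/2) *\<^sub>R mat 1) - scale_mat c P)"
  shows "ch n e = cls (c ^ (2 * n + 1) \<cdot> trace (matrix_product (replicate (2 * n + 1) P)))"
proof -
  let ?F = "e - (1/2) *\<^sub>R mat 1"
  have "null_mat (- {[]}) (slot_mat e - slot_mat ?F + (slot_mat ?F - scale_mat c P))"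
    using P by (intro null_mat_add null_mat_unit_shift) (simp add: null_mat_def null_def)
  then have "null_mat (- {[]}) (slot_mat e - scale_mat c P)" by simp
  then have "list_all2 (\<lambda>M P. null_mat (- {[]}) (slot_mat M - P)) (replicate (2 * n) e) (replicate (2 * n) (scale_mat c P))"
    by (simp add: list_all2_conv_all_nth)
  from null_mat_matrix_product[OF P this]
  have "trace (matrix_product (map slot_mat (?F # replicate (2 * n) e)) - matrix_product (replicate (2 * n + 1) (scale_mat c P))) \<in> degenerate"
    by (intro trace_degenerate[of UNIV]) simp_all
  moreover have "trace (matrix_product (replicate (2 * n + 1) (scale_mat c P))) = (c ^ (2 * n + 1) \<cdot> trace (matrix_product (replicate (2 * n + 1) P)))"
    unfolding matrix_product_scale_mat by (simp add: trace_def scale_mat_def fscale_sum)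
  ultimately show ?thesis
    by (simp add: ch_def matrix_contract_trace cls_eq_iff trace_diff del: replicate_Suc)
qed

lemma instanton_traces:
  fixes q :: real and a a' b b' t :: "'x falg"
  shows
  "trace (matrix_product (replicate 1 (instanton_poly q a a' b b' t))) = 0"
  "trace (matrix_product (replicate 3 (instanton_poly q a a' b b' t))) =
   ((1 - q^2) \<cdot> (t \<otimes> (b \<otimes> b' - b' \<otimes> b) + b' \<otimes> (t \<otimes> b - b \<otimes> t) + b \<otimes> (b' \<otimes> t - t \<otimes> b')))"
  "trace (matrix_product (replicate 5 (instanton_poly q a a' b b' t))) =
   t \<otimes> c_z q a a' b b' t + a \<otimes> c_alpha q a a' b b' t + a' \<otimes> c_alpha' q a a' b b' t
          + b \<otimes> c_beta q a a' b b' t + b' \<otimes> c_beta' q a a' b b' t"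
proof -
  let ?S = "instanton_poly q a a' b b' t"
  show "trace (matrix_product (replicate 1 ?S)) = 0"
    by (simp add: trace_def sum_4 instanton_poly_def vector_4)
  show "trace (matrix_product (replicate 3 ?S)) =
   ((1 - q^2) \<cdot> (t \<otimes> (b \<otimes> b' - b' \<otimes> b) + b' \<otimes> (t \<otimes> b - b \<otimes> t) + b \<otimes> (b' \<otimes> t - t \<otimes> b')))"
    using trace_instanton_poly_3[of q a a' b b' t, folded instanton_square] by (simp add: numeral_3_eq_3)
  show "trace (matrix_product (replicate 5 ?S)) =
   t \<otimes> c_z q a a' b b' t + a \<otimes> c_alpha q a a' b b' t + a' \<otimes> c_alpha' q a a' b b' t
          + b \<otimes> c_beta q a a' b b' t + b' \<otimes> c_beta' q a a' b b' t"
    unfolding trace_instanton_poly_5[symmetric] instanton_square[symmetric]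
    by (simp add: eval_nat_numeral matrix_mul_assoc)
qed

lemma instanton_shift:
  "instanton_projection q \<alpha> \<beta> z - (1/2) *\<^sub>R mat 1 = (1/2) *\<^sub>R vector
     [vector [z, 0, \<alpha>, \<beta>],
      vector [0, z, - (q *\<^sub>R \<beta>\<^sup>\<star>), \<alpha>\<^sup>\<star>],
      vector [\<alpha>\<^sup>\<star>, - (q *\<^sub>R \<beta>), - z, 0],
      vector [\<beta>\<^sup>\<star>, \<alpha>, 0, - z]]"
  unfolding instanton_projection_def scaleR_right_diff_distrib[symmetric]
  by (simp add: vec_eq_iff forall_4 vector_4 mat_def)

lemma null_scaled_slot:
  assumes "null U (slot x - p)"
  shows "null U (slot (r *\<^sub>R x) - (r \<cdot> p))"
  unfolding scaleR_scaleC
  using null_add[OF null_slot_scaleC[of U r x] null_scale[OF assms, of r]]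
  by (simp add: fscale_diff)

lemma null_slot_minus:
  assumes "null U (slot x - p)"
  shows "null U (slot (- x) - (- p))"
  using null_scaled_slot[OF assms, of "- 1"]
  by (simp add: fscale_def single_uminus zero_list_def[symmetric])

lemma null_instanton:
  "null_mat U (slot_mat (instanton_projection q \<alpha> \<beta> z - (1/2) *\<^sub>R mat 1)
    - scale_mat (1/2) (instanton_poly q (slot \<alpha>) (slot (\<alpha>\<^sup>\<star>)) (slot \<beta>) (slot (\<beta>\<^sup>\<star>)) (slot z)))"
proof -
  have half: "null U (slot ((1/2) *\<^sub>R x) - (1/2 \<cdot> p))" if "null U (slot x - p)" for x p
    using null_scaled_slot[OF that, of "1/2"] by simp
  have refl: "null U (slot x - slot x)" and zero: "null U (slot 0 - 0)" for x
    by (simp_all add: null_zero null_slot_zero)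
  show ?thesis
    unfolding instanton_shift instanton_poly_def null_mat_def slot_mat_def scale_mat_def forall_4
    unfolding vector_minus_component vec_lambda_beta vector_scaleR_component vector_4
    by (intro conjI half refl zero null_slot_minus null_scaled_slot)
qed

lemma ch_instanton:
  fixes q :: real and \<alpha> \<beta> z :: "'a::cstar_algebra"
  defines "e \<equiv> instanton_projection q \<alpha> \<beta> z"
    and "a \<equiv> slot \<alpha>" and "a' \<equiv> slot (\<alpha>\<^sup>\<star>)" and "b \<equiv> slot \<beta>" and "b' \<equiv> slot (\<beta>\<^sup>\<star>)" and "t \<equiv> slot z"
  shows "ch 0 e = 0"
    and "ch 1 e = cls (1/8 \<cdot> (1 - q^2) \<cdot>
         (t \<otimes> (b \<otimes> b' - b' \<otimes> b) + b' \<otimes> (t \<otimes> b - b \<otimes> t) + b \<otimes> (b' \<otimes> t - t \<otimes> b')))"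
    and "ch 2 e = cls (1/32 \<cdot>
         (t \<otimes> c_z q a a' b b' t + a \<otimes> c_alpha q a a' b b' t + a' \<otimes> c_alpha' q a a' b b' t
          + b \<otimes> c_beta q a a' b b' t + b' \<otimes> c_beta' q a a' b b' t))"
proof -
  \<comment> \<open>The coefficients $\frac12,\frac18,\frac1{32}$ are the powers $(\frac12)^{2n+1}$.\<close>
  note tr = ch_eq_trace[OF null_instanton[of UNIV q \<alpha> \<beta> z, folded e_def a_def a'_def b_def b'_def t_def]]
  show "ch 0 e = 0"
    unfolding tr using instanton_traces(1)[of q a a' b b' t] by (simp add: fscale_zero cls_hom(1))
  show "ch 1 e = cls (1/8 \<cdot> (1 - q^2) \<cdot>
         (t \<otimes> (b \<otimes> b' - b' \<otimes> b) + b' \<otimes> (t \<otimes> b - b \<otimes> t) + b \<otimes> (b' \<otimes> t - t \<otimes> b')))"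
    unfolding tr using instanton_traces(2)[of q a a' b b' t] by (simp add: numeral_3_eq_3)
  show "ch 2 e = cls (1/32 \<cdot>
         (t \<otimes> c_z q a a' b b' t + a \<otimes> c_alpha q a a' b b' t + a' \<otimes> c_alpha' q a a' b b' t
          + b \<otimes> c_beta q a a' b b' t + b' \<otimes> c_beta' q a a' b b' t))"
    unfolding tr instanton_traces(3)[symmetric] by (simp add: eval_nat_numeral)
qed

text \<open>
  Each entry of $e^2 - e$ is a multiple of a defining relation or of the adjoint of one, once
  $\beta\beta^*$ is replaced by $\beta^*\beta$ in the last two diagonal entries.
\<close>

lemma instanton_idempotent:
  fixes q :: real and \<alpha> \<beta> z :: "'a::cstar_algebra"
  assumes "sphere_relations q \<alpha> \<beta> z"
  shows "instanton_projection q \<alpha> \<beta> z ** instanton_projection q \<alpha> \<beta> z = instanton_projection q \<alpha> \<beta> z"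
proof -
  let ?M = "vector
     [vector [1 + z, 0, \<alpha>, \<beta>],
      vector [0, 1 + z, - (q *\<^sub>R \<beta>\<^sup>\<star>), \<alpha>\<^sup>\<star>],
      vector [\<alpha>\<^sup>\<star>, - (q *\<^sub>R \<beta>), 1 - z, 0],
      vector [\<beta>\<^sup>\<star>, \<alpha>, 0, 1 - z]] :: 'a ^ 4 ^ 4"
  have rel: "\<beta> * \<alpha> = q *\<^sub>R (\<alpha> * \<beta>)" "\<beta>\<^sup>\<star> * \<alpha> = q *\<^sub>R (\<alpha> * \<beta>\<^sup>\<star>)" "\<beta> * \<beta>\<^sup>\<star> = \<beta>\<^sup>\<star> * \<beta>"
     "z\<^sup>\<star> = z" "z * \<alpha> = \<alpha> * z" "z * \<beta> = \<beta> * z"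
     "\<alpha>\<^sup>\<star> * \<alpha> = 1 - q\<^sup>2 *\<^sub>R (\<beta>\<^sup>\<star> * \<beta>) - z * z"
     "\<alpha> * \<alpha>\<^sup>\<star> = 1 - \<beta>\<^sup>\<star> * \<beta> - z * z"
    using assms unfolding sphere_relations_def by (auto simp: algebra_simps eq_diff_eq)
  have star_R: "(r *\<^sub>R x)\<^sup>\<star> = r *\<^sub>R x\<^sup>\<star>" for r and x :: 'a
    by (simp add: scaleR_scaleC star_scaleC)
  have twice: "(q * 2) *\<^sub>R x = q *\<^sub>R x + q *\<^sub>R x" for x :: 'a
    by (simp only: mult_2_right scaleR_left_distrib)
  have adj: "\<alpha>\<^sup>\<star> * \<beta>\<^sup>\<star> = q *\<^sub>R (\<beta>\<^sup>\<star> * \<alpha>\<^sup>\<star>)" "\<alpha>\<^sup>\<star> * \<beta> = q *\<^sub>R (\<beta> * \<alpha>\<^sup>\<star>)"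
    "z * \<alpha>\<^sup>\<star> = \<alpha>\<^sup>\<star> * z" "z * \<beta>\<^sup>\<star> = \<beta>\<^sup>\<star> * z"
    using arg_cong[OF rel(1), of star] arg_cong[OF rel(2), of star] arg_cong[OF rel(5), of star]
      arg_cong[OF rel(6), of star]
    by (simp_all add: star_mult star_star star_R rel(4))
  have "?M ** ?M = 2 *\<^sub>R ?M"
    by (simp add: vec_eq_iff forall_4 matrix_mult_entry sum_4 vector_4)
      (simp add: algebra_simps rel adj power2_eq_square scaleR_2 twice)
  moreover have "((1/2) *\<^sub>R ?M) ** ((1/2) *\<^sub>R ?M) = (1/4) *\<^sub>R (?M ** ?M)"
    by (simp add: vec_eq_iff matrix_mult_entry scaleR_sum_right)
  ultimately show ?thesis
    by (simp add: instanton_projection_def)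
qed

section \<open>Representations on finitely supported sequences\<close>

text \<open>
  The pre-Hilbert space of the representations: the algebraic span of an orthonormal basis indexed by
  the integers.  With a two-sided index set the same family of shifts covers both $|q| < 1$ and
  $|q| = 1$.  The inner product is the real part of the hermitian one.
\<close>

typedef fin_seq = "{f :: int \<Rightarrow> complex. finite {n. f n \<noteq> 0}}"
  morphisms coord Fin_seq
  by (rule exI[of _ "\<lambda>_. 0"]) simp

setup_lifting type_definition_fin_seq

lemma finite_support: "finite {n. coord x n \<noteq> 0}"
  using coord by simp

lemma fin_seq_eqI: "(\<And>n. coord x n = coord y n) \<Longrightarrow> x = y"
  by (simp add: coord_inject[symmetric] fun_eq_iff)

instantiation fin_seq :: real_inner
begin

lift_definition zero_fin_seq :: fin_seq is "\<lambda>_. 0" by simp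

lift_definition plus_fin_seq :: "fin_seq \<Rightarrow> fin_seq \<Rightarrow> fin_seq" is "\<lambda>x y n. x n + y n"
  by (erule (1) finite_subset[OF _ finite_UnI, rotated]) auto

lift_definition minus_fin_seq :: "fin_seq \<Rightarrow> fin_seq \<Rightarrow> fin_seq" is "\<lambda>x y n. x n - y n"
  by (erule (1) finite_subset[OF _ finite_UnI, rotated]) auto

lift_definition uminus_fin_seq :: "fin_seq \<Rightarrow> fin_seq" is "\<lambda>x n. - x n"
  by simp

lift_definition scaleR_fin_seq :: "real \<Rightarrow> fin_seq \<Rightarrow> fin_seq" is "\<lambda>r x n. r *\<^sub>R x n"
  by (rule finite_subset[rotated]) auto

definition inner_fin_seq :: "fin_seq \<Rightarrow> fin_seq \<Rightarrow> real" where
  "inner_fin_seq x y = (\<Sum>n | coord x n \<noteq> 0. inner (coord x n) (coord y n))"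

definition norm_fin_seq :: "fin_seq \<Rightarrow> real" where
  "norm_fin_seq x = sqrt (inner x x)"

definition sgn_fin_seq :: "fin_seq \<Rightarrow> fin_seq" where
  "sgn_fin_seq x = inverse (norm x) *\<^sub>R x"

definition dist_fin_seq :: "fin_seq \<Rightarrow> fin_seq \<Rightarrow> real" where
  "dist_fin_seq x y = norm (x - y)"

definition uniformity_fin_seq :: "(fin_seq \<times> fin_seq) filter" where
  "uniformity_fin_seq = (INF e\<in>{0<..}. principal {(x, y). dist x y < e})"

definition open_fin_seq :: "fin_seq set \<Rightarrow> bool" where
  "open_fin_seq U \<longleftrightarrow> (\<forall>x\<in>U. \<forall>\<^sub>F (x', y) in uniformity. x' = x \<longrightarrow> y \<in> U)"

lemma inner_fin_seq_superset:
  assumes "finite S" "{n. coord x n \<noteq> 0} \<subseteq> S"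
  shows "inner x y = (\<Sum>n\<in>S. inner (coord x n) (coord y n))"
  unfolding inner_fin_seq_def using assms by (intro sum.mono_neutral_left) auto

instance
proof
  fix x y z :: fin_seq and r :: real
  let ?S = "{n. coord x n \<noteq> 0} \<union> {n. coord y n \<noteq> 0} \<union> {n. coord z n \<noteq> 0}"
  have S: "finite ?S" by (simp add: finite_support)
  show "x + y + z = x + (y + z)" "x + y = y + x" "0 + x = x" "- x + x = 0" "x - y = x + - y"
    by (transfer; simp add: algebra_simps)+
  show "r *\<^sub>R (x + y) = r *\<^sub>R x + r *\<^sub>R y" "1 *\<^sub>R x = x" for r
    by (transfer; simp add: algebra_simps)+
  show "(r + s) *\<^sub>R x = r *\<^sub>R x + s *\<^sub>R x" "r *\<^sub>R s *\<^sub>R x = (r * s) *\<^sub>R x" for r s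
    by (transfer; simp add: algebra_simps)+
  show "dist x y = norm (x - y)" by (rule dist_fin_seq_def)
  show "sgn x = inverse (norm x) *\<^sub>R x" by (rule sgn_fin_seq_def)
  show "uniformity = (INF e\<in>{0<..}. principal {(x, y :: fin_seq). dist x y < e})"
    by (rule uniformity_fin_seq_def)
  show "open U \<longleftrightarrow> (\<forall>x\<in>U. \<forall>\<^sub>F (x', y) in uniformity. x' = x \<longrightarrow> y \<in> U)" for U :: "fin_seq set"
    by (rule open_fin_seq_def)
  show "norm x = sqrt (inner x x)" by (rule norm_fin_seq_def)
  have I: "inner u v = (\<Sum>n\<in>?S. inner (coord u n) (coord v n))"
    if "u \<in> {x, y, x + y, r *\<^sub>R x}" for u v
    using that by (intro inner_fin_seq_superset S)
      (auto simp: plus_fin_seq.rep_eq scaleR_fin_seq.rep_eq)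
  show "inner x y = inner y x"
    using I[of x y] I[of y x] by (simp add: inner_commute)
  show "inner (x + y) z = inner x z + inner y z"
    using I[of "x + y" z] I[of x z] I[of y z]
    by (simp add: plus_fin_seq.rep_eq inner_add_left sum.distrib)
  show "inner (r *\<^sub>R x) y = r * inner x y"
    using I[of "r *\<^sub>R x" y] I[of x y] by (simp add: scaleR_fin_seq.rep_eq sum_distrib_left)
  show "0 \<le> inner x x"
    unfolding inner_fin_seq_def by (intro sum_nonneg) simp
  show "inner x x = 0 \<longleftrightarrow> x = 0"
  proof
    assume "inner x x = 0"
    then have "{n. coord x n \<noteq> 0} = {}"
      unfolding inner_fin_seq_def using finite_support[of x]
      by (subst (asm) sum_nonneg_eq_0_iff) auto
    then show "x = 0" by (intro fin_seq_eqI) (simp add: zero_fin_seq.rep_eq)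
  qed (simp add: inner_fin_seq_def zero_fin_seq.rep_eq)
qed

end

text \<open>
  Shifts, diagonal operators ($k = 0$) and complex scalars ($k = 0$ and constant weights) are all
  of this form, as are their adjoints.
\<close>

lift_definition weighted_shift :: "int \<Rightarrow> (int \<Rightarrow> complex) \<Rightarrow> fin_seq \<Rightarrow> fin_seq" is
  "\<lambda>k c x n. c n * x (n + k)"
proof -
  fix k :: int and c x :: "int \<Rightarrow> complex"
  assume "finite {n. x n \<noteq> 0}"
  then have "finite ((\<lambda>m. m - k) ` {n. x n \<noteq> 0})" by simp
  moreover have "{n. c n * x (n + k) \<noteq> 0} \<subseteq> (\<lambda>m. m - k) ` {n. x n \<noteq> 0}"
  proof
    fix n assume "n \<in> {n. c n * x (n + k) \<noteq> 0}"
    then show "n \<in> (\<lambda>m. m - k) ` {n. x n \<noteq> 0}"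
      by (intro image_eqI[of _ _ "n + k"]) auto
  qed
  ultimately show "finite {n. c n * x (n + k) \<noteq> 0}"
    by (rule rev_finite_subset)
qed

lemma support_weighted_shift: "{n. coord (weighted_shift k c x) n \<noteq> 0} \<subseteq> (\<lambda>m. m - k) ` {n. coord x n \<noteq> 0}"
proof
  fix n assume "n \<in> {n. coord (weighted_shift k c x) n \<noteq> 0}"
  then show "n \<in> (\<lambda>m. m - k) ` {n. coord x n \<noteq> 0}"
    by (intro image_eqI[of _ _ "n + k"]) (auto simp: weighted_shift.rep_eq)
qed

lemma inner_weighted_shift:
  "inner (weighted_shift k c x) y = inner x (weighted_shift (- k) (\<lambda>n. cnj (c (n - k))) y)"
proof -
  let ?X = "{n. coord x n \<noteq> 0}"
  let ?S = "(\<lambda>m. m - k) ` ?X"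
  have "inner (weighted_shift k c x) y = (\<Sum>n\<in>?S. inner (coord (weighted_shift k c x) n) (coord y n))"
    by (rule inner_fin_seq_superset)
      (simp_all add: finite_support support_weighted_shift)
  also have "\<dots> = (\<Sum>m\<in>?X. inner (c (m - k) * coord x m) (coord y (m - k)))"
    by (subst sum.reindex) (auto simp: inj_on_def weighted_shift.rep_eq)
  also have "\<dots> = inner x (weighted_shift (- k) (\<lambda>n. cnj (c (n - k))) y)"
    unfolding inner_fin_seq_def
    by (intro sum.cong refl) (simp add: weighted_shift.rep_eq inner_complex_def algebra_simps)
  finally show ?thesis .
qed

lemma norm_weighted_shift_le:
  assumes c: "\<And>n. cmod (c n) \<le> C"
  shows "norm (weighted_shift k c x) \<le> C * norm x"
proof -
  let ?X = "{n. coord x n \<noteq> 0}"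
  let ?S = "(\<lambda>m. m - k) ` ?X"
  have C: "0 \<le> C" using c[of 0] norm_ge_zero order_trans by blast
  have "inner (weighted_shift k c x) (weighted_shift k c x) = (\<Sum>n\<in>?S. (cmod (coord (weighted_shift k c x) n))\<^sup>2)"
    unfolding dot_square_norm[symmetric]
    by (rule inner_fin_seq_superset)
      (simp_all add: finite_support support_weighted_shift)
  also have "\<dots> = (\<Sum>m\<in>?X. (cmod (c (m - k)))\<^sup>2 * (cmod (coord x m))\<^sup>2)"
    by (subst sum.reindex) (auto simp: inj_on_def weighted_shift.rep_eq norm_mult power_mult_distrib)
  also have "\<dots> \<le> (\<Sum>m\<in>?X. C\<^sup>2 * (cmod (coord x m))\<^sup>2)"
    by (intro sum_mono mult_right_mono power_mono c) auto
  also have "\<dots> = C\<^sup>2 * inner x x"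
    by (simp add: inner_fin_seq_def dot_square_norm sum_distrib_left)
  also have "\<dots> = (C * norm x)\<^sup>2"
    by (simp add: dot_square_norm power_mult_distrib)
  finally have "(norm (weighted_shift k c x))\<^sup>2 \<le> (C * norm x)\<^sup>2"
    by (simp only: dot_square_norm)
  then show ?thesis
    by (rule power2_le_imp_le) (simp add: C)
qed

lemma bounded_linear_weighted_shift:
  assumes "\<And>n. cmod (c n) \<le> C"
  shows "bounded_linear (weighted_shift k c)"
proof (rule bounded_linear_intro)
  show "norm (weighted_shift k c x) \<le> norm x * C" for x
    using norm_weighted_shift_le[OF assms, where k = k and x = x] by (simp add: mult.commute)
  show "weighted_shift k c (x + y) = weighted_shift k c x + weighted_shift k c y" for x y
    by (rule fin_seq_eqI) (simp add: weighted_shift.rep_eq plus_fin_seq.rep_eq distrib_left)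
  show "weighted_shift k c (r *\<^sub>R x) = r *\<^sub>R weighted_shift k c x" for r x
    by (rule fin_seq_eqI) (simp add: weighted_shift.rep_eq scaleR_fin_seq.rep_eq)
qed

text \<open>
  A bounded $*$-representation of the free $*$-algebra on a real inner product space with a
  complex structure \<open>sc\<close>.  The adjoints are part of the data because a bounded operator on an
  incomplete space may have none.
\<close>

locale star_rep =
  fixes sc :: "complex \<Rightarrow> 'v::real_inner \<Rightarrow> 'v"
    and op :: "gen \<times> bool \<Rightarrow> 'v \<Rightarrow> 'v"
  assumes sc_linear: "bounded_linear (sc c)"
    and sc_add: "sc (c + d) x = sc c x + sc d x"
    and sc_sc: "sc c (sc d x) = sc (c * d) x"
    and sc_one: "sc 1 x = x"
    and norm_sc: "norm (sc c x) = cmod c * norm x"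
    and sc_adjoint: "inner (sc c x) y = inner x (sc (cnj c) y)"
    and op_linear: "bounded_linear (op l)"
    and op_sc: "op l (sc c x) = sc c (op l x)"
    and op_adjoint: "inner (op (g, s) x) y = inner x (op (g, \<not> s) y)"
begin

definition rep :: "free_star \<Rightarrow> 'v \<Rightarrow> 'v" where
  "rep p x = extend sc (\<lambda>w. foldr op w x) p"

lemma sc_zero: "sc 0 x = 0"
  using sc_add[of 0 0 x] by simp

lemma rep_single: "rep (Poly_Mapping.single w c) x = sc c (foldr op w x)"
  unfolding rep_def by (rule extend_single) (rule sc_zero)

lemma rep_add: "rep (p + r) x = rep p x + rep r x"
  unfolding rep_def by (rule extend_add) (simp_all add: sc_zero sc_add)

lemma rep_diff: "rep (p - r) x = rep p x - rep r x"
  using rep_add[of "p - r" r x] by (simp add: algebra_simps)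

lemma rep_one: "rep 1 x = x"
proof -
  have "rep (word []) x = x" unfolding rep_single by (simp add: sc_one)
  then show ?thesis by (simp add: zero_list_def[symmetric])
qed

lemma bounded_linear_word: "bounded_linear (foldr op w)"
proof (induction w)
  case Nil
  show ?case by (simp add: id_def bounded_linear_ident)
next
  case (Cons l w)
  then show ?case using bounded_linear_compose[OF op_linear] by (simp add: o_def)
qed

lemma word_sc: "foldr op w (sc c x) = sc c (foldr op w x)"
  by (induction w) (simp_all add: op_sc)

lemma bounded_linear_rep: "bounded_linear (rep p)"
proof (induction p rule: falg_induct)
  case (single w c)
  show ?case
    using bounded_linear_compose[OF sc_linear bounded_linear_word]
    by (simp add: rep_single[abs_def])
next
  case (add p r)
  then show ?case using bounded_linear_add by (simp add: rep_add[abs_def])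
qed

lemma rep_mult: "rep (p * r) x = rep p (rep r x)"
proof (induction p rule: falg_induct)
  case (single w c)
  show ?case
  proof (induction r rule: falg_induct)
    case (single v d)
    show ?case
      by (simp add: mult_single plus_list_def rep_single word_sc sc_sc mult.commute)
  next
    case (add p r)
    then show ?case
      by (simp add: distrib_left rep_add bounded_linear.linear[OF bounded_linear_rep, THEN linear_add])
  qed
qed (simp add: distrib_right rep_add)

lemma rep_scale: "rep (c \<cdot> p) x = sc c (rep p x)"
  by (simp add: fscale_def rep_mult rep_single)

lemma rep_adjoint: "inner (rep p x) y = inner x (rep (fstar p) y)"
proof (induction p rule: falg_induct)
  case (single w c)
  have "inner (foldr op w x) y = inner x (foldr op (rev (map (\<lambda>(g, s). (g, \<not> s)) w)) y)" for x y
    by (induction w arbitrary: y) (auto simp: op_adjoint)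
  then show ?case
    unfolding fstar_def
    by (subst extend_single) (simp_all add: fscale_zero fscale_single rep_single sc_adjoint word_sc)
next
  case (add p r)
  then show ?case by (simp add: fstar_add rep_add inner_add_left inner_add_right)
qed

text \<open>
  Cauchy-Schwarz applied to $\|p^*x\|^2 = \langle x, p\,p^*x\rangle$.
\<close>

lemma onorm_fstar_le: "onorm (rep (fstar p)) \<le> onorm (rep p)"
proof (rule onorm_bound[OF onorm_pos_le[OF bounded_linear_rep]])
  fix x
  let ?y = "rep (fstar p) x"
  have "norm ?y * norm ?y = inner x (rep p ?y)"
    using rep_adjoint[of p ?y x] by (simp add: inner_commute power2_norm_eq_inner flip: power2_eq_square)
  also have "\<dots> \<le> norm x * (onorm (rep p) * norm ?y)"
    by (rule order_trans[OF norm_cauchy_schwarz])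
      (intro mult_left_mono onorm[OF bounded_linear_rep] norm_ge_zero)
  finally show "norm ?y \<le> onorm (rep p) * norm x"
    using onorm_pos_le[OF bounded_linear_rep, of p]
    by (cases "norm ?y = 0") (simp_all add: algebra_simps)
qed

lemma onorm_fstar_mult: "onorm (rep (fstar p * p)) = (onorm (rep p))\<^sup>2"
proof (rule antisym)
  have comp: "rep (fstar p * p) = rep (fstar p) \<circ> rep p"
    by (simp add: fun_eq_iff rep_mult)
  have pos: "0 \<le> onorm (rep p)" by (rule onorm_pos_le[OF bounded_linear_rep])
  show "onorm (rep (fstar p * p)) \<le> (onorm (rep p))\<^sup>2"
    unfolding comp power2_eq_square
    by (rule order_trans[OF onorm_compose[OF bounded_linear_rep bounded_linear_rep]])
      (intro mult_right_mono onorm_fstar_le pos)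
  let ?N = "onorm (rep (fstar p * p))"
  have posN: "0 \<le> ?N" by (rule onorm_pos_le[OF bounded_linear_rep])
  have "onorm (rep p) \<le> sqrt ?N"
  proof (rule onorm_bound[OF real_sqrt_ge_zero[OF posN]])
    fix x
    have "(norm (rep p x))\<^sup>2 = inner x (rep (fstar p * p) x)"
      by (simp add: power2_norm_eq_inner rep_adjoint rep_mult)
    also have "\<dots> \<le> norm x * (?N * norm x)"
      by (rule order_trans[OF norm_cauchy_schwarz])
        (intro mult_left_mono onorm[OF bounded_linear_rep] norm_ge_zero)
    also have "\<dots> = (sqrt ?N * norm x)\<^sup>2"
      using posN by (simp add: power_mult_distrib power2_eq_square)
    finally have "(norm (rep p x))\<^sup>2 \<le> (sqrt ?N * norm x)\<^sup>2" .
    then show "norm (rep p x) \<le> sqrt ?N * norm x"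
      by (rule power2_le_imp_le) (simp add: posN)
  qed
  then have "(onorm (rep p))\<^sup>2 \<le> (sqrt ?N)\<^sup>2" by (intro power_mono pos)
  then show "(onorm (rep p))\<^sup>2 \<le> ?N" using posN by simp
qed

lemma cstar_seminorm_rep: "cstar_seminorm (\<lambda>p. onorm (rep p))"
  unfolding cstar_seminorm_def
proof (intro conjI allI)
  show "onorm (rep (p + r)) \<le> onorm (rep p) + onorm (rep r)" for p r
    using onorm_triangle[OF bounded_linear_rep bounded_linear_rep, of p r]
    by (simp add: rep_add[abs_def])
  show "onorm (rep (c \<cdot> p)) = cmod c * onorm (rep p)" for c p
  proof -
    have "onorm (rep (c \<cdot> p)) = onorm (\<lambda>x. cmod c *\<^sub>R rep p x)"
      by (simp add: onorm_def rep_scale norm_sc)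
    then show ?thesis by (simp add: onorm_scaleR[OF bounded_linear_rep])
  qed
  show "onorm (rep (p * r)) \<le> onorm (rep p) * onorm (rep r)" for p r
    using onorm_compose[OF bounded_linear_rep bounded_linear_rep, of p r]
    by (simp add: o_def rep_mult[abs_def])
qed (rule onorm_fstar_mult)

text \<open>
  The universality of $A_q$ in use: a relation between the generators that holds in $A_q$ holds in
  every representation of the defining relations.
\<close>

lemma rep_eq_zero:
  assumes "quantum_sphere q \<alpha> \<beta> z" "\<And>r x. r \<in> sphere_relators q \<Longrightarrow> rep r x = 0"
    and "eval_free \<alpha> \<beta> z p = 0"
  shows "rep p x = 0"
proof -
  have "onorm (rep r) = 0" if "r \<in> sphere_relators q" for r
    using assms(2)[OF that] by (simp add: onorm_eq_0[OF bounded_linear_rep])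
  then have "onorm (rep p) \<le> 0"
    using assms(1,3) cstar_seminorm_rep unfolding quantum_sphere_def
    by (metis norm_zero)
  then have "onorm (rep p) * norm x \<le> 0 * norm x" by (intro mult_right_mono) auto
  from order_trans[OF onorm[OF bounded_linear_rep] this] show ?thesis by simp
qed

end

section \<open>Linear independence of the generators\<close>

text \<open>
  The relations of the sphere for the operators $\alpha e_n = w_n e_{n+1}$, $\beta e_n = b_n e_n$,
  $z e_n = t_n e_n$ on the basis vectors $e_n$.
\<close>

definition sphere_weights :: "real \<Rightarrow> (int \<Rightarrow> real) \<Rightarrow> (int \<Rightarrow> complex) \<Rightarrow> (int \<Rightarrow> real) \<Rightarrow> bool" where
  "sphere_weights q w b t \<longleftrightarrow> (\<forall>n.
     b (n + 1) * w n = q * w n * b n \<and> t (n + 1) * w n = w n * t n \<and>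
     (w n)\<^sup>2 + q\<^sup>2 * (cmod (b n))\<^sup>2 + (t n)\<^sup>2 = 1 \<and>
     (w (n - 1))\<^sup>2 + (cmod (b n))\<^sup>2 + (t n)\<^sup>2 = 1)"

fun shift_letter :: "(int \<Rightarrow> real) \<Rightarrow> (int \<Rightarrow> complex) \<Rightarrow> (int \<Rightarrow> real) \<Rightarrow> gen \<times> bool \<Rightarrow> fin_seq \<Rightarrow> fin_seq" where
  "shift_letter w b t (GAlpha, False) = weighted_shift (- 1) (\<lambda>n. w (n - 1))"
| "shift_letter w b t (GAlpha, True) = weighted_shift 1 (\<lambda>n. w n)"
| "shift_letter w b t (GBeta, False) = weighted_shift 0 b"
| "shift_letter w b t (GBeta, True) = weighted_shift 0 (\<lambda>n. cnj (b n))"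
| "shift_letter w b t (GZ, s) = weighted_shift 0 (\<lambda>n. t n)"

lemma norm_weighted_shift_const: "norm (weighted_shift 0 (\<lambda>_. c) x) = cmod c * norm x"
proof -
  have "inner (weighted_shift 0 (\<lambda>_. c) x) (weighted_shift 0 (\<lambda>_. c) x) = (cmod c)\<^sup>2 * inner x x"
  proof -
    have "weighted_shift 0 (\<lambda>_. cnj c) (weighted_shift 0 (\<lambda>_. c) x) = (cmod c)\<^sup>2 *\<^sub>R x"
      by (rule fin_seq_eqI)
        (simp add: weighted_shift.rep_eq scaleR_fin_seq.rep_eq scaleR_conv_of_real complex_norm_square mult_ac
          del: of_real_power)
    then show ?thesis by (simp add: inner_weighted_shift)
  qed
  then show ?thesis
    by (simp add: norm_eq_sqrt_inner real_sqrt_mult)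
qed

lemma star_rep_shift:
  assumes "sphere_weights q w b t"
  shows "star_rep (\<lambda>c. weighted_shift 0 (\<lambda>_. c)) (shift_letter w b t)"
proof (rule star_rep.intro)
  have le: "\<bar>w n\<bar> \<le> 1" "cmod (b n) \<le> 1" "\<bar>t n\<bar> \<le> 1" for n
  proof -
    have 1: "(w n)\<^sup>2 + q\<^sup>2 * (cmod (b n))\<^sup>2 + (t n)\<^sup>2 = 1" "(w (n - 1))\<^sup>2 + (cmod (b n))\<^sup>2 + (t n)\<^sup>2 = 1"
      using assms by (auto simp: sphere_weights_def)
    have "0 \<le> q\<^sup>2 * (cmod (b n))\<^sup>2" "0 \<le> (t n)\<^sup>2" "0 \<le> (w (n - 1))\<^sup>2" "0 \<le> (cmod (b n))\<^sup>2"
      by auto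
    with 1 have "(w n)\<^sup>2 \<le> 1" "(cmod (b n))\<^sup>2 \<le> 1" "(t n)\<^sup>2 \<le> 1" by linarith+
    then show "\<bar>w n\<bar> \<le> 1" "cmod (b n) \<le> 1" "\<bar>t n\<bar> \<le> 1"
      by (auto simp: abs_square_le_1)
  qed
  fix c d :: complex and x y :: fin_seq and g s and l :: "gen \<times> bool"
  show "bounded_linear (weighted_shift 0 (\<lambda>_. c))"
    by (rule bounded_linear_weighted_shift[of _ "cmod c"]) simp
  show "weighted_shift 0 (\<lambda>_. c + d) x = weighted_shift 0 (\<lambda>_. c) x + weighted_shift 0 (\<lambda>_. d) x"
    by (rule fin_seq_eqI) (simp add: weighted_shift.rep_eq plus_fin_seq.rep_eq distrib_right)
  show "weighted_shift 0 (\<lambda>_. c) (weighted_shift 0 (\<lambda>_. d) x) = weighted_shift 0 (\<lambda>_. c * d) x"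
    by (rule fin_seq_eqI) (simp add: weighted_shift.rep_eq)
  show "weighted_shift 0 (\<lambda>_. 1) x = x"
    by (rule fin_seq_eqI) (simp add: weighted_shift.rep_eq)
  show "norm (weighted_shift 0 (\<lambda>_. c) x) = cmod c * norm x"
    by (rule norm_weighted_shift_const)
  show "inner (weighted_shift 0 (\<lambda>_. c) x) y = inner x (weighted_shift 0 (\<lambda>_. cnj c) y)"
    by (simp add: inner_weighted_shift)
  show "bounded_linear (shift_letter w b t l)"
    by (cases "(w, b, t, l)" rule: shift_letter.cases)
      (auto intro!: bounded_linear_weighted_shift[of _ 1] le)
  show "shift_letter w b t l (weighted_shift 0 (\<lambda>_. c) x) = weighted_shift 0 (\<lambda>_. c) (shift_letter w b t l x)"
    by (cases "(w, b, t, l)" rule: shift_letter.cases; rule fin_seq_eqI)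
      (auto simp: weighted_shift.rep_eq)
  show "inner (shift_letter w b t (g, s) x) y = inner x (shift_letter w b t (g, \<not> s) y)"
    by (cases "(w, b, t, (g, s))" rule: shift_letter.cases) (auto simp: inner_weighted_shift)
qed

text \<open>
  The coordinates of $p\,e_n$, where $p$ is the given linear combination of the generators:
  $\alpha$ raises the index, $\alpha^*$ lowers it, and the other four terms are diagonal.
\<close>

lemma shift_coordinates:
  assumes sphere: "quantum_sphere q \<alpha> \<beta> z" and wts: "sphere_weights q w b t"
    and rel: "c0 *\<^sub>C 1 + c1 *\<^sub>C \<alpha> + c2 *\<^sub>C \<alpha>\<^sup>\<star> + c3 *\<^sub>C \<beta> + c4 *\<^sub>C \<beta>\<^sup>\<star> + c5 *\<^sub>C z = 0"
  shows "c1 * w n = 0" "c2 * w n = 0" "c0 + c3 * b n + c4 * cnj (b n) + c5 * t n = 0"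
proof -
  interpret star_rep "\<lambda>c. weighted_shift 0 (\<lambda>_. c)" "shift_letter w b t"
    by (rule star_rep_shift[OF wts])
  let ?p = "Poly_Mapping.single [] c0 + Poly_Mapping.single [(GAlpha, False)] c1
    + Poly_Mapping.single [(GAlpha, True)] c2 + Poly_Mapping.single [(GBeta, False)] c3
    + Poly_Mapping.single [(GBeta, True)] c4 + Poly_Mapping.single [(GZ, False)] c5"
  have w: "b (n + 1) * w n = q * w n * b n" "t (n + 1) * w n = w n * t n"
     "(w n)\<^sup>2 + q\<^sup>2 * (cmod (b n))\<^sup>2 + (t n)\<^sup>2 = 1" "(w (n - 1))\<^sup>2 + (cmod (b n))\<^sup>2 + (t n)\<^sup>2 = 1" for n
    using wts by (auto simp: sphere_weights_def)
  have relators: "rep r x = 0" if "r \<in> sphere_relators q" for r x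
  proof (rule fin_seq_eqI)
    fix m
    have shift: "b m = q * b (m - 1)" "t m = t (m - 1)" if "w (m - 1) \<noteq> 0"
      using w(1,2)[of "m - 1"] that by simp_all
    have cshift: "cnj (b m) = q * cnj (b (m - 1))" if "w (m - 1) \<noteq> 0"
      using shift(1)[OF that] by simp
    have sq: "w m * w m + (q * q * (cnj (b m) * b m)) + t m * t m = (1 :: complex)"
      "w (m - 1) * w (m - 1) + b m * cnj (b m) + t m * t m = (1 :: complex)"
      using arg_cong[OF w(3)[of m], of complex_of_real] arg_cong[OF w(4)[of m], of complex_of_real]
      unfolding of_real_add of_real_mult complex_norm_square of_real_power[of "w _"] of_real_power[of "t _"]
        of_real_power[of q] of_real_1
      by (simp_all add: power2_eq_square mult_ac)
    have sq_coord: "w m * (w m * coord x m) + (complex_of_real q)\<^sup>2 * (cnj (b m) * (b m * coord x m))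
        + t m * (t m * coord x m) = coord x m"
      "w (m - 1) * (w (m - 1) * coord x m) + b m * (cnj (b m) * coord x m)
        + t m * (t m * coord x m) = coord x m"
      using sq[THEN arg_cong[where f = "\<lambda>s. s * coord x m"]]
      by (simp_all add: algebra_simps power2_eq_square)
    show "coord (rep r x) m = coord 0 m"
      using that
      unfolding sphere_relators_def Let_def
      by (auto simp: shift cshift sq_coord rep_diff rep_add rep_mult rep_scale rep_single rep_one minus_fin_seq.rep_eq plus_fin_seq.rep_eq
          zero_fin_seq.rep_eq weighted_shift.rep_eq)
  qed
  have "rep ?p x = 0" for x
  proof (rule rep_eq_zero[OF sphere relators])
    show "eval_free \<alpha> \<beta> z ?p = 0"
      using rel by (simp add: eval_add eval_single)
  qed
  then have coord0: "coord (rep ?p x) m = 0" for x m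
    by (simp add: zero_fin_seq.rep_eq)
  define e where "e = Fin_seq (\<lambda>m. if m = n then 1 else 0)"
  have e: "coord e m = (if m = n then 1 else 0)" for m
    by (simp add: e_def Fin_seq_inverse)
  \<comment> \<open>The coefficient of $\alpha^*$ is $w_n$ on the basis vector of index $n+1$.\<close>
  define e' where "e' = Fin_seq (\<lambda>m. if m = n + 1 then 1 else 0)"
  have e': "coord e' m = (if m = n + 1 then 1 else 0)" for m
    by (simp add: e'_def Fin_seq_inverse)
  note co = rep_add rep_single weighted_shift.rep_eq plus_fin_seq.rep_eq
  show "c1 * w n = 0"
    using coord0[of e "n + 1"] by (simp add: co e)
  show "c2 * w n = 0"
    using coord0[of e' n] by (simp add: co e')
  show "c0 + c3 * b n + c4 * cnj (b n) + c5 * t n = 0"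
    using coord0[of e n] by (simp add: co e)
qed

text \<open>
  For $|q| < 1$ this is the standard representation of quantum $SU(2)$ at $z = 0$, placed on the basis
  vectors of nonnegative index; on the others the weights are those of the character $z = 1$,
  $\alpha = \beta = 0$.  The two parts decouple because $w_{-1} = 0$.  For $|q| = 1$ the bilateral
  shift works, with $(\frac35)^2 + (\frac45)^2 = 1$.
\<close>

lemma sphere_weights_exist:
  assumes q: "q \<in> {-1..<0} \<union> {0<..1}" and u: "cmod u = 1"
  obtains w b t r where "sphere_weights q w b t" "w 0 \<noteq> 0" "t 0 = 0" "r \<noteq> 0" "b 0 = complex_of_real r * u"
proof (cases "\<bar>q\<bar> = 1")
  case True
  then have qq: "q\<^sup>2 = 1" using abs_square_eq_1 by blast
  define b where "b n = 4/5 * (if even n then u else complex_of_real q * u)" for n :: int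
  have b: "(cmod (b n))\<^sup>2 = 16/25" "b (n + 1) = q * b n" for n
    using True u qq by (auto simp: b_def norm_mult power_divide simp flip: power2_eq_square of_real_power mult.assoc)
  show thesis
    by (rule that[of "\<lambda>_. 3/5" b "\<lambda>_. 0" "4/5"])
      (simp_all add: sphere_weights_def qq b power_divide, simp add: b_def)
next
  case False
  define w where "w n = (if 0 \<le> n then sqrt (1 - q ^ (2 * nat n + 2)) else 0)" for n :: int
  define b where "b n = (if 0 \<le> n then complex_of_real (q ^ nat n) * u else 0)" for n :: int
  define t where "t n = (if 0 \<le> n then 0 else 1 :: real)" for n :: int
  have q1: "\<bar>q\<bar> < 1" using False q by auto
  have qe: "0 \<le> 1 - q ^ (2 * k + 2)" for k
    using power_le_one[of "q\<^sup>2" "k + 1"] q1 abs_square_le_1[of q] power_mult[of q 2 "k + 1"]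
    by simp
  have w2: "(w n)\<^sup>2 = (if 0 \<le> n then 1 - q ^ (2 * nat n + 2) else 0)" for n
    using qe by (simp add: w_def)
  have b2: "(cmod (b n))\<^sup>2 = (if 0 \<le> n then q ^ (2 * nat n) else 0)" for n
    using u by (simp add: b_def norm_mult power_mult_distrib norm_power power_even_abs mult.commute flip: power_mult)
  have "sphere_weights q w b t"
    unfolding sphere_weights_def
  proof (intro allI conjI)
    fix n :: int
    show "b (n + 1) * w n = q * w n * b n"
      by (simp add: b_def w_def nat_add_distrib)
    show "t (n + 1) * w n = w n * t n"
      by (simp add: t_def w_def)
    show "(w n)\<^sup>2 + q\<^sup>2 * (cmod (b n))\<^sup>2 + (t n)\<^sup>2 = 1"
      by (simp only: w2 b2 t_def power_add split: if_split) (simp add: mult.commute)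
    show "(w (n - 1))\<^sup>2 + (cmod (b n))\<^sup>2 + (t n)\<^sup>2 = 1"
    proof (cases "n \<ge> 1")
      case True
      then have "2 * nat (n - 1) + 2 = 2 * nat n" by (simp add: nat_diff_distrib)
      with True show ?thesis by (simp add: w2 b2 t_def)
    next
      case False
      then show ?thesis by (cases "n = 0") (simp_all add: w2 b2 t_def)
    qed
  qed
  moreover have "w 0 \<noteq> 0"
    using q1 abs_square_less_1[of q] by (simp add: w_def power2_eq_square)
  ultimately show thesis
    by (rule that[of w b t 1]) (simp_all add: b_def t_def)
qed

text \<open>
  The characters $z = \pm1$, $\alpha = \beta = 0$ remove $1$ and $z$; the shifts remove $\alpha$ and
  $\alpha^*$; rotating the phase of $\beta$ by $u = 1$ and $u = i$ separates $\beta$ from $\beta^*$.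
\<close>

lemma sphere_independent:
  assumes q: "q \<in> {-1..<0} \<union> {0<..1}" and sphere: "quantum_sphere q \<alpha> \<beta> z"
    and rel: "c0 *\<^sub>C 1 + c1 *\<^sub>C \<alpha> + c2 *\<^sub>C \<alpha>\<^sup>\<star> + c3 *\<^sub>C \<beta> + c4 *\<^sub>C \<beta>\<^sup>\<star> + c5 *\<^sub>C z = 0"
  shows "c0 = 0 \<and> c1 = 0 \<and> c2 = 0 \<and> c3 = 0 \<and> c4 = 0 \<and> c5 = 0"
proof -
  note coords = shift_coordinates[OF sphere _ rel]
  have "sphere_weights q (\<lambda>_. 0) (\<lambda>_. 0) (\<lambda>_. 1)" "sphere_weights q (\<lambda>_. 0) (\<lambda>_. 0) (\<lambda>_. - 1)"
    by (simp_all add: sphere_weights_def)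
  from coords(3)[OF this(1)] coords(3)[OF this(2)]
  have "c0 + c5 = 0" "c0 - c5 = 0" by simp_all
  then have "(c0 + c5) + (c0 - c5) = 0" "(c0 + c5) - (c0 - c5) = 0" by simp_all
  then have c05: "c0 = 0" "c5 = 0" by simp_all
  have gen: "c1 = 0 \<and> c2 = 0 \<and> c3 * u + c4 * cnj u = 0" if u: "cmod u = 1" for u
  proof -
    obtain w b t r where wts: "sphere_weights q w b t" and "w 0 \<noteq> 0" "t 0 = 0" "r \<noteq> 0"
      and b: "b 0 = complex_of_real r * u"
      using sphere_weights_exist[OF q u] by blast
    have "complex_of_real r * (c3 * u + c4 * cnj u) = 0"
      using coords(3)[OF wts, of 0] c05 b \<open>t 0 = 0\<close> by (simp add: algebra_simps)
    with \<open>r \<noteq> 0\<close> \<open>w 0 \<noteq> 0\<close> coords(1,2)[OF wts, of 0] show ?thesis by simp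
  qed
  from gen[of 1] gen[of \<i>] have "c3 + c4 = 0" "c3 * \<i> - c4 * \<i> = 0" by simp_all
  then have "c3 + c4 = 0" "c3 - c4 = 0"
    by (simp_all flip: left_diff_distrib)
  then have "(c3 + c4) + (c3 - c4) = 0" "(c3 + c4) - (c3 - c4) = 0" by simp_all
  then show ?thesis using c05 gen[of 1] by simp
qed

section \<open>Non-vanishing of the components\<close>

text \<open>
  Linear independence is phrased for the family, so that coincidences between its members are
  excluded as well.
\<close>

lemma linear_functionals:
  fixes v :: "'i \<Rightarrow> 'a::cstar_algebra"
  assumes I: "finite I"
    and indep: "\<And>c. (\<Sum>i\<in>I. c i *\<^sub>C v i) = 0 \<Longrightarrow> \<forall>i\<in>I. c i = 0"
  obtains f where "Vector_Spaces.linear scaleC (*) f" "\<And>i. i \<in> I \<Longrightarrow> f (v i) = g i"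
proof -
  interpret vector_space_pair "scaleC :: complex \<Rightarrow> 'a \<Rightarrow> 'a" "(*) :: complex \<Rightarrow> complex \<Rightarrow> complex"
    by unfold_locales
      (simp_all add: scaleC_add_right scaleC_add_left scaleC_scaleC scaleC_one algebra_simps)
  have inj: "inj_on v I"
  proof (rule inj_onI, rule ccontr)
    fix i j assume ij: "i \<in> I" "j \<in> I" "v i = v j" "i \<noteq> j"
    let ?c = "\<lambda>k. if k = i then 1 else if k = j then - 1 else (0 :: complex)"
    have "(\<Sum>k\<in>I. ?c k *\<^sub>C v k) = (\<Sum>k\<in>{i, j}. ?c k *\<^sub>C v k)"
      using ij I by (intro sum.mono_neutral_right) (auto simp: scaleC_zero_left)
    also have "\<dots> = 0"
      using ij scaleC_add_left[of 1 "- 1" "v j"] by (simp add: scaleC_zero_left)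
    finally show False using indep[of ?c] ij by auto
  qed
  have "vs1.independent (v ` I)"
    unfolding vs1.dependent_finite[OF finite_imageI[OF I]]
  proof (safe)
    fix u i assume *: "(\<Sum>x\<in>v ` I. u x *\<^sub>C x) = 0" "i \<in> I" "u (v i) \<noteq> 0"
    then show False
      using indep[of "u \<circ> v"] by (auto simp: sum.reindex[OF inj])
  qed
  from linear_independent_extend[OF this, of "g \<circ> inv_into I v"]
  obtain f where f: "Vector_Spaces.linear scaleC (*) f" "\<forall>x\<in>v ` I. f x = (g \<circ> inv_into I v) x"
    by blast
  show thesis
    by (rule that[OF f(1)]) (use f(2) inj in auto)
qed

text \<open>
  The functional $f_0\otimes\dots\otimes f_m$ on words.
\<close>

fun pair_word :: "('a \<Rightarrow> complex) list \<Rightarrow> 'a list \<Rightarrow> complex" where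
  "pair_word (f # fs) (x # xs) = f x * pair_word fs xs"
| "pair_word [] [] = 1"
| "pair_word _ _ = 0"

definition pairing :: "('a \<Rightarrow> complex) list \<Rightarrow> 'a falg \<Rightarrow> complex" where
  "pairing fs = extend (*) (pair_word fs)"

lemma pairing_single: "pairing fs (Poly_Mapping.single w c) = c * pair_word fs w"
  unfolding pairing_def by (rule extend_single) simp

lemma pairing_add: "pairing fs (p + r) = pairing fs p + pairing fs r"
  unfolding pairing_def by (rule extend_add) (simp_all add: algebra_simps)

lemma pairing_scale: "pairing fs (c \<cdot> p) = c * pairing fs p"
  by (induction p rule: falg_induct)
    (simp_all add: fscale_single fscale_add pairing_add pairing_single algebra_simps)

lemma pairing_zero: "pairing fs 0 = 0"
  using pairing_scale[of fs 0 0] by (simp add: fscale_zero)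

lemma pairing_uminus: "pairing fs (- p) = - pairing fs p"
  using pairing_add[of fs p "- p"] by (simp add: pairing_zero add_eq_0_iff)

lemma pairing_diff: "pairing fs (p - r) = pairing fs p - pairing fs r"
  using pairing_add[of fs p "- r"] by (simp add: pairing_uminus)

lemma pairing_slot:
  "pairing (f # fs) (slot x * p) = f x * pairing fs p"
  "pairing [f] (slot x) = f x"
proof -
  show "pairing (f # fs) (slot x * p) = f x * pairing fs p"
    by (induction p rule: falg_induct)
      (simp_all add: slot_def mult_single plus_list_def pairing_single distrib_left pairing_add)
  show "pairing [f] (slot x) = f x"
    by (simp add: slot_def pairing_single)
qed

text \<open>
  As a function of one slot, the product functional is either zero, because the lengths do not match,
  or a multiple of one of its factors, and not of the first one unless the slot is the first.
\<close>

lemma pair_word_slot: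
  obtains (zero) "\<And>x. pair_word fs (u @ x # v) = 0"
  | (slot) f c where "f \<in> set fs" "u \<noteq> [] \<Longrightarrow> f \<in> set (tl fs)" "\<And>x. pair_word fs (u @ x # v) = c * f x"
proof (induction u arbitrary: fs thesis)
  case Nil
  show ?case
  proof (cases fs)
    case Nil
    then show ?thesis by (intro Nil.prems(1)) simp
  next
    case (Cons f gs)
    then show ?thesis by (intro Nil.prems(2)[of f "pair_word gs v"]) auto
  qed
next
  case (Cons y u)
  show ?case
  proof (cases fs)
    case Nil
    then show ?thesis by (intro Cons.prems(1)) simp
  next
    case fs: (Cons f gs)
    show ?thesis
    proof (rule Cons.IH[of gs])
      assume "\<And>x. pair_word gs (u @ x # v) = 0"
      then show ?thesis by (intro Cons.prems(1)) (simp add: fs)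
    next
      fix h c assume "h \<in> set gs" "\<And>x. pair_word gs (u @ x # v) = c * h x"
      then show ?thesis by (intro Cons.prems(2)[of h "f y * c"]) (auto simp: fs)
    qed
  qed
qed

lemma pairing_degenerate:
  assumes lin: "\<And>f. f \<in> set fs \<Longrightarrow> Vector_Spaces.linear scaleC (*) f"
    and unit: "\<And>f. f \<in> set (tl fs) \<Longrightarrow> f 1 = 0"
    and "fs \<noteq> []" and "p \<in> degenerate"
  shows "pairing fs p = 0"
  using assms(4)
proof (induction rule: degenerate.induct)
  case (sum p r)
  then show ?case by (simp add: pairing_add)
next
  case (additive c u x y v)
  show ?case
    by (rule pair_word_slot[of fs u v])
      (simp_all add: pairing_scale pairing_diff pairing_single distrib_left
        module_hom.add[OF Vector_Spaces.linear.axioms(3)[OF lin]])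
next
  case (homogeneous c u k x v)
  show ?case
    by (rule pair_word_slot[of fs u v])
      (simp_all add: pairing_scale pairing_diff pairing_single
        module_hom.scale[OF Vector_Spaces.linear.axioms(3)[OF lin]])
next
  case (unit u c v)
  then show ?case
    by (rule_tac pair_word_slot[of fs u v])
      (simp_all add: pairing_scale pairing_single assms(2))
next
  case (empty c)
  then show ?case using assms(3) by (cases fs) (simp_all add: pairing_scale pairing_single)
qed

lemma cls_nonzero:
  assumes "\<And>f. f \<in> set fs \<Longrightarrow> Vector_Spaces.linear scaleC (*) f"
    and "\<And>f. f \<in> set (tl fs) \<Longrightarrow> f 1 = 0"
    and "fs \<noteq> []" and "pairing fs p \<noteq> 0"
  shows "cls p \<noteq> 0"
proof
  assume "cls p = 0"
  then have "p \<in> degenerate" using cls_eq_iff[of p 0] by (simp add: cls_hom)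
  then have "pairing fs p = 0" by (intro pairing_degenerate assms)
  with assms(4) show False ..
qed

lemma sphere_functional:
  assumes q: "q \<in> {-1..<0} \<union> {0<..1}" and sphere: "quantum_sphere q \<alpha> \<beta> z"
  obtains f where "Vector_Spaces.linear scaleC (*) f" "f 1 = 0" "f \<alpha> = ga" "f (\<alpha>\<^sup>\<star>) = ga'"
    "f \<beta> = gb" "f (\<beta>\<^sup>\<star>) = gb'" "f z = gz"
proof -
  let ?v = "(!) [1, \<alpha>, \<alpha>\<^sup>\<star>, \<beta>, \<beta>\<^sup>\<star>, z]"
  have "\<forall>i\<in>{..<6}. c i = 0" if "(\<Sum>i\<in>{..<6::nat}. c i *\<^sub>C ?v i) = 0" for c
  proof -
    have "c 0 *\<^sub>C 1 + c 1 *\<^sub>C \<alpha> + c 2 *\<^sub>C \<alpha>\<^sup>\<star> + c 3 *\<^sub>C \<beta> + c 4 *\<^sub>C \<beta>\<^sup>\<star> + c 5 *\<^sub>C z = 0"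
      using that by (simp add: eval_nat_numeral)
    from sphere_independent[OF q sphere this] show ?thesis
      by (auto simp: less_Suc_eq eval_nat_numeral)
  qed
  from linear_functionals[where v = ?v and I = "{..<6}" and g = "(!) [0, ga, ga', gb, gb', gz]",
      OF finite_lessThan this]
  obtain f where f: "Vector_Spaces.linear scaleC (*) f"
    "\<And>i. i < 6 \<Longrightarrow> f (?v i) = [0, ga, ga', gb, gb', gz] ! i"
    by auto
  show thesis
    by (rule that[OF f(1)]) (use f(2)[of 0] f(2)[of 1] f(2)[of 2] f(2)[of 3] f(2)[of 4] f(2)[of 5] in simp_all)
qed

text \<open>
  The dual functionals of $z$, $\beta$, $\beta^*$ single out one word of $ch_1$; those of $z$, $\alpha$,
  $\alpha^*$, $\beta$, $\beta^*$ single out one word of $ch_2$, whose coefficient does not depend on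
  $q$.
\<close>

lemma ch_instanton_nonzero:
  assumes q: "q \<in> {-1..<0} \<union> {0<..1}" and sphere: "quantum_sphere q \<alpha> \<beta> z"
  shows "\<bar>q\<bar> \<noteq> 1 \<Longrightarrow> ch 1 (instanton_projection q \<alpha> \<beta> z) \<noteq> 0"
    and "ch 2 (instanton_projection q \<alpha> \<beta> z) \<noteq> 0"
proof -
  note dual = sphere_functional[OF q sphere]
  obtain fz where fz: "Vector_Spaces.linear scaleC (*) fz" "fz 1 = 0" "fz \<alpha> = 0" "fz (\<alpha>\<^sup>\<star>) = 0"
    "fz \<beta> = 0" "fz (\<beta>\<^sup>\<star>) = 0" "fz z = 1" by (rule dual)
  obtain fa where fa: "Vector_Spaces.linear scaleC (*) fa" "fa 1 = 0" "fa \<alpha> = 1" "fa (\<alpha>\<^sup>\<star>) = 0"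
    "fa \<beta> = 0" "fa (\<beta>\<^sup>\<star>) = 0" "fa z = 0" by (rule dual)
  obtain fa' where fa': "Vector_Spaces.linear scaleC (*) fa'" "fa' 1 = 0" "fa' \<alpha> = 0" "fa' (\<alpha>\<^sup>\<star>) = 1"
    "fa' \<beta> = 0" "fa' (\<beta>\<^sup>\<star>) = 0" "fa' z = 0" by (rule dual)
  obtain fb where fb: "Vector_Spaces.linear scaleC (*) fb" "fb 1 = 0" "fb \<alpha> = 0" "fb (\<alpha>\<^sup>\<star>) = 0"
    "fb \<beta> = 1" "fb (\<beta>\<^sup>\<star>) = 0" "fb z = 0" by (rule dual)
  obtain fb' where fb': "Vector_Spaces.linear scaleC (*) fb'" "fb' 1 = 0" "fb' \<alpha> = 0" "fb' (\<alpha>\<^sup>\<star>) = 0"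
    "fb' \<beta> = 0" "fb' (\<beta>\<^sup>\<star>) = 1" "fb' z = 0" by (rule dual)
  note dual_values = fz fa fa' fb fb'
  note expand = pairing_add pairing_diff pairing_uminus pairing_scale pairing_slot
    distrib_left distrib_right left_diff_distrib right_diff_distrib mult.assoc
    fscale_mult_left fscale_mult_right
  show "ch 1 (instanton_projection q \<alpha> \<beta> z) \<noteq> 0" if "\<bar>q\<bar> \<noteq> 1"
  proof -
    have "1 - (complex_of_real q)\<^sup>2 \<noteq> 0"
    proof
      assume "1 - (complex_of_real q)\<^sup>2 = 0"
      then have "q\<^sup>2 = 1" by (simp flip: of_real_power)
      with that show False by (simp add: abs_square_eq_1)
    qed
    then show ?thesis
      unfolding ch_instanton
      by (intro cls_nonzero[of "[fz, fb, fb']"]) (auto simp: expand dual_values)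
  qed
  show "ch 2 (instanton_projection q \<alpha> \<beta> z) \<noteq> 0"
    unfolding ch_instanton
  proof (rule cls_nonzero[of "[fz, fa, fa', fb, fb']"])
    show "pairing [fz, fa, fa', fb, fb'] (1/32 \<cdot>
         (slot z \<otimes> c_z q (slot \<alpha>) (slot (\<alpha>\<^sup>\<star>)) (slot \<beta>) (slot (\<beta>\<^sup>\<star>)) (slot z)
          + slot \<alpha> \<otimes> c_alpha q (slot \<alpha>) (slot (\<alpha>\<^sup>\<star>)) (slot \<beta>) (slot (\<beta>\<^sup>\<star>)) (slot z)
          + slot (\<alpha>\<^sup>\<star>) \<otimes> c_alpha' q (slot \<alpha>) (slot (\<alpha>\<^sup>\<star>)) (slot \<beta>) (slot (\<beta>\<^sup>\<star>)) (slot z)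
          + slot \<beta> \<otimes> c_beta q (slot \<alpha>) (slot (\<alpha>\<^sup>\<star>)) (slot \<beta>) (slot (\<beta>\<^sup>\<star>)) (slot z)
          + slot (\<beta>\<^sup>\<star>) \<otimes> c_beta' q (slot \<alpha>) (slot (\<alpha>\<^sup>\<star>)) (slot \<beta>) (slot (\<beta>\<^sup>\<star>)) (slot z))) \<noteq> 0"
      by (simp add: pairing_scale pairing_add pairing_slot dual_values)
        (simp add: c_z_def expand dual_values)
  qed (auto simp: dual_values)
qed

section \<open>The theorem\<close>

theorem mainTheorem2:
  fixes q :: real and \<alpha> \<beta> z :: "'a::cstar_algebra"
  assumes q: "q \<in> {-1..<0} \<union> {0<..1}"
    and sphere: "quantum_sphere q \<alpha> \<beta> z"
  shows
    "let e = instanton_projection q \<alpha> \<beta> z;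
         a = slot \<alpha>; a' = slot (\<alpha>\<^sup>\<star>); b = slot \<beta>; b' = slot (\<beta>\<^sup>\<star>); t = slot z
     in
       ch 0 e = 0 \<and>
       ch 1 e = cls (1/8 \<cdot> (1 - q^2) \<cdot>
         (t \<otimes> (b \<otimes> b' - b' \<otimes> b) + b' \<otimes> (t \<otimes> b - b \<otimes> t) + b \<otimes> (b' \<otimes> t - t \<otimes> b'))) \<and>
       ch 2 e = cls (1/32 \<cdot>
         (t \<otimes> c_z q a a' b b' t + a \<otimes> c_alpha q a a' b b' t + a' \<otimes> c_alpha' q a a' b b' t
          + b \<otimes> c_beta q a a' b b' t + b' \<otimes> c_beta' q a a' b b' t)) \<and>
       (q = 1 \<longrightarrow> ch 1 e = 0) \<and>
       (\<bar>q\<bar> \<noteq> 1 \<longrightarrow> ch 1 e \<noteq> 0) \<and>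
       ch 2 e \<noteq> 0 \<and>
       hochschild_b (ch 1 e) = 0 \<and>
       connes_B (ch 0 e) = 0 \<and>
       hochschild_b (ch 2 e) = connes_B ((3/2) *\<^sub>C ch 1 e) \<and>
       bB_cycle ((3/2) *\<^sub>C ch 1 e) (ch 2 e)"
proof -
  define e where "e = instanton_projection q \<alpha> \<beta> z"
  have e: "e ** e = e"
    using sphere instanton_idempotent unfolding quantum_sphere_def e_def by blast
  note ch = ch_instanton[of q \<alpha> \<beta> z, folded e_def]
  have scale_zero: "c *\<^sub>C (0 :: 'a chain) = 0" for c
    using cls_hom(3)[of c 0] by (simp add: fscale_zero cls_hom(1))
  have zero: "hochschild_b (0 :: 'a chain) = 0" "connes_B (0 :: 'a chain) = 0"
    using cls_boundaries[of "0 :: 'a falg"]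
    by (simp_all add: cls_hom(1) extend_def A_op_def B0_def)
  have b1: "hochschild_b (ch 1 e) = 0"
    using b_ch_eq_B_ch[OF e, of 0] by (simp add: ch(1) scale_zero zero)
  have b2: "hochschild_b (ch 2 e) = connes_B ((3/2) *\<^sub>C ch 1 e)"
    using b_ch_eq_B_ch[OF e, of 1] by (simp add: numeral_2_eq_2)
  have b1': "hochschild_b ((3/2) *\<^sub>C ch 1 e) = 0"
  proof -
    have "hochschild_b (cls (c \<cdot> p)) = c *\<^sub>C hochschild_b (cls p)" for c and p :: "'a falg"
      by (simp add: cls_boundaries extend_fscale flip: cls_hom)
    then show ?thesis
      using b1 unfolding ch_def by (simp add: cls_hom scale_zero)
  qed
  have cycle: "bB_cycle ((3/2) *\<^sub>C ch 1 e) (ch 2 e)"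
    unfolding bB_cycle_def
    using ch_in_chains[of "3/2" 1 e] ch_in_chains[of 1 2 e] b1' b2
    by (simp add: ch_def cls_scale_one)
  have q1: "q = 1 \<longrightarrow> ch 1 e = 0"
    by (auto simp: ch(2) fscale_zero cls_hom(1) simp del: One_nat_def)
  show ?thesis
    unfolding Let_def e_def[symmetric]
    using ch q1 ch_instanton_nonzero[OF q sphere, folded e_def] b1 b2 cycle
    by (intro conjI impI) (simp_all add: zero)
qed

end
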